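(* Let $n\in\mathbb{N}$ and, for $i=1,\dots,n$, let $\tau_{\psi_i},\tau_{\phi_i}\in\mathbb{R}_{+}$ and put $\psi_{i}(q)=q^{-\tau_{\psi_i}}$, $\phi_{i}(q)=q^{-\tau_{\phi_i}}$ for $q\in\mathbb{N}$. Assume $\sum_{i=1}^{n}\tau_{\psi_i}\geq 1$. Let $W_{n}(\Psi,\Phi)$ be the set of $\mathbf{x}=(x_1,\dots,x_n)\in[0,1]^{n}$ for which there are infinitely many $(\mathbf{p},q)\in\mathbb{Z}^{n}\times\mathbb{N}$ such that \[ \left|x_{i}-\tfrac{p_{i}}{q}\right|<\tfrac{\psi_{i}(q)}{q}\ \text{ for each } i=1,\dots,n,\quad\text{and}\quad \left|x_{j}-\tfrac{p_{j}}{q}\right|>\tfrac{(1-\phi_{j}(q))\psi_{j}(q)}{q}\ \text{ for some } j\in\{1,\dots,n\}. \] For $j,k\in\{1,\dots,n\}$ define $\tau_{k(j)}=\tau_{\psi_j}+\tau_{\phi_j}$ if $k=j$ and $\tau_{k(j)}=\tau_{\psi_k}$ if $k\neq j$. Then \[ \dim_{H} W_{n}(\Psi,\Phi)=\max_{j=1,\dots,n}\ \min_{k=1,\dots,n}\left\{\frac{n+1+\sum_{i\neq j:\ \tau_{\psi_i}<\tau_{k(j)}}(\tau_{k(j)}-\tau_{\psi_i})+\max\{0,\tau_{k(j)}-\tau_{\psi_j}-\tau_{\phi_j}\}}{1+\tau_{k(j)}}\right\}. \]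
   Context: $\dim_{H}$ denotes Hausdorff dimension. The sum in the numerator runs over indices $i\in\{1,\dots,n\}\setminus\{j\}$ with $\tau_{\psi_i}<\tau_{k(j)}$. *)

theory Defs
  imports "HOL-Analysis.Analysis"
begin

(* The gauge diam(U)^s, with the usual conventions diam(empty)^s = 0 and
   diam(U)^0 = 1 for nonempty U; the case split is needed because 0 powr 0 = 0.
   It is only meant for bounded U, where diameter is the true diameter. *)
definition diam_pow :: "real \<Rightarrow> 'a::metric_space set \<Rightarrow> ennreal" where
  "diam_pow s U =
     (if U = {} then 0 else if s = 0 then 1 else ennreal (diameter U powr s))"

(* Covers indexed by nat include the finite ones, since sets may be empty. *)
definition hausdorff_premeasure :: "real \<Rightarrow> real \<Rightarrow> 'a::metric_space set \<Rightarrow> ennreal" where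
  "hausdorff_premeasure \<delta> s A =
     (INF U \<in> {U :: nat \<Rightarrow> 'a set. A \<subseteq> (\<Union>i. U i) \<and> (\<forall>i. bounded (U i) \<and> diameter (U i) \<le> \<delta>)}.
        (\<Sum>i. diam_pow s (U i)))"

definition hausdorff_measure :: "real \<Rightarrow> 'a::metric_space set \<Rightarrow> ennreal" where
  "hausdorff_measure s A = (SUP \<delta> \<in> {0<..}. hausdorff_premeasure \<delta> s A)"

definition hausdorff_dim :: "'a::metric_space set \<Rightarrow> ereal" where
  "hausdorff_dim A = Inf {ereal s | s. 0 \<le> s \<and> hausdorff_measure s A = 0}"

definition W_set :: "('n::finite \<Rightarrow> nat \<Rightarrow> real) \<Rightarrow> ('n \<Rightarrow> nat \<Rightarrow> real) \<Rightarrow> (real ^ 'n) set" where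
  "W_set \<Psi> \<Phi> = {x. (\<forall>i. 0 \<le> x $ i \<and> x $ i \<le> 1) \<and>
     infinite {(p :: int ^ 'n, q :: nat). q > 0 \<and>
       (\<forall>i. \<bar>x $ i - real_of_int (p $ i) / real q\<bar> < \<Psi> i q / real q) \<and>
       (\<exists>j. \<bar>x $ j - real_of_int (p $ j) / real q\<bar> > (1 - \<Phi> j q) * \<Psi> j q / real q)}}"

(* The exponent written tau_{k(j)} in mathematical notation. *)
definition tau_k :: "('n \<Rightarrow> real) \<Rightarrow> ('n \<Rightarrow> real) \<Rightarrow> 'n \<Rightarrow> 'n \<Rightarrow> real" where
  "tau_k \<tau>\<psi> \<tau>\<phi> k j = (if k = j then \<tau>\<psi> j + \<tau>\<phi> j else \<tau>\<psi> k)"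

end

theory Submission
  imports Defs "HOL-Real_Asymp.Real_Asymp"
begin

text \<open>
The points counted in \<open>W_set\<close> for a fixed index \<open>j\<close> form the limsup of shifted thin boxes: side \<open>i\<close> has length of
order \<open>q powr (- 1 - t i)\<close> with \<open>t i = tau_k \<tau>\<psi> \<tau>\<phi> i j\<close>, and the centres are \<open>p / q\<close> translated by a vector that
depends on \<open>q\<close> only. Covering these boxes by cubes of side \<open>q powr (- 1 - t k)\<close> gives the upper bound.

For the lower bound let \<open>a i = min c (t i)\<close> with \<open>c\<close> chosen such that the \<open>a i\<close> sum to 1; such \<open>c\<close> exists
because the \<open>t i\<close> sum to at least 1. A gcd count shows that among the \<open>X ^ (n + 1)\<close> or so translated rationals
of height about \<open>X\<close>, a typical one has only \<open>O (ln X)\<close> neighbours in the box with sides \<open>X powr (- 1 - a i)\<close>. The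
translation does not matter, since it merely moves the interval containing \<open>u * q' - v * q\<close>. Hence, inside any
fixed cube, one can select a positive proportion of these points that are well distributed at all smaller scales,
and spread mass evenly over the boxes around them. For a cube of side \<open>r = X powr (- 1 - \<tau>)\<close>, the Frostman bound
\<open>r powr s\<close> then amounts to \<open>s * (1 + \<tau>) < n + 1 + (\<Sum>i. max 0 (\<tau> - t i))\<close>. Both sides are piecewise linear in
\<open>\<tau>\<close>, and it suffices to check the values \<open>\<tau> = t k\<close>: this is the minimum over \<open>k\<close>. Iterating yields a Cantor set,
encoded by weights on finite families of dyadic cells.
\<close>

section \<open>Counting lattice points and close pairs of fractions\<close>

text \<open>The \<open>a i\<close> sum to 1 because a box with sides
  \<open>X powr (- 1 - a i)\<close> then has volume \<open>X powr (- (n + 1))\<close>, the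
  reciprocal of the number of points: a bounded number of neighbours is the best to hope for. The
  logarithm lost to the gcd is harmless, since the strict inequality on \<open>s\<close> leaves a
  spare factor \<open>X powr (- \<epsilon>)\<close>. The obstacle in the iteration is that constants
  must not pile up, so the mass bound carries the constant 1 throughout. At scales between the
  current cell and the spacing \<open>1 / X\<close>, new points obey only a volume bound with a
  large constant. It is paid for in advance: mass is first spread uniformly over much smaller cells,
  which gains any desired factor because \<open>s < n\<close>. No limit measure is constructed. A
  cover that is too cheap is enlarged to open boxes; compactness reduces it to finitely many boxes
  covering one finite stage, and the weights of a deep enough stage give the contradiction. The
  lower bound uses one slab of the shell in one direction \<open>j\<close> attaining the maximum;
  the upper bound covers both slabs for every \<open>j\<close>.\<close>

lemma card_dependent_functions:
  fixes T :: "'n::finite \<Rightarrow> 'a set"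
  assumes "\<And>i. finite (T i)"
  shows "finite {f. \<forall>i. f i \<in> T i}" "card {f. \<forall>i. f i \<in> T i} = (\<Prod>i\<in>UNIV. card (T i))"
proof -
  have e: "{f. \<forall>i. f i \<in> T i} = Pi\<^sub>E UNIV T" by (auto simp: PiE_def Pi_def)
  show "finite {f. \<forall>i. f i \<in> T i}" unfolding e by (rule finite_PiE) (use assms in auto)
  show "card {f. \<forall>i. f i \<in> T i} = (\<Prod>i\<in>UNIV. card (T i))" unfolding e by (rule card_PiE) auto
qed

lemma card_le_fibres:
  assumes "finite A" "\<And>y. y \<in> f ` A \<Longrightarrow> real (card {x \<in> A. f x = y}) \<le> k"
  shows "real (card A) \<le> k * real (card (f ` A))"
proof -
  have "card A = (\<Sum>y\<in>f ` A. card {x \<in> A. f x = y})"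
    using sum.image_gen[OF assms(1), of "\<lambda>_. 1::nat" f] by simp
  then have "real (card A) = (\<Sum>y\<in>f ` A. real (card {x \<in> A. f x = y}))" by simp
  also have "\<dots> \<le> (\<Sum>y\<in>f ` A. k)" by (rule sum_mono) (use assms in auto)
  finally show ?thesis by (simp add: mult.commute)
qed

text \<open>Offsets from the minimum of \<open>T\<close> are exact multiples of \<open>k\<close>, so
  dividing them by \<open>k\<close> is injective, with values between 0 and
  \<open>(hi - lo) / k\<close>.\<close>

lemma card_congruent_ints_le:
  fixes T :: "int set" and k :: int
  assumes k: "k > 0" and cong: "\<And>x y. x \<in> T \<Longrightarrow> y \<in> T \<Longrightarrow> k dvd x - y"
    and bd: "\<And>x. x \<in> T \<Longrightarrow> lo \<le> real_of_int x \<and> real_of_int x \<le> hi" and "lo \<le> hi"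
  shows "finite T" "real (card T) \<le> (hi - lo) / k + 1"
proof -
  have sub: "T \<subseteq> {\<lceil>lo\<rceil>..\<lfloor>hi\<rfloor>}"
    using bd by (auto simp: ceiling_le_iff le_floor_iff)
  then show fin: "finite T" using finite_subset by blast
  show "real (card T) \<le> (hi - lo) / k + 1"
  proof (cases "T = {}")
    case True then show ?thesis using k \<open>lo \<le> hi\<close> by simp
  next
    case False
    define m where "m = Min T"
    have m: "m \<in> T" "\<And>x. x \<in> T \<Longrightarrow> m \<le> x" using False fin by (auto simp: m_def)
    define N where "N = \<lfloor>(hi - lo) / k\<rfloor>"
    have N: "N \<ge> 0" using k \<open>lo \<le> hi\<close> by (simp add: N_def)
    have "card T \<le> card {0..N}"
    proof (rule card_inj_on_le)
      show "inj_on (\<lambda>x. (x - m) div k) T"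
      proof (rule inj_onI)
        fix x y assume x: "x \<in> T" and y: "y \<in> T" and e: "(x - m) div k = (y - m) div k"
        have "x - m = k * ((x - m) div k)" "y - m = k * ((y - m) div k)"
          using cong[OF x m(1)] cong[OF y m(1)] by simp_all
        then have "x - m = y - m" unfolding e by (rule trans[OF _ sym])
        then show "x = y" by simp
      qed
      show "(\<lambda>x. (x - m) div k) ` T \<subseteq> {0..N}"
      proof safe
        fix x assume x: "x \<in> T"
        have e: "x - m = k * ((x - m) div k)" using cong[OF x m(1)] by simp
        from arg_cong[OF e, of real_of_int]
        have "real_of_int x - real_of_int m = real_of_int k * real_of_int ((x - m) div k)"
          by (simp only: of_int_diff of_int_mult)
        moreover have "real_of_int x - real_of_int m \<le> hi - lo" using bd[OF x] bd[OF m(1)] by simp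
        ultimately have "real_of_int ((x - m) div k) \<le> (hi - lo) / k"
          using k by (simp add: field_simps)
        then show "(x - m) div k \<in> {0..N}" using m(2)[OF x] k
          by (auto simp: N_def le_floor_iff pos_imp_zdiv_nonneg_iff)
      qed
    qed auto
    then have "real (card T) \<le> real_of_int N + 1" using N by simp
    then show ?thesis unfolding N_def by linarith
  qed
qed

lemma card_ints_le:
  assumes "lo \<le> hi"
  shows "finite {p::int. lo \<le> real_of_int p \<and> real_of_int p \<le> hi}"
    "real (card {p::int. lo \<le> real_of_int p \<and> real_of_int p \<le> hi}) \<le> hi - lo + 1"
proof -
  let ?T = "{p::int. lo \<le> real_of_int p \<and> real_of_int p \<le> hi}"
  show "finite ?T" by (rule card_congruent_ints_le[of 1 _ lo hi]) (use assms in simp_all)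
  have "real (card ?T) \<le> (hi - lo) / real_of_int 1 + 1"
    by (rule card_congruent_ints_le) (use assms in simp_all)
  then show "real (card ?T) \<le> hi - lo + 1" by simp
qed

lemma card_ints_ge:
  "real (card {p::int. lo \<le> real_of_int p \<and> real_of_int p \<le> hi}) \<ge> hi - lo - 1"
proof -
  have "{p::int. lo \<le> real_of_int p \<and> real_of_int p \<le> hi} = {\<lceil>lo\<rceil>..\<lfloor>hi\<rfloor>}"
    by (auto simp: ceiling_le_iff le_floor_iff)
  moreover have "real (card {\<lceil>lo\<rceil>..\<lfloor>hi\<rfloor>}) \<ge> hi - lo - 1"
    by (simp add: nat_eq_iff) linarith
  ultimately show ?thesis by simp
qed

text \<open>Each value \<open>u * q' - v * q\<close>, necessarily a multiple of \<open>d = gcd q q'\<close>, is attained at most \<open>d + 1\<close> times.\<close>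
lemma card_close_fractions:
  fixes q q' :: nat and \<sigma> \<sigma>' r :: real
  assumes q: "q > 0" "q' > 0" and l: "r \<ge> 0"
  defines "T \<equiv> {(u::int, v::int). 0 \<le> u / q + \<sigma> \<and> u / q + \<sigma> < 1 \<and> 0 \<le> v / q' + \<sigma>' \<and> v / q' + \<sigma>' < 1
      \<and> \<bar>(u / q + \<sigma>) - (v / q' + \<sigma>')\<bar> \<le> r}"
  shows "finite T" "real (card T) \<le> 4 * r * q * q' + 2 * gcd q q'"
proof -
  define d where "d = gcd q q'"
  have d: "d > 0" using q by (simp add: d_def)
  have uT: "real q * (-\<sigma>) \<le> u \<and> u \<le> real q * (1 - \<sigma>) \<and> real q' * (-\<sigma>') \<le> v \<and> v \<le> real q' * (1 - \<sigma>')"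
    if "(u, v) \<in> T" for u v
  proof -
    have e: "real q * (u / q) = u" "real q' * (v / q') = v" using q by auto
    have "-\<sigma> \<le> u / q" "u / q \<le> 1 - \<sigma>" "-\<sigma>' \<le> v / q'" "v / q' \<le> 1 - \<sigma>'"
      using that by (auto simp: T_def)
    from this(1,2)[THEN mult_left_mono, of "real q"] this(3,4)[THEN mult_left_mono, of "real q'"]
    show ?thesis unfolding e by simp
  qed
  have "T \<subseteq> {p::int. real q * (-\<sigma>) \<le> p \<and> p \<le> real q * (1 - \<sigma>)} \<times> {p::int. real q' * (-\<sigma>') \<le> p \<and> p \<le> real q' * (1 - \<sigma>')}"
    using uT by auto
  moreover have "finite \<dots>" 
    by (intro finite_cartesian_product card_ints_le) (auto simp: algebra_simps)
  ultimately show fin: "finite T" using finite_subset by blast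
  define m where "m = (\<lambda>(u::int, v::int). u * int q' - v * int q)"
  have im: "real (card (m ` T)) \<le> (2 * r * q * q') / d + 1"
  proof -
    define c where "c = real q * real q' * (\<sigma>' - \<sigma>)"
    have *: "real (card (m ` T)) \<le> ((c + r * q * q') - (c - r * q * q')) / real_of_int (int d) + 1"
    proof (rule card_congruent_ints_le)
      have dv: "int d dvd x" if "x \<in> m ` T" for x
        using that unfolding d_def m_def by (auto intro!: dvd_diff dvd_mult)
      show "\<And>x y. x \<in> m ` T \<Longrightarrow> y \<in> m ` T \<Longrightarrow> int d dvd x - y" using dv by (meson dvd_diff)
      show "c - r * q * q' \<le> real_of_int x \<and> real_of_int x \<le> c + r * q * q'" if "x \<in> m ` T" for x
      proof -
        obtain u v where uv: "(u, v) \<in> T" "x = u * int q' - v * int q" using \<open>x \<in> m ` T\<close> by (auto simp: m_def)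
        have "real_of_int x - c = real q * real q' * ((u / q + \<sigma>) - (v / q' + \<sigma>'))"
          using q by (simp add: uv(2) c_def field_simps)
        then have "\<bar>real_of_int x - c\<bar> = real q * real q' * \<bar>(u / q + \<sigma>) - (v / q' + \<sigma>')\<bar>"
          by (simp add: abs_mult)
        also have "\<dots> \<le> real q * real q' * r" using uv(1) by (intro mult_left_mono) (auto simp: T_def)
        finally have "\<bar>real_of_int x - c\<bar> \<le> r * q * q'" by (simp add: mult_ac)
        then show ?thesis by linarith
      qed
    qed (use d l in auto)
    then show ?thesis by simp
  qed
  \<comment> \<open>Equal values force \<open>u\<close> into one residue class modulo
    \<open>q / d\<close>, by coprimality of the cofactors, and \<open>u\<close> determines
    \<open>v\<close>. As \<open>u\<close> runs through an interval of length \<open>q\<close>, at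
    most \<open>d + 1 \<le> 2 * d\<close> pairs remain.\<close>
  have fib: "real (card {x \<in> T. m x = y}) \<le> 2 * d" for y
  proof -
    let ?F = "{x \<in> T. m x = y}"
    have inj: "inj_on fst ?F" using q by (auto simp: inj_on_def m_def)
    have qd': "q div d > 0" using q d unfolding div_greater_zero_iff by (simp add: d_def dvd_imp_le)
    then have qd: "int q div int d > 0" by (simp flip: of_nat_div)
    have "real (card (fst ` ?F)) \<le> (real q * (1 - \<sigma>) - real q * (-\<sigma>)) / real_of_int (int q div int d) + 1"
    proof (rule card_congruent_ints_le[OF qd])
      fix x x' assume "x \<in> fst ` ?F" "x' \<in> fst ` ?F"
      then obtain v v' where "m (x, v) = y" "m (x', v') = y" by auto
      then have "(x - x') * int q' = (v - v') * int q" by (auto simp: m_def algebra_simps)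
      have e: "int q = int d * (int q div int d)" "int q' = int d * (int q' div int d)"
        unfolding d_def by simp_all
      define A B where "A = int q div int d" and "B = int q' div int d"
      have "(x - x') * (int d * B) = (v - v') * (int d * A)"
        using \<open>(x - x') * int q' = (v - v') * int q\<close> unfolding A_def B_def e(1)[symmetric] e(2)[symmetric] .
      then have "int d * ((x - x') * (int q' div int d)) = int d * ((v - v') * (int q div int d))"
        unfolding A_def[symmetric] B_def[symmetric] by (simp only: mult.left_commute)
      then have "(x - x') * (int q' div int d) = (v - v') * (int q div int d)" using d by simp
      then have "int q div int d dvd (x - x') * (int q' div int d)" by simp
      moreover have "coprime (int q div int d) (int q' div int d)"
        using div_gcd_coprime[of "int q" "int q'"] q by (simp add: d_def)
      ultimately show "int q div int d dvd x - x'" by (simp add: coprime_dvd_mult_left_iff)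
    qed (use uT in \<open>auto simp: algebra_simps\<close>)
    also have "\<dots> = d + 1"
    proof -
      have "real q = real d * real (q div d)" unfolding d_def
        by (metis dvd_mult_div_cancel gcd_dvd1 of_nat_mult)
      moreover note qd'
      moreover have "real_of_int (int q div int d) = real (q div d)" by (simp flip: of_nat_div)
      ultimately show ?thesis by (simp add: algebra_simps)
    qed
    also have "\<dots> \<le> 2 * d" using d by simp
    finally show ?thesis by (simp add: card_image[OF inj])
  qed
  have "real (card T) \<le> (2 * d) * real (card (m ` T))" by (rule card_le_fibres[OF fin fib])
  also have "\<dots> \<le> (2 * d) * ((2 * r * q * q') / d + 1)" by (rule mult_left_mono[OF im]) auto
  also have "\<dots> = 4 * r * q * q' + 2 * d" using d by (simp add: field_simps)
  finally show "real (card T) \<le> 4 * r * q * q' + 2 * gcd q q'" by (simp add: d_def)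
qed

section \<open>Averages of gcds, and the selection of uncrowded points\<close>

lemma harm_le_ln: "n > 0 \<Longrightarrow> (\<Sum>d=1..n. 1 / real d) \<le> 1 + ln n"
proof (induction n rule: nat_induct_non_zero)
  case (Suc n)
  have "ln (real n / real (Suc n)) \<le> real n / real (Suc n) - 1" using Suc by (intro ln_le_minus_one) auto
  also have "\<dots> = - 1 / Suc n" by (simp add: field_simps)
  finally have "1 / Suc n \<le> ln (Suc n) - ln n" using Suc by (simp add: ln_div)
  then show ?case using Suc by simp
qed simp

text \<open>Being a common divisor itself, \<open>gcd q q'\<close> is at most the sum of all common
  divisors. After exchanging sums, \<open>d\<close> is weighted with the square of the number of its
  multiples, at most \<open>(X / d)^2\<close>, and \<open>X^2\<close> times a harmonic sum
  remains.\<close>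

lemma sum_gcd_le:
  assumes "X > 0"
  shows "(\<Sum>q=1..X. \<Sum>q'=1..X. real (gcd q q')) \<le> real X ^ 2 * (1 + ln X)"
proof -
  have "(\<Sum>q=1..X. \<Sum>q'=1..X. real (gcd q q'))
      \<le> (\<Sum>q=1..X. \<Sum>q'=1..X. \<Sum>d=1..X. if d dvd q \<and> d dvd q' then real d else 0)"
  proof (intro sum_mono)
    fix q q' assume q: "q \<in> {1..X}" "q' \<in> {1..X}"
    have "gcd q q' \<le> q" using q by (simp add: dvd_imp_le)
    moreover have "gcd q q' > 0" using q by simp
    ultimately have "gcd q q' \<in> {1..X}" using q unfolding atLeastAtMost_iff by linarith
    then have "(\<Sum>d\<in>{gcd q q'}. if d dvd q \<and> d dvd q' then real d else 0)
       \<le> (\<Sum>d=1..X. if d dvd q \<and> d dvd q' then real d else 0)"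
      by (intro sum_mono2) auto
    then show "real (gcd q q') \<le> (\<Sum>d=1..X. if d dvd q \<and> d dvd q' then real d else 0)" by simp
  qed
  also have "\<dots> = (\<Sum>d=1..X. \<Sum>q=1..X. \<Sum>q'=1..X. if d dvd q \<and> d dvd q' then real d else 0)"
    by (subst sum.swap, subst (2) sum.swap, rule refl)
  also have "\<dots> = (\<Sum>d=1..X. real d * real (card {q\<in>{1..X}. d dvd q}) ^ 2)"
  proof (rule sum.cong[OF refl])
    fix d
    have "(\<Sum>q=1..X. \<Sum>q'=1..X. if d dvd q \<and> d dvd q' then real d else 0)
       = (\<Sum>q=1..X. \<Sum>q'=1..X. real d * (of_bool (d dvd q) * of_bool (d dvd q')))"
      by (intro sum.cong refl) auto
    also have "\<dots> = real d * ((\<Sum>q=1..X. of_bool (d dvd q)) * (\<Sum>q=1..X. of_bool (d dvd q)))"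
      by (subst sum_product) (simp only: sum_distrib_left)
    also have "(\<Sum>q=1..X. of_bool (d dvd q)) = real (card {q\<in>{1..X}. d dvd q})"
      by (simp add: of_bool_def sum.If_cases Int_def)
    finally show "(\<Sum>q=1..X. \<Sum>q'=1..X. if d dvd q \<and> d dvd q' then real d else 0) =
       real d * real (card {q\<in>{1..X}. d dvd q}) ^ 2" by (simp add: power2_eq_square)
  qed
  also have "\<dots> \<le> (\<Sum>d=1..X. real X ^ 2 * (1 / real d))"
  proof (rule sum_mono)
    fix d assume d: "d \<in> {1..X}"
    have "card {q\<in>{1..X}. d dvd q} \<le> card {1..X div d}"
    proof (rule card_inj_on_le)
      show "inj_on (\<lambda>q. q div d) {q\<in>{1..X}. d dvd q}" by (auto simp: inj_on_def)
      show "(\<lambda>q. q div d) ` {q\<in>{1..X}. d dvd q} \<subseteq> {1..X div d}"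
        using d by (auto simp: div_le_mono div_greater_zero_iff Suc_le_eq dvd_imp_le)
    qed auto
    then have "real (card {q\<in>{1..X}. d dvd q}) \<le> real (X div d)" by simp
    also have "\<dots> \<le> real X / real d" by (rule of_nat_div_le_of_nat)
    finally have "real (card {q\<in>{1..X}. d dvd q}) ^ 2 \<le> (real X / real d) ^ 2" by (intro power_mono) auto
    then have "real d * real (card {q\<in>{1..X}. d dvd q}) ^ 2 \<le> real d * (real X / real d) ^ 2"
      by (intro mult_left_mono) auto
    also have "\<dots> = real X ^ 2 * (1 / real d)" using d by (simp add: power2_eq_square field_simps)
    finally show "real d * real (card {q\<in>{1..X}. d dvd q}) ^ 2 \<le> real X ^ 2 * (1 / real d)" .
  qed
  also have "\<dots> = real X ^ 2 * (\<Sum>d=1..X. 1 / real d)" by (simp add: sum_distrib_left)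
  also have "\<dots> \<le> real X ^ 2 * (1 + ln X)" by (intro mult_left_mono harm_le_ln assms) auto
  finally show ?thesis .
qed

text \<open>Markov's inequality: each point outside \<open>G\<close> accounts for more than
  \<open>H\<close> related pairs.\<close>

lemma card_crowded_points_le:
  fixes H :: real and U :: "'a set" and R :: "'a \<Rightarrow> 'a \<Rightarrow> bool"
  assumes "finite U" "H > 0"
  defines "G \<equiv> {z \<in> U. real (card {z' \<in> U. R z z'}) \<le> H}"
  shows "real (card (U - G)) * H \<le> real (card {(z, z'). z \<in> U \<and> z' \<in> U \<and> R z z'})"
proof -
  have "{(z, z'). z \<in> U \<and> z' \<in> U \<and> R z z'} = (SIGMA z:U. {z' \<in> U. R z z'})" by auto
  then have "real (card {(z, z'). z \<in> U \<and> z' \<in> U \<and> R z z'}) = (\<Sum>z\<in>U. real (card {z' \<in> U. R z z'}))"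
    using assms by simp
  also have "\<dots> \<ge> (\<Sum>z\<in>U - G. real (card {z' \<in> U. R z z'}))"
    by (rule sum_mono2) (use assms in auto)
  also have "(\<Sum>z\<in>U - G. real (card {z' \<in> U. R z z'})) \<ge> (\<Sum>z\<in>U - G. H)"
    by (rule sum_mono) (auto simp: G_def)
  finally show ?thesis by simp
qed

text \<open>Cut the box into a grid with sides \<open>r i\<close>. Points of one grid box are
  neighbours in the sense of \<open>nb\<close>, so it holds at most \<open>H\<close> of them, and
  the product bounds the number of grid boxes. A neighbour bound at one scale thus controls boxes of
  every shape.\<close>

lemma card_box_le:
  fixes f :: "'a \<Rightarrow> 'n::finite \<Rightarrow> real" and r len :: "'n \<Rightarrow> real"
  assumes fin: "finite G" and r: "\<And>i. r i > 0" and len: "\<And>i. len i \<ge> 0" and "H \<ge> 0"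
    and nb: "\<And>z. z \<in> G \<Longrightarrow> real (card {z' \<in> G. \<forall>i. \<bar>f z i - f z' i\<bar> \<le> r i}) \<le> H"
  shows "real (card {z \<in> G. \<forall>i. lo i \<le> f z i \<and> f z i \<le> lo i + len i}) \<le> H * (\<Prod>i\<in>UNIV. len i / r i + 1)"
proof -
  let ?A = "{z \<in> G. \<forall>i. lo i \<le> f z i \<and> f z i \<le> lo i + len i}"
  define g where "g = (\<lambda>z i. \<lfloor>(f z i - lo i) / r i\<rfloor>)"
  have fibre: "real (card {z \<in> ?A. g z = y}) \<le> H" if "y \<in> g ` ?A" for y
  proof -
    obtain z where z: "z \<in> ?A" "g z = y" using \<open>y \<in> g ` ?A\<close> by auto
    have "{z \<in> ?A. g z = y} \<subseteq> {z' \<in> G. \<forall>i. \<bar>f z i - f z' i\<bar> \<le> r i}"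
    proof (rule subsetI, rule CollectI, intro conjI allI)
      fix z' i assume "z' \<in> {z \<in> ?A. g z = y}"
      then show "z' \<in> G" by simp
      have "g z' = y" using \<open>z' \<in> {z \<in> ?A. g z = y}\<close> by simp
      then have "\<lfloor>(f z i - lo i) / r i\<rfloor> = \<lfloor>(f z' i - lo i) / r i\<rfloor>" using z(2) by (metis g_def)
      then have "\<bar>(f z i - lo i) / r i - (f z' i - lo i) / r i\<bar> \<le> 1" by linarith
      then have "\<bar>(f z i - f z' i) / r i\<bar> \<le> 1" by (simp add: diff_divide_distrib)
      then show "\<bar>f z i - f z' i\<bar> \<le> r i" using r[of i] by (simp add: abs_divide divide_le_eq)
    qed
    then have "card {z \<in> ?A. g z = y} \<le> card {z' \<in> G. \<forall>i. \<bar>f z i - f z' i\<bar> \<le> r i}"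
      by (intro card_mono) (use fin in auto)
    also have "real \<dots> \<le> H" using nb z by auto
    finally show ?thesis by simp
  qed
  have "g ` ?A \<subseteq> {h. \<forall>i. h i \<in> {0..\<lfloor>len i / r i\<rfloor>}}"
  proof safe
    fix z i assume z: "\<forall>i. lo i \<le> f z i \<and> f z i \<le> lo i + len i"
    have "0 \<le> (f z i - lo i) / r i" "(f z i - lo i) / r i \<le> len i / r i"
      using z r[of i] by (auto intro!: divide_nonneg_pos divide_right_mono simp: less_imp_le algebra_simps)
    then show "g z i \<in> {0..\<lfloor>len i / r i\<rfloor>}" by (auto simp: g_def floor_mono)
  qed
  then have "card (g ` ?A) \<le> card {h::'n \<Rightarrow> int. \<forall>i. h i \<in> {0..\<lfloor>len i / r i\<rfloor>}}"
    by (intro card_mono card_dependent_functions) auto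
  also have "\<dots> = (\<Prod>i\<in>UNIV. card {0..\<lfloor>len i / r i\<rfloor>})" by (rule card_dependent_functions) auto
  also have "real \<dots> \<le> (\<Prod>i\<in>UNIV. len i / r i + 1)"
    unfolding of_nat_prod
  proof (rule prod_mono)
    fix i
    have "len i / r i \<ge> 0" using r[of i] len[of i] by simp
    then show "0 \<le> real (card {0..\<lfloor>len i / r i\<rfloor>}) \<and> real (card {0..\<lfloor>len i / r i\<rfloor>}) \<le> len i / r i + 1"
      by simp
  qed
  finally have "H * real (card (g ` ?A)) \<le> H * (\<Prod>i\<in>UNIV. len i / r i + 1)"
    using \<open>H \<ge> 0\<close> by (intro mult_left_mono) auto
  moreover have "real (card ?A) \<le> H * real (card (g ` ?A))"
    by (rule card_le_fibres) (use fin fibre in auto)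
  ultimately show ?thesis by linarith
qed

text \<open>A point is a pair \<open>(q, p)\<close>. Despite the name, this vector serves later as
  the lower corner of a box extending upwards by \<open>\<rho> i\<close> in direction
  \<open>i\<close>.\<close>

definition ctr :: "(nat \<Rightarrow> 'n \<Rightarrow> real) \<Rightarrow> nat \<times> ('n \<Rightarrow> int) \<Rightarrow> 'n \<Rightarrow> real" where
  "ctr sh z i = real_of_int (snd z i) / real (fst z) + sh (fst z) i"

definition unit_pts :: "(nat \<Rightarrow> 'n \<Rightarrow> real) \<Rightarrow> nat \<Rightarrow> (nat \<times> ('n \<Rightarrow> int)) set" where
  "unit_pts sh Q = {z. Q < fst z \<and> fst z \<le> 2 * Q \<and> (\<forall>i. 0 \<le> ctr sh z i \<and> ctr sh z i < 1)}"

lemma prod_powr_const: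
  fixes X :: real
  assumes "X > 0" "finite A"
  shows "(\<Prod>i\<in>A. X powr f i) = X powr (\<Sum>i\<in>A. f i)"
  using assms(2,1) by (induction A) (auto simp: powr_add)

text \<open>For fixed denominators with gcd \<open>d\<close> the coordinates are independent, and
  coordinate \<open>i\<close> admits at most \<open>6 * X powr (1 - a i) * d powr a i\<close> pairs
  of numerators. As the \<open>a i\<close> sum to 1, the product is
  \<open>6 ^ n * X ^ (n - 1) * d\<close>: linear in the gcd, so \<open>sum_gcd_le\<close> costs a
  single logarithm.\<close>

lemma card_close_pairs_le:
  fixes sh :: "nat \<Rightarrow> 'n::finite \<Rightarrow> real" and a :: "'n \<Rightarrow> real"
  assumes Q: "Q > 0" and a: "\<And>i. 0 \<le> a i \<and> a i \<le> 1" "(\<Sum>i\<in>UNIV. a i) = 1"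
  defines "X \<equiv> 2 * Q"
  shows "finite (unit_pts sh Q)"
    and "real (card {(z, z'). z \<in> unit_pts sh Q \<and> z' \<in> unit_pts sh Q
            \<and> (\<forall>i. \<bar>ctr sh z i - ctr sh z' i\<bar> \<le> real X powr (- 1 - a i))})
        \<le> 6 ^ CARD('n) * real X ^ (CARD('n) + 1) * (1 + ln X)"
proof -
  let ?n = "CARD('n)"
  have X: "X > 0" "real X \<ge> 1" using Q by (auto simp: X_def)
  define T where "T q q' i = {(u::int, v::int). 0 \<le> u / real q + sh q i \<and> u / real q + sh q i < 1
      \<and> 0 \<le> v / real q' + sh q' i \<and> v / real q' + sh q' i < 1
      \<and> \<bar>(u / real q + sh q i) - (v / real q' + sh q' i)\<bar> \<le> real X powr (- 1 - a i)}" for q q' i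
  have T: "finite (T q q' i)" "real (card (T q q' i)) \<le> 4 * real X powr (- 1 - a i) * q * q' + 2 * gcd q q'"
    if "q > 0" "q' > 0" for q q' i
    unfolding T_def using card_close_fractions[OF that, of "real X powr (- 1 - a i)" "sh q i" "sh q' i"] by auto
  define B where "B = (SIGMA (q, q'):{1..X} \<times> {1..X}. {f. \<forall>i. f i \<in> T q q' i})"
  have finT: "finite {f. \<forall>i. f i \<in> T q q' i}" if "(q, q') \<in> {1..X} \<times> {1..X}" for q q'
    by (rule card_dependent_functions) (use that in \<open>auto intro!: T\<close>)
  have finB: "finite B" unfolding B_def using finT by (intro finite_SigmaI) auto
  define h :: "(nat \<times> ('n \<Rightarrow> int)) \<times> (nat \<times> ('n \<Rightarrow> int)) \<Rightarrow> _"
    where "h = (\<lambda>((q, p), (q', p')). ((q, q'), (\<lambda>i. (p i, p' i))))"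
  have inj: "inj_on h S" for S
    by (auto simp: inj_on_def h_def fun_eq_iff)
  let ?P = "{(z, z'). z \<in> unit_pts sh Q \<and> z' \<in> unit_pts sh Q
            \<and> (\<forall>i. \<bar>ctr sh z i - ctr sh z' i\<bar> \<le> real X powr (- 1 - a i))}"
  have sub: "h ` ?P \<subseteq> B"
    by (auto simp: h_def B_def unit_pts_def T_def ctr_def X_def)
  have finP: "finite ?P" using inj_on_finite[OF inj sub finB] .
  have "(\<lambda>z. (z, z)) ` unit_pts sh Q \<subseteq> ?P" by auto
  then have "finite ((\<lambda>z. (z, z)) ` unit_pts sh Q)" using finP by (rule finite_subset)
  then show "finite (unit_pts sh Q)" by (rule finite_imageD) (auto simp: inj_on_def)
  have "real (card ?P) \<le> real (card B)"
    using card_inj_on_le[OF inj sub finB] by simp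
  also have "\<dots> = (\<Sum>(q, q')\<in>{1..X} \<times> {1..X}. real (\<Prod>i\<in>UNIV. card (T q q' i)))"
    unfolding B_def by (subst card_SigmaI) (use finT T in \<open>auto simp: card_dependent_functions intro!: sum.cong\<close>)
  also have "\<dots> \<le> (\<Sum>(q, q')\<in>{1..X} \<times> {1..X}. 6 ^ ?n * real X ^ (?n - 1) * gcd q q')"
  proof (rule sum_mono, clarify)
    fix q q' assume q: "q \<in> {1..X}" "q' \<in> {1..X}"
    define d where "d = gcd q q'"
    have "d \<le> q" "d > 0" using q by (auto simp: d_def dvd_imp_le)
    then have d: "1 \<le> real d" "real d \<le> real X" using q by auto
    have "real (\<Prod>i\<in>UNIV. card (T q q' i)) \<le> (\<Prod>i\<in>UNIV. 6 * (real X powr (1 - a i) * real d powr a i))"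
      unfolding of_nat_prod
    proof (rule prod_mono, rule conjI)
      fix i
      have "real (card (T q q' i)) \<le> 4 * real X powr (- 1 - a i) * q * q' + 2 * d"
        unfolding d_def by (rule T) (use q in auto)
      also have "4 * real X powr (- 1 - a i) * q * q' \<le> 4 * real X powr (- 1 - a i) * X * X"
        using q by (intro mult_mono) auto
      also have "\<dots> = 4 * real X powr (1 - a i)"
        using X by (simp add: powr_diff powr_minus field_simps)
      finally have 1: "real (card (T q q' i)) \<le> 4 * real X powr (1 - a i) + 2 * real d" by simp
      \<comment> \<open>Since \<open>1 \<le> d \<le> X\<close>, both \<open>X powr (1 - a i)\<close>
        and \<open>d\<close> are at most the interpolated value
        \<open>X powr (1 - a i) * d powr a i\<close>; the constant 6 is 4 + 2.\<close>
      have 2: "real X powr (1 - a i) \<le> real X powr (1 - a i) * real d powr a i"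
        using d a(1)[of i] ge_one_powr_ge_zero[of "real d" "a i"] by (simp add: mult_le_cancel_left1)
      have "real d = real d powr (1 - a i) * real d powr a i"
        using d by (simp flip: powr_add)
      also have "\<dots> \<le> real X powr (1 - a i) * real d powr a i"
        using d a(1)[of i] by (intro mult_right_mono powr_mono2) auto
      finally show "real (card (T q q' i)) \<le> 6 * (real X powr (1 - a i) * real d powr a i)"
        using 1 2 by linarith
    qed simp
    also have "\<dots> = 6 ^ ?n * (real X powr (\<Sum>i\<in>UNIV. 1 - a i) * real d powr (\<Sum>i\<in>UNIV. a i))"
      using d by (simp add: prod.distrib prod_powr_const)
    also have "(\<Sum>i\<in>UNIV. 1 - a i) = real (?n - 1)"
      by (simp add: sum_subtractf a(2) of_nat_diff Suc_leI)
    also have "6 ^ ?n * (real X powr real (?n - 1) * real d powr (\<Sum>i\<in>UNIV. a i)) = 6 ^ ?n * real X ^ (?n - 1) * d"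
      using powr_realpow[of "real X" "?n - 1"] X d a(2) by (simp only: of_nat_0_less_iff) simp
    finally show "real (\<Prod>i\<in>UNIV. card (T q q' i)) \<le> 6 ^ ?n * real X ^ (?n - 1) * real (gcd q q')"
      by (simp add: d_def)
  qed
  also have "\<dots> = 6 ^ ?n * real X ^ (?n - 1) * (\<Sum>q=1..X. \<Sum>q'=1..X. real (gcd q q'))"
    by (simp add: sum_distrib_left sum.cartesian_product case_prod_beta)
  also have "\<dots> \<le> 6 ^ ?n * real X ^ (?n - 1) * (real X ^ 2 * (1 + ln X))"
    by (intro mult_left_mono sum_gcd_le X) auto
  also have "\<dots> = 6 ^ ?n * (real X ^ (?n - 1) * real X ^ 2) * (1 + ln X)" by (simp add: mult_ac)
  also have "real X ^ (?n - 1) * real X ^ 2 = real X ^ (?n + 1)"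
  proof -
    have "?n - 1 + 2 = ?n + 1" using zero_less_card_finite[where 'a='n] by linarith
    then show ?thesis by (metis power_add)
  qed
  finally show "real (card ?P) \<le> 6 ^ ?n * real X ^ (?n + 1) * (1 + ln X)" .
qed

section \<open>Well distributed translated rationals\<close>

text \<open>The difference of the two sides is convex and piecewise linear in \<open>\<tau>\<close>, with breakpoints \<open>t k\<close>.\<close>
lemma exponent_gap:
  fixes t :: "'n::finite \<Rightarrow> real" and s :: real
  assumes s: "0 \<le> s" "s < CARD('n)"
    and k: "\<And>k. s * (1 + t k) < real CARD('n) + 1 + (\<Sum>i\<in>UNIV. max 0 (t k - t i))"
  obtains \<epsilon> where "\<epsilon> > 0" "\<epsilon> \<le> CARD('n) - s"
    "\<And>\<tau>. s * (1 + \<tau>) + \<epsilon> \<le> real CARD('n) + 1 + (\<Sum>i\<in>UNIV. max 0 (\<tau> - t i))"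
proof -
  define g :: "real \<Rightarrow> real" where "g \<tau> = real CARD('n) + 1 + (\<Sum>i\<in>UNIV. max 0 (\<tau> - t i)) - s * (1 + \<tau>)" for \<tau>
  \<comment> \<open>The entry \<open>n - s\<close> is for radii close to \<open>1 / X\<close>, where
    \<open>box_count_prod_le\<close> compares \<open>r powr (n - s)\<close> with
    \<open>X powr (- \<epsilon>)\<close>.\<close>
  define \<epsilon> where "\<epsilon> = min (CARD('n) - s) (Min (range (\<lambda>k. g (t k))))"
  have pos: "\<epsilon> > 0" using s k by (auto simp: \<epsilon>_def g_def)
  have le: "\<epsilon> \<le> g (t k)" for k unfolding \<epsilon>_def by (intro min.coboundedI2 Min_le) auto
  have "\<epsilon> \<le> g \<tau>" for \<tau>
  proof -
    \<comment> \<open>\<open>card U - s\<close> is the right-hand slope of \<open>g\<close> at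
      \<open>\<tau>\<close>. If it is at most 0, \<open>g\<close> does not increase up to the next
      breakpoint above; otherwise \<open>g\<close> does not increase on the way down to the last
      breakpoint not above \<open>\<tau>\<close>. The bounds on \<open>s\<close> guarantee that the
      breakpoint in question exists.\<close>
    define U where "U = {i. t i \<le> \<tau>}"
    show ?thesis
    proof (cases "real (card U) \<le> s")
      case True
      then have "U \<noteq> UNIV" using s by auto
      then have ne: "-U \<noteq> {}" by blast
      define b where "b = Min (t ` (-U))"
      have "b \<in> t ` (-U)" unfolding b_def by (rule Min_in) (use ne in auto)
      then obtain k where kk: "k \<in> -U" "b = t k" by blast
      have b: "b > \<tau>" using kk by (auto simp: U_def)
      have bl: "b \<le> t i" if "i \<notin> U" for i unfolding b_def by (rule Min_le) (use that in auto)
      have "(\<Sum>i\<in>UNIV. max 0 (b - t i)) - (\<Sum>i\<in>UNIV. max 0 (\<tau> - t i)) = (\<Sum>i\<in>UNIV. if i \<in> U then b - \<tau> else 0)"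
        unfolding sum_subtractf[symmetric]
        by (intro sum.cong refl) (use bl b in \<open>force simp: U_def max_def\<close>)
      also have "\<dots> = card U * (b - \<tau>)" by (simp add: sum.If_cases)
      finally have "g \<tau> - g b = (s - card U) * (b - \<tau>)" by (simp add: g_def algebra_simps)
      also have "\<dots> \<ge> 0" using True b by simp
      finally show ?thesis using le[of k] kk by simp
    next
      case False
      then have ne: "U \<noteq> {}" using s by auto
      define b where "b = Max (t ` U)"
      have "b \<in> t ` (U)" unfolding b_def by (rule Max_in) (use ne in auto)
      then obtain k where kk: "k \<in> U" "b = t k" by blast
      have b: "b \<le> \<tau>" using kk by (auto simp: U_def)
      have bl: "b \<ge> t i" if "i \<in> U" for i unfolding b_def by (rule Max_ge) (use that in auto)
      have "(\<Sum>i\<in>UNIV. max 0 (\<tau> - t i)) - (\<Sum>i\<in>UNIV. max 0 (b - t i)) = (\<Sum>i\<in>UNIV. if i \<in> U then \<tau> - b else 0)"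
        unfolding sum_subtractf[symmetric]
        by (intro sum.cong refl) (use bl b in \<open>force simp: U_def max_def\<close>)
      also have "\<dots> = card U * (\<tau> - b)" by (simp add: sum.If_cases)
      finally have "g \<tau> - g b = (card U - s) * (\<tau> - b)" by (simp add: g_def algebra_simps)
      also have "\<dots> \<ge> 0" using False b by simp
      finally show ?thesis using le[of k] kk by simp
    qed
  qed
  then show ?thesis using that[of \<epsilon>] pos by (auto simp: g_def \<epsilon>_def algebra_simps)
qed

text \<open>Intermediate value theorem in \<open>c\<close>: the sum is 0 at \<open>c = 0\<close>,
  and it is the full sum once \<open>c\<close> reaches the largest \<open>t i\<close>.\<close>

lemma truncated_sum_eq_1:
  fixes t :: "'n::finite \<Rightarrow> real"
  assumes "\<And>i. t i > 0" "(\<Sum>i\<in>UNIV. t i) \<ge> 1"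
  obtains c where "c \<ge> 0" "(\<Sum>i\<in>UNIV. min c (t i)) = 1"
proof -
  define m where "m = Max (range t)"
  have m: "t i \<le> m" for i unfolding m_def by (rule Max_ge) auto
  have "\<exists>c\<ge>0. c \<le> m \<and> (\<Sum>i\<in>UNIV. min c (t i)) = 1"
  proof (rule IVT')
    show "(\<Sum>i\<in>UNIV. min 0 (t i)) \<le> 1" using assms(1) by (simp add: min_def less_imp_le)
    show "1 \<le> (\<Sum>i\<in>UNIV. min m (t i))" using assms(2) m by (simp add: min_absorb2)
    show "0 \<le> m" using m[of undefined] assms(1)[of undefined] by linarith
    show "continuous_on {0..m} (\<lambda>c. \<Sum>i\<in>UNIV. min c (t i))" by (intro continuous_intros)
  qed
  then show ?thesis using that by blast
qed

text \<open>For each \<open>q\<close>, a coordinate has an interval of length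
  \<open>q * \<delta>\<close> for its numerator. Rounding costs 1 and room for the box costs
  \<open>q * \<rho> i \<le> 1\<close>, so at least \<open>Q * \<delta> - 2\<close> numerators
  remain; this exceeds half of \<open>Q * \<delta>\<close> because
  \<open>Q * \<delta> \<ge> 4\<close>.\<close>

lemma card_points_in_cell_ge:
  fixes sh :: "nat \<Rightarrow> 'n::finite \<Rightarrow> real" and Q :: nat and \<delta> r :: real and \<rho> lo :: "'n \<Rightarrow> real"
  assumes \<delta>: "Q * \<delta> \<ge> 4" and \<rho>: "\<And>i. 0 \<le> \<rho> i \<and> \<rho> i \<le> 1 / (2 * Q)" and Q: "Q > 0"
  defines "I \<equiv> {z. Q < fst z \<and> fst z \<le> 2 * Q \<and> (\<forall>i. lo i \<le> ctr sh z i \<and> ctr sh z i + \<rho> i \<le> lo i + \<delta>)}"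
  shows "finite I" "real (card I) \<ge> real Q * (Q * \<delta> / 2) ^ CARD('n)"
proof -
  define T where "T q i = {u::int. real q * (lo i - sh q i) \<le> u \<and> u \<le> real q * (lo i - sh q i + \<delta> - \<rho> i)}" for q i
  have "I = (SIGMA q:{Q<..2 * Q}. {p. \<forall>i. p i \<in> T q i})"
    using Q by (auto simp: I_def T_def ctr_def field_simps)
  have pos: "\<delta> > 0" using \<delta> Q by (smt (verit) mult_nonneg_nonpos of_nat_0_le_iff)
  have "1 / (2 * real Q) \<le> \<delta>" using \<delta> Q by (simp add: field_simps)
  then have \<rho>\<delta>: "\<rho> i \<le> \<delta>" for i using \<rho>[of i] by linarith
  have finT: "finite (T q i)" for q i
    unfolding T_def by (rule card_ints_le) (use \<rho>\<delta>[of i] in \<open>auto intro!: mult_left_mono\<close>)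
  show "finite I" unfolding \<open>I = _\<close> by (auto intro!: card_dependent_functions finT)
  have cT: "real (card (T q i)) \<ge> Q * \<delta> / 2" if q: "q \<in> {Q<..2 * Q}" for q i
  proof -
    have "real (card (T q i)) \<ge> real q * (lo i - sh q i + \<delta> - \<rho> i) - real q * (lo i - sh q i) - 1"
      unfolding T_def by (rule card_ints_ge)
    moreover have "real q * (lo i - sh q i + \<delta> - \<rho> i) - real q * (lo i - sh q i) = real q * \<delta> - real q * \<rho> i"
      by (simp add: algebra_simps)
    moreover have "real q * \<delta> \<ge> Q * \<delta>" using q pos by simp
    moreover have "real q * \<rho> i \<le> real (2 * Q) * (1 / (2 * Q))"
      using q \<rho>[of i] by (intro mult_mono) auto
    ultimately show ?thesis using \<delta> Q by simp
  qed
  have "real Q * (Q * \<delta> / 2) ^ CARD('n) = (\<Sum>q\<in>{Q<..2 * Q}. \<Prod>i\<in>(UNIV :: 'n set). Q * \<delta> / 2)"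
    by simp
  also have "\<dots> \<le> (\<Sum>q\<in>{Q<..2 * Q}. \<Prod>i\<in>UNIV. real (card (T q i)))"
    using pos cT by (intro sum_mono prod_mono) auto
  also have "\<dots> = real (card I)"
    unfolding \<open>I = _\<close> by (subst card_SigmaI) (auto simp: card_dependent_functions finT)
  finally show "real (card I) \<ge> real Q * (Q * \<delta> / 2) ^ CARD('n)" .
qed

text \<open>Above the spacing \<open>1 / Q\<close>, counting numerators for each \<open>q\<close>
  separately loses only a constant. A coordinate admits at most \<open>2 * Q * (r + r) + 1\<close>
  of them, and \<open>1 \<le> Q * r\<close>; hence the 5.\<close>

lemma card_points_in_box_le:
  fixes sh :: "nat \<Rightarrow> 'n::finite \<Rightarrow> real" and Q :: nat and \<delta> r :: real and \<rho> lo :: "'n \<Rightarrow> real"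
  assumes r: "r \<ge> 1 / Q" and \<rho>: "\<And>i. 0 \<le> \<rho> i \<and> \<rho> i \<le> 1 / Q" and Q: "Q > 0"
  defines "I \<equiv> {z. Q < fst z \<and> fst z \<le> 2 * Q \<and> (\<forall>i. lo i \<le> ctr sh z i \<and> ctr sh z i \<le> lo i + (r + \<rho> i))}"
  shows "finite I" "real (card I) \<le> real Q * (5 * Q * r) ^ CARD('n)"
proof -
  define T where "T q i = {u::int. real q * (lo i - sh q i) \<le> u \<and> u \<le> real q * (lo i - sh q i + (r + \<rho> i))}" for q i
  have "I = (SIGMA q:{Q<..2 * Q}. {p. \<forall>i. p i \<in> T q i})"
    using Q by (auto simp: I_def T_def ctr_def field_simps)
  have "r > 0" using r Q by (metis divide_pos_pos less_le_trans of_nat_0_less_iff zero_less_one)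
  have le: "real q * (lo i - sh q i) \<le> real q * (lo i - sh q i + (r + \<rho> i))" for q i
    using \<open>r > 0\<close> \<rho>[of i] by (intro mult_left_mono) auto
  have finT: "finite (T q i)" for q i
    unfolding T_def by (rule card_ints_le[OF le])
  show "finite I" unfolding \<open>I = _\<close> by (auto intro!: card_dependent_functions finT)
  have cT: "real (card (T q i)) \<le> 5 * Q * r" if q: "q \<in> {Q<..2 * Q}" for q i
  proof -
    have "real (card (T q i)) \<le> real q * (lo i - sh q i + (r + \<rho> i)) - real q * (lo i - sh q i) + 1"
      unfolding T_def by (rule card_ints_le[OF le])
    also have "\<dots> = real q * (r + \<rho> i) + 1"
      by (simp add: algebra_simps)
    also have "real q * (r + \<rho> i) \<le> real (2 * Q) * (r + r)"
      using q \<rho>[of i] r \<open>r > 0\<close> by (intro mult_mono) auto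
    also have "1 \<le> Q * r" using r Q by (simp add: field_simps)
    finally show ?thesis by (simp add: mult_ac)
  qed
  have "real (card I) = (\<Sum>q\<in>{Q<..2 * Q}. \<Prod>i\<in>UNIV. real (card (T q i)))"
    unfolding \<open>I = _\<close> by (subst card_SigmaI) (auto simp: card_dependent_functions finT)
  also have "\<dots> \<le> (\<Sum>q\<in>{Q<..2 * Q}. \<Prod>i\<in>(UNIV :: 'n set). 5 * Q * r)"
    using cT by (intro sum_mono prod_mono) auto
  also have "\<dots> = real Q * (5 * Q * r) ^ CARD('n)"
    by simp
  finally show "real (card I) \<le> real Q * (5 * Q * r) ^ CARD('n)" .
qed

text \<open>The first factor counts grid intervals of length \<open>len\<close> for the points whose
  boxes can meet an interval of length \<open>r\<close>; the second bounds the share of such a box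
  inside that interval. Below the threshold \<open>X powr (- 1 - c)\<close> both \<open>r\<close>
  and \<open>\<rho>\<close> are at most \<open>len\<close>, so the first factor is at most 3. Above
  it, either \<open>len \<le> r\<close>, or \<open>a = t\<close> and \<open>len = \<rho>\<close>. As
  \<open>c\<close> is common to all coordinates, a product over them never mixes the two
  bounds.\<close>

lemma box_count_factor_le:
  fixes X r t a c :: real
  assumes X: "X \<ge> 1" and r: "r > 0" and a: "a = min c t"
  defines "\<rho> \<equiv> X powr (- 1 - t)" and "len \<equiv> X powr (- 1 - a)"
  shows "r \<le> X powr (- 1 - c) \<Longrightarrow> ((r + \<rho>) / len + 1) * min 1 (2 * r / \<rho>) \<le> 6 * min 1 (r / \<rho>)"
    and "r \<ge> X powr (- 1 - c) \<Longrightarrow> ((r + \<rho>) / len + 1) * min 1 (2 * r / \<rho>) \<le> 6 * (r * X powr (1 + a))"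
proof -
  have pos: "\<rho> > 0" "len > 0" using X by (auto simp: \<rho>_def len_def)
  have \<rho>l: "\<rho> \<le> len" unfolding \<rho>_def len_def using X a by (intro powr_mono) auto
  show "((r + \<rho>) / len + 1) * min 1 (2 * r / \<rho>) \<le> 6 * min 1 (r / \<rho>)" if "r \<le> X powr (- 1 - c)"
  proof -
    have "X powr (- 1 - c) \<le> len" unfolding len_def using X a by (intro powr_mono) auto
    then have "(r + \<rho>) / len + 1 \<le> 3" using that \<rho>l pos by (simp add: field_simps)
    moreover have "min 1 (2 * r / \<rho>) \<le> 2 * min 1 (r / \<rho>)" "0 \<le> min 1 (2 * r / \<rho>)" using r pos by (auto simp: min_def)
    ultimately have "((r + \<rho>) / len + 1) * min 1 (2 * r / \<rho>) \<le> 3 * (2 * min 1 (r / \<rho>))"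
      by (intro mult_mono) auto
    then show ?thesis by simp
  qed
  show "((r + \<rho>) / len + 1) * min 1 (2 * r / \<rho>) \<le> 6 * (r * X powr (1 + a))" if "r \<ge> X powr (- 1 - c)"
  proof -
    have e: "r * X powr (1 + a) = r / len" using X by (simp add: len_def powr_diff powr_minus powr_add field_simps)
    show ?thesis
    proof (cases "c \<le> t")
      case True
      then have "len \<le> r" using that a by (simp add: len_def min_def)
      then have "(r + \<rho>) + len \<le> 3 * r" using \<rho>l by linarith
      then have "((r + \<rho>) + len) / len \<le> (3 * r) / len" using pos by (intro divide_right_mono) auto
      then have "(r + \<rho>) / len + 1 \<le> 3 * (r / len)" using pos by (simp add: add_divide_distrib)
      then have "((r + \<rho>) / len + 1) * min 1 (2 * r / \<rho>) \<le> (3 * (r / len)) * 1"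
        using r pos by (intro mult_mono) (auto simp: min_def)
      also have "\<dots> \<le> 6 * (r / len)" using divide_pos_pos[OF r pos(2)] by linarith
      finally show ?thesis using e by simp
    next
      case False
      then have l: "len = \<rho>" using a by (simp add: len_def \<rho>_def min_def)
      have x: "(r + \<rho>) / \<rho> + 1 = r / \<rho> + 2" using pos by (simp add: field_simps)
      define y where "y = r / \<rho>"
      have y: "y > 0" using r pos by (simp add: y_def)
      have "(y + 2) * min 1 (2 * y) \<le> 6 * y"
      proof (cases "y \<ge> 1")
        case True
        then show ?thesis by (simp add: min_def)
      next
        case False
        then have "(y + 2) * min 1 (2 * y) \<le> 3 * (2 * y)" using y by (intro mult_mono) auto
        then show ?thesis by simp
      qed
      then show ?thesis unfolding e unfolding l x by (simp add: y_def)
    qed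
  qed
qed

text \<open>A small \<open>r\<close> is written as \<open>X powr (- 1 - \<tau>)\<close>; then the
  product of the \<open>min 1 (r / \<rho> i)\<close> is \<open>X\<close> to minus the sum in the gap
  hypothesis. For larger \<open>r\<close> the exponents \<open>1 + a i\<close> add up to
  \<open>n + 1\<close>, so \<open>r ^ n * X ^ (n + 1)\<close> appears, and
  \<open>r \<le> 2 / X\<close> turns the surplus \<open>r powr (n - s)\<close> into
  \<open>2 ^ n * X powr (- \<epsilon>)\<close>.\<close>

lemma box_count_prod_le:
  fixes t a :: "'n::finite \<Rightarrow> real" and s :: real
  assumes gap: "\<epsilon> \<le> CARD('n) - s" "\<And>\<tau>. s * (1 + \<tau>) + \<epsilon> \<le> real CARD('n) + 1 + (\<Sum>i\<in>UNIV. max 0 (\<tau> - t i))"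
    and a: "\<And>i. a i = min c (t i)" "(\<Sum>i\<in>UNIV. a i) = 1"
    and X: "X \<ge> 2" and r: "0 < r" "r \<le> 2 / X" and s: "0 \<le> s" "s < CARD('n)"
  defines "\<rho> \<equiv> \<lambda>i. X powr (- 1 - t i)"
  shows "(\<Prod>i\<in>UNIV. ((r + \<rho> i) / X powr (- 1 - a i) + 1) * min 1 (2 * r / \<rho> i))
     \<le> 12 ^ CARD('n) * X ^ (CARD('n) + 1) * X powr (- \<epsilon>) * r powr s"
proof -
  let ?n = "CARD('n)"
  have X1: "X \<ge> 1" "X > 0" using X by auto
  have nn: "0 \<le> ((r + \<rho> i) / X powr (- 1 - a i) + 1) * min 1 (2 * r / \<rho> i)" for i
    using r X by (auto simp: \<rho>_def intro!: mult_nonneg_nonneg add_nonneg_nonneg)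
  show ?thesis
  proof (cases "r \<le> X powr (- 1 - c)")
    case True
    define \<tau> where "\<tau> = - log X r - 1"
    have r\<tau>: "r = X powr (- 1 - \<tau>)" using X r by (simp add: \<tau>_def)
    have "(\<Prod>i\<in>UNIV. ((r + \<rho> i) / X powr (- 1 - a i) + 1) * min 1 (2 * r / \<rho> i)) \<le> (\<Prod>i\<in>UNIV. 6 * min 1 (r / \<rho> i))"
    proof (rule prod_mono)
      fix i show "0 \<le> ((r + \<rho> i) / X powr (- 1 - a i) + 1) * min 1 (2 * r / \<rho> i) \<and>
          ((r + \<rho> i) / X powr (- 1 - a i) + 1) * min 1 (2 * r / \<rho> i) \<le> 6 * min 1 (r / \<rho> i)"
        using nn[of i] box_count_factor_le(1)[OF X1(1) r(1) a(1)[of i] True] by (simp add: \<rho>_def)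
    qed
    also have "\<dots> = (\<Prod>i\<in>UNIV. 6 * X powr (- max 0 (\<tau> - t i)))"
    proof (rule prod.cong[OF refl])
      fix i
      have "r / \<rho> i = X powr (- (\<tau> - t i))" unfolding r\<tau> \<rho>_def using X by (simp flip: powr_diff)
      moreover have "min 1 (X powr (- (\<tau> - t i))) = X powr (- max 0 (\<tau> - t i))"
      proof (cases "\<tau> \<ge> t i")
        case True
        then have "X powr (- (\<tau> - t i)) \<le> X powr 0" using X by (intro powr_mono) auto
        then show ?thesis using True X by (simp add: max_def min_def)
      next
        case False
        then have "X powr (- (\<tau> - t i)) \<ge> X powr 0" using X by (intro powr_mono) auto
        then show ?thesis using False X by (simp add: max_def min_def)
      qed
      ultimately show "6 * min 1 (r / \<rho> i) = 6 * X powr (- max 0 (\<tau> - t i))" by simp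
    qed
    also have "\<dots> = 6 ^ ?n * X powr (- (\<Sum>i\<in>UNIV. max 0 (\<tau> - t i)))"
      using X by (simp add: prod.distrib prod_powr_const sum_negf)
    also have "\<dots> \<le> 6 ^ ?n * X powr (real (?n + 1) + - \<epsilon> + (- 1 - \<tau>) * s)"
      using X gap(2)[of \<tau>] by (intro mult_left_mono powr_mono) (auto simp: algebra_simps)
    also have "\<dots> = 6 ^ ?n * X ^ (?n + 1) * X powr (- \<epsilon>) * r powr s"
      using X powr_realpow[of X "?n + 1"] unfolding r\<tau> powr_powr powr_add[of X] by simp
    also have "\<dots> \<le> 12 ^ ?n * X ^ (?n + 1) * X powr (- \<epsilon>) * r powr s"
      using X by (intro mult_right_mono power_mono) auto
    finally show ?thesis .
  next
    case False
    have "(\<Prod>i\<in>UNIV. ((r + \<rho> i) / X powr (- 1 - a i) + 1) * min 1 (2 * r / \<rho> i)) \<le> (\<Prod>i\<in>UNIV. 6 * (r * X powr (1 + a i)))"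
    proof (rule prod_mono)
      fix i show "0 \<le> ((r + \<rho> i) / X powr (- 1 - a i) + 1) * min 1 (2 * r / \<rho> i) \<and>
          ((r + \<rho> i) / X powr (- 1 - a i) + 1) * min 1 (2 * r / \<rho> i) \<le> 6 * (r * X powr (1 + a i))"
        using nn[of i] box_count_factor_le(2)[OF X1(1) r(1) a(1)[of i]] False by (simp add: \<rho>_def)
    qed
    also have "\<dots> = 6 ^ ?n * (r ^ ?n * X powr (?n + 1))"
      using X a(2) by (simp add: prod.distrib prod_powr_const sum.distrib add.commute)
    also have "r ^ ?n = r powr s * r powr (?n - s)"
      using r by (simp flip: powr_realpow powr_add)
    finally have 1: "(\<Prod>i\<in>UNIV. ((r + \<rho> i) / X powr (- 1 - a i) + 1) * min 1 (2 * r / \<rho> i))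
      \<le> 6 ^ ?n * (r powr s * r powr (?n - s) * X powr (?n + 1))" .
    have "r powr (?n - s) \<le> (2 / X) powr (?n - s)"
      using r s by (intro powr_mono2) auto
    also have "\<dots> = 2 powr (?n - s) * X powr (- (?n - s))"
      using X by (simp add: powr_divide powr_diff powr_minus field_simps)
    also have "\<dots> \<le> 2 powr ?n * X powr (- \<epsilon>)"
      using X s gap(1) by (intro mult_mono powr_mono) auto
    finally have 2: "r powr (?n - s) \<le> 2 ^ ?n * X powr (- \<epsilon>)" by (simp add: powr_realpow)
    have "6 ^ ?n * (r powr s * r powr (?n - s) * X powr (?n + 1)) \<le> 6 ^ ?n * (r powr s * (2 ^ ?n * X powr (- \<epsilon>)) * X powr (?n + 1))"
      using 2 by (intro mult_left_mono mult_right_mono) auto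
    note 3 = order.trans[OF 1 this]
    have "X powr (?n + 1) = X ^ (?n + 1)" using X powr_realpow[of X "?n + 1"] by simp
    note 3[unfolded this]
    also have "6 ^ ?n * (r powr s * (2 ^ ?n * X powr (- \<epsilon>)) * X ^ (?n + 1)) = (6 * 2) ^ ?n * X ^ (?n + 1) * X powr (- \<epsilon>) * r powr s"
      unfolding power_mult_distrib by (simp only: mult_ac)
    finally show ?thesis by simp
  qed
qed

text \<open>The final bound concerns the mass of a cube of side \<open>r\<close> when unit mass is
  spread evenly over the boxes at the points of \<open>S\<close>: the fraction counts points whose
  box can meet the cube, the product bounds the share of each box. The factor 2 in it leaves room
  for replacing boxes by dyadic cells. The third condition on \<open>Q\<close> makes
  \<open>X powr (- \<epsilon>)\<close> beat the logarithm and all constants.\<close>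

lemma well_distributed_points:
  fixes t :: "'n::finite \<Rightarrow> real" and sh :: "nat \<Rightarrow> 'n \<Rightarrow> real" and s \<delta> :: real and Q :: nat and lo :: "'n \<Rightarrow> real"
  assumes t: "\<And>i. t i > 0" "(\<Sum>i\<in>UNIV. t i) \<ge> 1"
    and s: "0 \<le> s" "s < CARD('n)"
    and gap: "\<epsilon> \<le> CARD('n) - s" "\<And>\<tau>. s * (1 + \<tau>) + \<epsilon> \<le> real CARD('n) + 1 + (\<Sum>i\<in>UNIV. max 0 (\<tau> - t i))"
    and Q: "Q > 0" "Q * \<delta> \<ge> 4"
      "16 * 96 ^ CARD('n) * 12 ^ CARD('n) / \<delta> ^ (2 * CARD('n)) * (1 + ln (2 * real Q)) * (2 * real Q) powr (- \<epsilon>) \<le> 1"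
    and \<delta>: "\<delta> > 0" and lo: "\<And>i. 0 \<le> lo i \<and> lo i + \<delta> \<le> 1"
  defines "\<rho> \<equiv> \<lambda>i. (2 * real Q) powr (- 1 - t i)"
  obtains S where "finite S" "S \<noteq> {}"
    "\<And>z i. z \<in> S \<Longrightarrow> Q < fst z \<and> fst z \<le> 2 * Q \<and> lo i \<le> ctr sh z i \<and> ctr sh z i + \<rho> i \<le> lo i + \<delta>"
    "\<And>r c. r > 0 \<Longrightarrow> real (card {z \<in> S. \<forall>i. c i - \<rho> i \<le> ctr sh z i \<and> ctr sh z i \<le> c i + r}) / card S * (\<Prod>i\<in>UNIV. min 1 (2 * r / \<rho> i))
        \<le> max (2 * 10 ^ CARD('n) * (r / \<delta>) ^ CARD('n)) (r powr s)"
proof -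
  let ?n = "CARD('n)"
  define X where "X = 2 * real Q"
  have X: "X \<ge> 2" "X > 0" using Q by (auto simp: X_def)
  obtain c where c: "c \<ge> 0" "(\<Sum>i\<in>UNIV. min c (t i)) = 1"
    using truncated_sum_eq_1[of t] t by blast
  define a where "a = (\<lambda>i. min c (t i))"
  have a0: "0 \<le> a i" for i using c t(1)[of i] by (simp add: a_def)
  have a1: "a i \<le> 1" for i
  proof -
    have "a i \<le> (\<Sum>i\<in>UNIV. a i)" by (rule member_le_sum) (use a0 in auto)
    then show ?thesis using c by (simp add: a_def)
  qed
  have asum: "(\<Sum>i\<in>UNIV. a i) = 1" using c by (simp add: a_def)
  define len where "len = (\<lambda>i. X powr (- 1 - a i))"
  have len: "len i > 0" for i using X by (simp add: len_def)
  have \<rho>0: "\<rho> i > 0" for i using Q by (simp add: \<rho>_def)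
  have \<rho>X: "\<rho> i \<le> 1 / X" for i
  proof -
    have "\<rho> i \<le> X powr (- 1)" unfolding \<rho>_def X_def[symmetric] using X t(1)[of i] by (intro powr_mono) auto
    then show ?thesis using X by (simp add: powr_minus_divide)
  qed
  define U where "U = unit_pts sh Q"
  define R where "R z z' \<longleftrightarrow> (\<forall>i. \<bar>ctr sh z i - ctr sh z' i\<bar> \<le> len i)" for z z'
  have a01: "0 \<le> a i \<and> a i \<le> 1" for i using a0 a1 by simp
  note pairs = card_close_pairs_le[where sh = sh, OF Q(1) a01 asum]
  have finU: "finite U" using pairs(1) by (simp add: U_def)
  \<comment> \<open>Chosen so that \<open>M * H\<close>, for the \<open>M\<close> below, is exactly
    the bound on close pairs. Then at most \<open>M\<close> points are crowded, while the cell
    contains at least \<open>2 * M\<close>, so at least \<open>M\<close> survive.\<close>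
  define H where "H = 4 * 24 ^ ?n * (1 + ln X) / \<delta> ^ ?n"
  have lnX: "1 + ln X > 0" using X ln_ge_zero[of X] by linarith
  then have H: "H > 0" using \<delta> by (simp add: H_def)
  define G where "G = {z \<in> U. real (card {z' \<in> U. R z z'}) \<le> H}"
  define I where "I = {z. Q < fst z \<and> fst z \<le> 2 * Q \<and> (\<forall>i. lo i \<le> ctr sh z i \<and> ctr sh z i + \<rho> i \<le> lo i + \<delta>)}"
  have IU: "I \<subseteq> U"
  proof
    fix z assume z: "z \<in> I"
    have "0 \<le> ctr sh z i \<and> ctr sh z i < 1" for i
    proof -
      have "lo i \<le> ctr sh z i \<and> ctr sh z i + \<rho> i \<le> lo i + \<delta>" using z by (simp add: I_def)
      then show ?thesis using lo[of i] \<rho>0[of i] by linarith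
    qed
    then show "z \<in> U" using z by (simp add: U_def unit_pts_def I_def)
  qed
  define M where "M = X ^ (?n + 1) * \<delta> ^ ?n / (4 * 4 ^ ?n)"
  have M: "M > 0" using X \<delta> by (simp add: M_def)
  have cardI: "real (card I) \<ge> 2 * M"
  proof -
    have "real (card I) \<ge> real Q * (Q * \<delta> / 2) ^ ?n"
      unfolding I_def by (rule card_points_in_cell_ge) (use Q \<rho>0 \<rho>X in \<open>auto simp: X_def less_imp_le\<close>)
    also have "real Q * (Q * \<delta> / 2) ^ ?n = X / 2 * (X * \<delta> / 4) ^ ?n" by (simp add: X_def mult_ac)
    also have "\<dots> = 2 * M" by (simp add: M_def power_divide power_mult_distrib)
    finally show ?thesis .
  qed
  have bad: "real (card (U - G)) \<le> M"
  proof -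
    have "real (card (U - G)) * H \<le> real (card {(z, z'). z \<in> U \<and> z' \<in> U \<and> R z z'})"
      unfolding G_def by (rule card_crowded_points_le[OF finU H])
    also have "\<dots> \<le> 6 ^ ?n * X ^ (?n + 1) * (1 + ln X)"
      using pairs(2) by (simp add: U_def R_def len_def X_def)
    also have "\<dots> = M * H"
    proof -
      have "(24::real) ^ ?n = 6 ^ ?n * 4 ^ ?n" by (simp flip: power_mult_distrib)
      then show ?thesis using \<delta> by (simp add: M_def H_def)
    qed
    finally show ?thesis using H by simp
  qed
  define S where "S = I \<inter> G"
  have finS: "finite S" using finU IU by (auto simp: S_def intro: finite_subset)
  have cardS: "real (card S) \<ge> M"
  proof -
    have "card I \<le> card (S \<union> (U - G))" using IU finU finS by (intro card_mono) (auto simp: S_def)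
    also have "\<dots> \<le> card S + card (U - G)" by (rule card_Un_le)
    finally show ?thesis using cardI bad by linarith
  qed
  show ?thesis
  proof (rule that[of S])
    show "S \<noteq> {}" using cardS M by auto
    show "Q < fst z \<and> fst z \<le> 2 * Q \<and> lo i \<le> ctr sh z i \<and> ctr sh z i + \<rho> i \<le> lo i + \<delta>" if "z \<in> S" for z i
      using that by (simp add: S_def I_def)
    fix r :: real and b :: "'n \<Rightarrow> real" assume r: "r > 0"
    let ?C = "{z \<in> S. \<forall>i. b i - \<rho> i \<le> ctr sh z i \<and> ctr sh z i \<le> b i + r}"
    let ?P = "\<Prod>i\<in>UNIV. min 1 (2 * r / \<rho> i)"
    have P: "0 \<le> ?P" using r \<rho>0 by (auto intro!: prod_nonneg simp: less_imp_le)
    have P1: "?P \<le> 1" using r \<rho>0 by (intro prod_le_1) (auto simp: less_imp_le)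
    have C: "real (card ?C) / card S \<le> real (card ?C) / M"
      using cardS M by (intro divide_left_mono) auto
    show "real (card ?C) / card S * ?P \<le> max (2 * 10 ^ ?n * (r / \<delta>) ^ ?n) (r powr s)"
    \<comment> \<open>Above the spacing \<open>1 / Q\<close> the volume count suffices and yields
      the first entry of the maximum; below it the neighbour bound \<open>H\<close> is needed and
      yields \<open>r powr s\<close>.\<close>
    proof (cases "r \<ge> 1 / Q")
      case True
      let ?D = "{z. Q < fst z \<and> fst z \<le> 2 * Q \<and> (\<forall>i. b i - \<rho> i \<le> ctr sh z i \<and> ctr sh z i \<le> b i - \<rho> i + (r + \<rho> i))}"
      have "\<rho> i \<le> 1 / Q" for i using \<rho>X[of i] Q by (simp add: X_def field_simps)
      then have D: "finite ?D" "real (card ?D) \<le> real Q * (5 * Q * r) ^ ?n"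
        using card_points_in_box_le[of Q r \<rho> "\<lambda>i. b i - \<rho> i" sh] True Q \<rho>0 by (auto simp: less_imp_le)
      have "card ?C \<le> card ?D" using D by (intro card_mono) (auto simp: S_def I_def)
      then have "real (card ?C) \<le> real Q * (5 * Q * r) ^ ?n" using D by linarith
      also have "\<dots> = X / 2 * (5 * X * r / 2) ^ ?n" by (simp add: X_def power_mult_distrib)
      also have "\<dots> = M * (2 * 10 ^ ?n * (r / \<delta>) ^ ?n)"
      proof -
        have "(10::real) ^ ?n = 5 ^ ?n * 2 ^ ?n" "(4::real) ^ ?n = 2 ^ ?n * 2 ^ ?n" by (simp_all flip: power_mult_distrib)
        then show ?thesis using \<delta> by (simp add: M_def power_divide power_mult_distrib)
      qed
      finally have "real (card ?C) / M \<le> 2 * 10 ^ ?n * (r / \<delta>) ^ ?n"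
        using M by (simp add: divide_le_eq mult.commute)
      then have "real (card ?C) / card S * ?P \<le> (2 * 10 ^ ?n * (r / \<delta>) ^ ?n) * 1"
        using C P P1 r \<delta> by (intro mult_mono) auto
      then show ?thesis by simp
    next
      case False
      have nb: "real (card {z' \<in> S. \<forall>i. \<bar>ctr sh z i - ctr sh z' i\<bar> \<le> len i}) \<le> H" if "z \<in> S" for z
      proof -
        have "card {z' \<in> S. \<forall>i. \<bar>ctr sh z i - ctr sh z' i\<bar> \<le> len i} \<le> card {z' \<in> U. R z z'}"
          using finU by (intro card_mono) (auto simp: R_def S_def G_def)
        then show ?thesis using that by (auto simp: S_def G_def)
      qed
      have "real (card {z \<in> S. \<forall>i. b i - \<rho> i \<le> ctr sh z i \<and> ctr sh z i \<le> b i - \<rho> i + (r + \<rho> i)}) 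
          \<le> H * (\<Prod>i\<in>UNIV. (r + \<rho> i) / len i + 1)"
        by (rule card_box_le) (use finS len nb H r \<rho>0 in \<open>auto simp: less_imp_le add_nonneg_nonneg\<close>)
      then have "real (card ?C) \<le> H * (\<Prod>i\<in>UNIV. (r + \<rho> i) / len i + 1)" by simp
      then have "real (card ?C) / M \<le> H * (\<Prod>i\<in>UNIV. (r + \<rho> i) / len i + 1) / M"
        using M by (intro divide_right_mono) auto
      then have "real (card ?C) / card S * ?P \<le> (H * (\<Prod>i\<in>UNIV. (r + \<rho> i) / len i + 1) / M) * ?P"
        using C P by (intro mult_right_mono) auto
      also have "\<dots> = H / M * (\<Prod>i\<in>UNIV. ((r + \<rho> i) / len i + 1) * min 1 (2 * r / \<rho> i))"
        by (simp add: prod.distrib)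
      also have "\<dots> \<le> H / M * (12 ^ ?n * X ^ (?n + 1) * X powr (- \<epsilon>) * r powr s)"
      proof (rule mult_left_mono)
        show "(\<Prod>i\<in>UNIV. ((r + \<rho> i) / len i + 1) * min 1 (2 * r / \<rho> i)) \<le> 12 ^ ?n * X ^ (?n + 1) * X powr (- \<epsilon>) * r powr s"
          unfolding len_def \<rho>_def X_def[symmetric]
          by (rule box_count_prod_le[where c = c]) (use gap asum X r s False Q in \<open>auto simp: a_def X_def field_simps\<close>)
      qed (use H M in auto)
      \<comment> \<open>\<open>H / M\<close> equals \<open>16 * 96 ^ n * (1 + ln X) / (\<delta> ^ (2
        * n) * X ^ (n + 1))\<close>, which is the origin of the constants in the condition on
        \<open>Q\<close>.\<close>
      also have "\<dots> = (16 * 96 ^ ?n * 12 ^ ?n / \<delta> ^ (2 * ?n) * (1 + ln X) * X powr (- \<epsilon>)) * r powr s"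
      proof -
        have "(96::real) ^ ?n = 24 ^ ?n * 4 ^ ?n" "\<delta> ^ (2 * ?n) = \<delta> ^ ?n * \<delta> ^ ?n" 
          by (simp_all add: mult_2 power_add flip: power_mult_distrib)
        then show ?thesis using X \<delta> unfolding M_def H_def by simp
      qed
      also have "\<dots> \<le> 1 * r powr s" using Q(3) by (intro mult_right_mono) (auto simp: X_def)
      finally show ?thesis by simp
    qed
  qed (fact finS)
qed

section \<open>Frostman weights on dyadic cells\<close>

text \<open>The function \<open>a\<close> in \<open>cells L\<close> stands for the dyadic cube of side \<open>1 / 2 ^ L\<close> in the unit cube with lower corner \<open>a / 2 ^ L\<close>;
\<open>anc k a\<close> is the cube \<open>k\<close> levels up that contains it.\<close>
definition cells :: "nat \<Rightarrow> ('n \<Rightarrow> int) set" where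
  "cells L = {a. \<forall>i. 0 \<le> a i \<and> a i < 2 ^ L}"

definition anc :: "nat \<Rightarrow> ('n \<Rightarrow> int) \<Rightarrow> 'n \<Rightarrow> int" where
  "anc k a = (\<lambda>i. a i div 2 ^ k)"

definition cmass :: "nat \<Rightarrow> (('n \<Rightarrow> int) \<Rightarrow> real) \<Rightarrow> nat \<Rightarrow> ('n \<Rightarrow> int) \<Rightarrow> real" where
  "cmass L w l c = (\<Sum>a | a \<in> cells L \<and> anc (L - l) a = c. w a)"

text \<open>The constant 1 in the bound is what makes infinite iteration possible: a factor lost in
  every generation would destroy the estimate in the limit.\<close>

definition frostman :: "real \<Rightarrow> nat \<Rightarrow> (('n \<Rightarrow> int) \<Rightarrow> real) \<Rightarrow> bool" where
  "frostman s L w \<longleftrightarrow> (\<forall>a. w a \<ge> 0) \<and> (\<Sum>a\<in>cells L. w a) = 1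
     \<and> (\<forall>l\<le>L. \<forall>c. cmass L w l c \<le> (1 / 2 ^ l) powr s)"

section \<open>Arithmetic of dyadic cells and redistribution of mass\<close>

lemma finite_cells [simp]: "finite (cells L :: ('n::finite \<Rightarrow> int) set)"
  unfolding cells_def using card_dependent_functions(1)[of "\<lambda>_::'n. {0..<2 ^ L :: int}"] by simp

lemma anc_0 [simp]: "anc 0 a = a"
  by (simp add: anc_def)

lemma anc_anc: "anc j (anc k a) = anc (j + k) a"
  by (simp add: anc_def fun_eq_iff power_add mult.commute[of "2 ^ j"] zdiv_zmult2_eq)

lemma anc_eq_iff: "anc k a = c \<longleftrightarrow> (\<forall>i. c i * 2 ^ k \<le> a i \<and> a i < (c i + 1) * 2 ^ k)"
proof -
  have "x div 2 ^ k = y \<longleftrightarrow> y * 2 ^ k \<le> x \<and> x < (y + 1) * 2 ^ k" for x y :: int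
  proof
    assume "x div 2 ^ k = y"
    then have "x = y * 2 ^ k + x mod 2 ^ k" by (metis div_mult_mod_eq)
    moreover have "0 \<le> x mod 2 ^ k" "x mod 2 ^ k < 2 ^ k" by simp_all
    ultimately show "y * 2 ^ k \<le> x \<and> x < (y + 1) * 2 ^ k" by (simp only: distrib_right) linarith
  next
    assume h: "y * 2 ^ k \<le> x \<and> x < (y + 1) * 2 ^ k"
    show "x div 2 ^ k = y"
      by (rule int_div_pos_eq[of _ _ _ "x - y * 2 ^ k"]) (use h in \<open>auto simp: algebra_simps\<close>)
  qed
  then show ?thesis by (auto simp: anc_def fun_eq_iff)
qed

lemma int_div_less_iff:
  fixes x y m :: int
  assumes "m > 0"
  shows "x div m < y \<longleftrightarrow> x < y * m"
proof
  assume "x div m < y"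
  then have "(x div m + 1) * m \<le> y * m" using assms by (intro mult_right_mono) auto
  moreover have "x < (x div m + 1) * m"
    using pos_mod_bound[OF assms, of x] div_mult_mod_eq[of x m] unfolding distrib_right by linarith
  ultimately show "x < y * m" by linarith
next
  assume x: "x < y * m"
  have "x div m * m \<le> x" using pos_mod_sign[OF assms, of x] div_mult_mod_eq[of x m] by linarith
  then show "x div m < y" using x assms by (meson le_less_trans mult_less_cancel_right_pos)
qed

lemma anc_in_cells:
  assumes "a \<in> cells L" "l \<le> L"
  shows "anc (L - l) a \<in> cells l"
proof -
  have "(2::int) ^ L = 2 ^ l * 2 ^ (L - l)" using assms by (simp flip: power_add)
  then show ?thesis using assms
    by (auto simp: cells_def anc_def pos_imp_zdiv_nonneg_iff int_div_less_iff)
qed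

lemma descendant_in_cells:
  assumes "anc (L - l) a \<in> cells l" "l \<le> L"
  shows "a \<in> cells L"
proof -
  have "(2::int) ^ L = 2 ^ l * 2 ^ (L - l)" using assms by (simp flip: power_add)
  then show ?thesis using assms
    by (auto simp: cells_def anc_def pos_imp_zdiv_nonneg_iff int_div_less_iff)
qed

lemma card_descendants:
  fixes c :: "'n::finite \<Rightarrow> int"
  assumes "c \<in> cells l" "l \<le> L"
  shows "card {a \<in> cells L. anc (L - l) a = c} = 2 ^ (CARD('n) * (L - l))"
proof -
  have "{a \<in> cells L. anc (L - l) a = c} = {a. \<forall>i. a i \<in> {c i * 2 ^ (L - l)..<(c i + 1) * 2 ^ (L - l)}}"
    using descendant_in_cells[of L l] assms by (auto simp flip: anc_eq_iff)
  then have "card {a \<in> cells L. anc (L - l) a = c} = (\<Prod>i\<in>(UNIV::'n set). card {c i * 2 ^ (L - l)..<(c i + 1) * 2 ^ (L - l)})"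
    by (simp only:) (rule card_dependent_functions, simp)
  also have "\<dots> = (2 ^ (L - l)) ^ CARD('n)"
    by (simp add: algebra_simps nat_power_eq)
  finally show ?thesis by (simp add: mult.commute flip: power_mult)
qed

text \<open>As \<open>\<nu>\<close> has mass 1 in every cell of level \<open>L\<close>, the masses
  at levels up to \<open>L\<close> are exactly those of \<open>w\<close> and keep their bounds. A
  cell of a finer level lies in a single cell of level \<open>L\<close>, so its mass is a product,
  bounded by \<open>fine\<close>.\<close>

lemma redistribute:
  fixes w \<nu> :: "('n::finite \<Rightarrow> int) \<Rightarrow> real"
  assumes w: "frostman s L w" and LL: "L \<le> L'" and \<nu>: "\<And>a. \<nu> a \<ge> 0"
    and unit: "\<And>b. b \<in> cells L \<Longrightarrow> cmass L' \<nu> L b = 1"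
    and fine: "\<And>l c. L < l \<Longrightarrow> l \<le> L' \<Longrightarrow> c \<in> cells l \<Longrightarrow> w (anc (l - L) c) * cmass L' \<nu> l c \<le> (1 / 2 ^ l) powr s"
  shows "frostman s L' (\<lambda>a. w (anc (L' - L) a) * \<nu> a)"
proof -
  let ?w = "\<lambda>a. w (anc (L' - L) a) * \<nu> a"
  have fib: "(\<Sum>a | a \<in> cells L' \<and> anc (L' - L) a = b. ?w a) = w b" if "b \<in> cells L" for b
    using unit[OF that] by (simp add: cmass_def sum_distrib_left[symmetric] cong: conj_cong)
  show ?thesis
    unfolding frostman_def
  proof (intro conjI allI impI)
    show "0 \<le> ?w a" for a using w \<nu> by (simp add: frostman_def)
    have "(\<Sum>a\<in>cells L'. ?w a) = (\<Sum>b\<in>cells L. \<Sum>a | a \<in> cells L' \<and> anc (L' - L) a = b. ?w a)"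
      by (rule sum.group[symmetric]) (use LL anc_in_cells in auto)
    also have "\<dots> = 1" using fib w by (simp add: frostman_def)
    finally show "(\<Sum>a\<in>cells L'. ?w a) = 1" .
    fix l c assume l: "l \<le> L'"
    show "cmass L' ?w l c \<le> (1 / 2 ^ l) powr s"
    proof (cases "l \<le> L")
      case True
      have anc: "anc (L - l) (anc (L' - L) a) = anc (L' - l) a" for a :: "'n \<Rightarrow> int"
        using True LL by (simp add: anc_anc)
      have "cmass L' ?w l c = (\<Sum>b | b \<in> cells L \<and> anc (L - l) b = c. 
          \<Sum>a | a \<in> {a. a \<in> cells L' \<and> anc (L' - l) a = c} \<and> anc (L' - L) a = b. ?w a)"
        unfolding cmass_def by (rule sum.group[symmetric]) (use LL anc_in_cells[of _ L' L] anc in auto)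
      also have "\<dots> = (\<Sum>b | b \<in> cells L \<and> anc (L - l) b = c. w b)"
      proof (rule sum.cong[OF refl], clarify)
        fix b assume b: "b \<in> cells L" "c = anc (L - l) b"
        have "{a. a \<in> {a. a \<in> cells L' \<and> anc (L' - l) a = anc (L - l) b} \<and> anc (L' - L) a = b}
          = {a. a \<in> cells L' \<and> anc (L' - L) a = b}" using anc by auto
        then show "(\<Sum>a | a \<in> {a. a \<in> cells L' \<and> anc (L' - l) a = anc (L - l) b} \<and> anc (L' - L) a = b. ?w a) = w b"
          using fib[OF b(1)] by simp
      qed
      also have "\<dots> \<le> (1 / 2 ^ l) powr s" using w True by (simp add: frostman_def cmass_def)
      finally show ?thesis .
    next
      case False
      show ?thesis
      proof (cases "c \<in> cells l")
        case True
        have "anc (L' - L) a = anc (l - L) (anc (L' - l) a)" for a :: "'n \<Rightarrow> int"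
          using False l by (simp add: anc_anc)
        then have "cmass L' ?w l c = w (anc (l - L) c) * cmass L' \<nu> l c"
          by (simp add: cmass_def sum_distrib_left)
        then show ?thesis using fine[of l c] False l True by simp
      next
        case c: False
        then have "{a. a \<in> cells L' \<and> anc (L' - l) a = c} = {}" using anc_in_cells l by blast
        then show ?thesis by (simp only: cmass_def) simp
      qed
    qed
  qed
qed

lemma frostman_le:
  assumes "frostman s L w" "a \<in> cells L"
  shows "w a \<le> (1 / 2 ^ L) powr s"
proof -
  have "cmass L w L a \<le> (1 / 2 ^ L) powr s" using assms by (simp add: frostman_def)
  moreover have "{b. b \<in> cells L \<and> anc (L - L) b = a} = {a}" using assms by auto
  ultimately show ?thesis by (simp only: cmass_def) simp
qed

lemma power_le_powr_of_le_1:
  fixes x s :: real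
  assumes "0 < x" "x \<le> 1" "s \<le> n"
  shows "x ^ n \<le> x powr s"
proof -
  have "x powr real n \<le> x powr s" using assms by (intro powr_mono') auto
  then show ?thesis using assms by (simp add: powr_realpow)
qed

text \<open>Spreading mass evenly over the descendants \<open>k\<close> levels down divides each
  weight by \<open>2 ^ (n * k)\<close>, while the permitted bound drops only by
  \<open>2 powr (s * k)\<close>. As \<open>s < n\<close>, a large \<open>k\<close> gains the factor
  \<open>\<kappa>\<close>; the intermediate levels satisfy their bounds for the same reason.\<close>

lemma refine_frostman:
  fixes w :: "('n::finite \<Rightarrow> int) \<Rightarrow> real"
  assumes w: "frostman s L w" and s: "s < CARD('n)" and \<kappa>: "\<kappa> > 0"
  obtains M w' where "M \<ge> L" "frostman s M w'" "\<And>b. b \<in> cells M \<Longrightarrow> w' b \<le> \<kappa> * (1 / 2 ^ M) powr s"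
    "\<And>a. w' a \<noteq> 0 \<Longrightarrow> w (anc (M - L) a) \<noteq> 0"
proof -
  let ?n = "CARD('n)"
  obtain k :: nat where k: "(1 / 2 ^ k) powr (?n - s) \<le> \<kappa>"
  proof -
    have "((1/2) powr (?n - s)) < 1" using s powr_less_mono2[of "?n - s" "1/2" 1] by simp
    then obtain k where "((1/2) powr (?n - s)) ^ k < \<kappa>" using real_arch_pow_inv \<kappa> by blast
    also have "((1/2) powr (?n - s)) ^ k = (1 / 2 ^ k) powr (?n - s)"
      by (simp add: powr_realpow[symmetric] powr_powr powr_divide mult.commute)
    finally show ?thesis by (intro that less_imp_le)
  qed
  define M where "M = L + k"
  define \<nu> :: "('n \<Rightarrow> int) \<Rightarrow> real" where "\<nu> = (\<lambda>_. 1 / 2 ^ (?n * k))"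
  have mass: "cmass M \<nu> l c = 2 ^ (?n * (M - l)) / 2 ^ (?n * k)" if "c \<in> cells l" "l \<le> M" for l c
    using card_descendants[OF that] by (simp add: cmass_def \<nu>_def)
  show ?thesis
  proof (rule that[of M "\<lambda>a. w (anc (M - L) a) * \<nu> a"])
    show "frostman s M (\<lambda>a. w (anc (M - L) a) * \<nu> a)"
    proof (rule redistribute[OF w])
      fix l and c :: "'n \<Rightarrow> int" assume l: "L < l" "l \<le> M" "c \<in> cells l"
      have "w (anc (l - L) c) \<le> (1 / 2 ^ L) powr s"
        by (rule frostman_le[OF w anc_in_cells]) (use l in auto)
      then have "w (anc (l - L) c) * cmass M \<nu> l c \<le> (1 / 2 ^ L) powr s * cmass M \<nu> l c"
        by (intro mult_right_mono) (auto simp: cmass_def \<nu>_def sum_nonneg)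
      also have cm: "cmass M \<nu> l c = (1 / 2 ^ (l - L)) ^ ?n"
      proof -
        have "?n * k = ?n * (M - l) + ?n * (l - L)" using l by (simp add: M_def flip: distrib_left)
        then show ?thesis unfolding mass[OF l(3,2)]
          by (simp add: power_add power_one_over power_mult[symmetric] mult.commute)
      qed
      also have "\<dots> \<le> (1 / 2 ^ (l - L)) powr s"
        using s by (intro power_le_powr_of_le_1) auto
      also have "(1 / 2 ^ L) powr s * (1 / 2 ^ (l - L)) powr s = (1 / 2 ^ l) powr s"
        using l by (simp flip: powr_mult power_add)
      finally show "w (anc (l - L) c) * cmass M \<nu> l c \<le> (1 / 2 ^ l) powr s" by (simp add: cm)
    qed (use mass[of _ L] in \<open>auto simp: M_def \<nu>_def\<close>)
    fix b :: "'n \<Rightarrow> int" assume b: "b \<in> cells M"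
    have "w (anc (M - L) b) * \<nu> b \<le> (1 / 2 ^ L) powr s * \<nu> b"
      by (intro mult_right_mono frostman_le[OF w anc_in_cells[OF b]]) (auto simp: M_def \<nu>_def)
    also have nu: "\<nu> b = (1 / 2 ^ k) powr s * (1 / 2 ^ k) powr (?n - s)"
      by (simp add: \<nu>_def powr_add[symmetric] powr_realpow power_one_over power_mult[symmetric] mult.commute)
    also have "\<dots> \<le> (1 / 2 ^ k) powr s * \<kappa>" using k by (intro mult_left_mono) auto
    also have "(1 / 2 ^ L) powr s * ((1 / 2 ^ k) powr s * \<kappa>) = \<kappa> * (1 / 2 ^ M) powr s"
      by (simp add: M_def powr_mult[symmetric] power_add mult.commute)
    finally show "w (anc (M - L) b) * \<nu> b \<le> \<kappa> * (1 / 2 ^ M) powr s" by (simp add: nu)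
  qed (auto simp: M_def)
qed

section \<open>Mass on the boxes around well distributed points\<close>

lemma real_card_filter:
  "finite B \<Longrightarrow> real (card {x \<in> B. R x}) = (\<Sum>x\<in>B. of_bool (R x))"
  by (simp add: of_bool_def sum.If_cases Int_def)

lemma sum_card_swap:
  assumes "finite A" "finite S"
  shows "(\<Sum>a\<in>A. real (card {z \<in> S. P z a})) = (\<Sum>z\<in>S. real (card {a \<in> A. P z a}))"
  unfolding real_card_filter[OF assms(1)] real_card_filter[OF assms(2)] by (rule sum.swap)

text \<open>In every cell of level \<open>M\<close>, each selected point receives an equal share of
  unit mass, spread over the cells of level \<open>L'\<close> that fit strictly inside its box. The
  two entries of the maximum are those of \<open>well_distributed_points\<close> with
  \<open>r = 1 / 2 ^ l\<close> and \<open>\<delta> = 1 / 2 ^ M\<close>.\<close>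

lemma local_measure:
  fixes t :: "'n::finite \<Rightarrow> real" and sh :: "nat \<Rightarrow> 'n \<Rightarrow> real" and s :: real
  assumes t: "\<And>i. t i > 0" "(\<Sum>i\<in>UNIV. t i) \<ge> 1"
    and s: "0 \<le> s" "s < CARD('n)"
    and k: "\<And>k. s * (1 + t k) < real CARD('n) + 1 + (\<Sum>i\<in>UNIV. max 0 (t k - t i))"
  obtains L' \<nu> where "M < L'" "\<And>a. \<nu> a \<ge> (0::real)"
    "\<And>b. b \<in> cells M \<Longrightarrow> cmass L' \<nu> M b = 1"
    "\<And>a. \<nu> a \<noteq> 0 \<Longrightarrow> \<exists>q::nat. q > m \<and> (\<exists>p::'n \<Rightarrow> int. \<forall>i. p i / q + sh q i < a i / 2 ^ L'
        \<and> (real_of_int (a i) + 1) / 2 ^ L' < p i / q + sh q i + q powr (- 1 - t i))"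
    "\<And>l c. M < l \<Longrightarrow> l \<le> L' \<Longrightarrow> c \<in> cells l \<Longrightarrow>
      cmass L' \<nu> l c \<le> max (2 * 10 ^ CARD('n) * (2 ^ M / 2 ^ l) ^ CARD('n)) ((1 / 2 ^ l) powr s)"
proof -
  let ?n = "CARD('n)"
  obtain \<epsilon> where \<epsilon>: "\<epsilon> > 0" "\<epsilon> \<le> ?n - s"
      "\<And>\<tau>. s * (1 + \<tau>) + \<epsilon> \<le> real ?n + 1 + (\<Sum>i\<in>UNIV. max 0 (\<tau> - t i))"
    using exponent_gap[OF s k] by blast
  define \<delta> :: real where "\<delta> = 1 / 2 ^ M"
  have \<delta>: "\<delta> > 0" by (simp add: \<delta>_def)
  define K where "K = 16 * 96 ^ ?n * 12 ^ ?n / \<delta> ^ (2 * ?n)"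
  \<comment> \<open>The conditions on \<open>Q\<close> involve a cell only through its side
    \<open>\<delta>\<close>, so one \<open>Q\<close> serves all cells of level
    \<open>M\<close>.\<close>
  have "((\<lambda>Q::nat. K * (1 + ln (2 * real Q)) * (2 * real Q) powr (- \<epsilon>)) \<longlongrightarrow> 0) at_top"
    using \<epsilon>(1) by real_asymp
  then have "eventually (\<lambda>Q::nat. K * (1 + ln (2 * real Q)) * (2 * real Q) powr (- \<epsilon>) < 1) at_top"
    by (rule order_tendstoD) simp
  moreover have "eventually (\<lambda>Q::nat. Q > m) at_top" by (rule eventually_gt_at_top)
  moreover have "eventually (\<lambda>Q::nat. Q * \<delta> \<ge> 4) at_top" using \<delta> by real_asymp
  ultimately have "eventually (\<lambda>Q::nat. K * (1 + ln (2 * real Q)) * (2 * real Q) powr (- \<epsilon>) < 1 \<and> Q > m \<and> Q * \<delta> \<ge> 4) at_top"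
    by (intro eventually_conj)
  then obtain Q :: nat where Q: "K * (1 + ln (2 * real Q)) * (2 * real Q) powr (- \<epsilon>) < 1" "Q > m" "Q * \<delta> \<ge> 4"
    by (auto dest!: eventually_happens)
  have Q0: "Q > 0" using Q by simp
  have Q1: "16 * 96 ^ ?n * 12 ^ ?n / \<delta> ^ (2 * ?n) * (1 + ln (2 * real Q)) * (2 * real Q) powr (- \<epsilon>) \<le> 1"
    using Q(1) by (simp add: K_def)
  \<comment> \<open>All boxes of this generation get the size belonging to the largest denominator
    \<open>2 * Q\<close>, which fits into the size allowed for any
    \<open>q \<le> 2 * Q\<close>.\<close>
  define \<rho> where "\<rho> i = (2 * real Q) powr (- 1 - t i)" for i
  have \<rho>0: "\<rho> i > 0" for i using Q0 by (simp add: \<rho>_def)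
  define good where "good b S \<longleftrightarrow> finite S \<and> S \<noteq> {} \<and>
    (\<forall>z\<in>S. \<forall>i. Q < fst z \<and> fst z \<le> 2 * Q \<and> b i * \<delta> \<le> ctr sh z i \<and> ctr sh z i + \<rho> i \<le> b i * \<delta> + \<delta>) \<and>
    (\<forall>r c. r > 0 \<longrightarrow> real (card {z \<in> S. \<forall>i. c i - \<rho> i \<le> ctr sh z i \<and> ctr sh z i \<le> c i + r}) / card S * (\<Prod>i\<in>UNIV. min 1 (2 * r / \<rho> i))
        \<le> max (2 * 10 ^ ?n * (r / \<delta>) ^ ?n) (r powr s))" for b :: "'n \<Rightarrow> int" and S
  have "\<exists>S. good b S" if b: "b \<in> cells M" for b
  proof -
    have lo: "0 \<le> b i * \<delta> \<and> b i * \<delta> + \<delta> \<le> 1" for i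
    proof -
      have "0 \<le> b i" "b i + 1 \<le> 2 ^ M" using b by (auto simp: cells_def zless_iff_Suc_zadd add1_zle_eq)
      then have "0 \<le> real_of_int (b i)" "real_of_int (b i + 1) \<le> real_of_int (2 ^ M)" by (simp_all only: of_int_le_iff of_int_0_le_iff)
      then show ?thesis by (simp add: \<delta>_def field_simps)
    qed
    show ?thesis
    proof (rule well_distributed_points[OF t s \<epsilon>(2,3) Q0 Q(3) Q1 \<delta> lo, where sh = sh, folded \<rho>_def])
      fix S assume "finite S" "S \<noteq> {}" 
        "\<And>z i. z \<in> S \<Longrightarrow> Q < fst z \<and> fst z \<le> 2 * Q \<and> b i * \<delta> \<le> ctr sh z i \<and> ctr sh z i + \<rho> i \<le> b i * \<delta> + \<delta>"
        "\<And>r c. r > 0 \<Longrightarrow> real (card {z \<in> S. \<forall>i. c i - \<rho> i \<le> ctr sh z i \<and> ctr sh z i \<le> c i + r}) / card S * (\<Prod>i\<in>UNIV. min 1 (2 * r / \<rho> i))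
          \<le> max (2 * 10 ^ ?n * (r / \<delta>) ^ ?n) (r powr s)"
      then have "good b S" unfolding good_def by simp
      then show ?thesis by blast
    qed
  qed
  then obtain S where S: "\<And>b. b \<in> cells M \<Longrightarrow> good b (S b)" by metis
  define L' where "L' = M + 1 + nat \<lceil>log 2 (6 / Min (range \<rho>))\<rceil>"
  have M_less_L: "M < L'" by (simp add: L'_def)
  have big: "2 ^ L' * \<rho> i \<ge> 6" for i
  proof -
    have m0: "Min (range \<rho>) > 0" using \<rho>0 by simp
    have "6 / Min (range \<rho>) = 2 powr log 2 (6 / Min (range \<rho>))" using m0 by simp
    also have "\<dots> \<le> 2 powr L'" unfolding L'_def by (intro powr_mono) (linarith, simp)
    finally have "6 / Min (range \<rho>) \<le> 2 ^ L'" by (simp add: powr_realpow)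
    then have "6 \<le> 2 ^ L' * Min (range \<rho>)" using m0 by (simp add: field_simps)
    also have "\<dots> \<le> 2 ^ L' * \<rho> i" by (intro mult_left_mono) auto
    finally show ?thesis .
  qed
  \<comment> \<open>The \<open>+ 1\<close> starts strictly beyond the lower corner, and the
    \<open>- 2\<close> in \<open>wd\<close> keeps the upper end of the last cell strictly inside the
    box. Since a side spans at least 6 cells, rounding still leaves at least half of it.\<close>
  define u where "u z i = \<lfloor>2 ^ L' * ctr sh z i\<rfloor> + 1" for z i
  define wd where "wd i = \<lfloor>2 ^ L' * \<rho> i\<rfloor> - 2" for i
  have wd: "wd i > 0" "real_of_int (wd i) \<ge> 2 ^ L' * \<rho> i / 2" for i
    using big[of i] unfolding wd_def by linarith+
  define R where "R z = {a. \<forall>i. a i \<in> {u z i..<u z i + wd i}}" for z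
  define V where "V = (\<Prod>i\<in>UNIV. real_of_int (wd i))"
  have V: "V > 0" unfolding V_def by (intro prod_pos) (use wd in auto)
  have R: "finite (R z)" "real (card (R z)) = V" for z
    unfolding R_def V_def using card_dependent_functions[of "\<lambda>i. {u z i..<u z i + wd i}"] wd(1)
    by (simp_all add: less_imp_le del: atLeastLessThan_iff)
  have Rin: "2 ^ L' * ctr sh z i < a i" "real_of_int (a i) + 1 < 2 ^ L' * (ctr sh z i + \<rho> i)" if "a \<in> R z" for a z i
  proof -
    have a: "u z i \<le> a i" "a i < u z i + wd i" using that by (auto simp: R_def)
    show "2 ^ L' * ctr sh z i < a i" using a(1) unfolding u_def by linarith
    have "a i + 1 \<le> \<lfloor>2 ^ L' * ctr sh z i\<rfloor> + \<lfloor>2 ^ L' * \<rho> i\<rfloor> - 1" using a(2) unfolding u_def wd_def by linarith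
    then have "real_of_int (a i + 1) \<le> real_of_int (\<lfloor>2 ^ L' * ctr sh z i\<rfloor> + \<lfloor>2 ^ L' * \<rho> i\<rfloor> - 1)" by (simp only: of_int_le_iff)
    moreover have "2 ^ L' * (ctr sh z i + \<rho> i) = 2 ^ L' * ctr sh z i + 2 ^ L' * \<rho> i" by (rule distrib_left)
    ultimately show "real_of_int (a i) + 1 < 2 ^ L' * (ctr sh z i + \<rho> i)"
      using of_int_floor_le[of "2 ^ L' * ctr sh z i"] of_int_floor_le[of "2 ^ L' * \<rho> i"] 
      unfolding of_int_add of_int_diff of_int_1 by linarith
  qed
  have pw: "(2::real) ^ L' = 2 ^ l * 2 ^ (L' - l)" if "l \<le> L'" for l using that by (simp flip: power_add)
  have Ranc: "anc (L' - M) a = b" if "b \<in> cells M" "z \<in> S b" "a \<in> R z" for a b z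
    unfolding anc_eq_iff
  proof
    fix i
    have z: "b i * \<delta> \<le> ctr sh z i" "ctr sh z i + \<rho> i \<le> b i * \<delta> + \<delta>"
      using S[OF that(1)] that(2) by (auto simp: good_def)
    have p: "2 ^ L' * (b i * \<delta>) = b i * 2 ^ (L' - M)" "2 ^ L' * (b i * \<delta> + \<delta>) = (b i + 1) * 2 ^ (L' - M)"
      using pw[of M] M_less_L by (auto simp: \<delta>_def field_simps)
    have "2 ^ L' * (b i * \<delta>) \<le> 2 ^ L' * ctr sh z i" "2 ^ L' * (ctr sh z i + \<rho> i) \<le> 2 ^ L' * (b i * \<delta> + \<delta>)"
      using z by simp_all
    then have "real_of_int (b i * 2 ^ (L' - M)) \<le> real_of_int (a i)" "real_of_int (a i) < real_of_int ((b i + 1) * 2 ^ (L' - M))"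
      using Rin[OF that(3), of i] unfolding p by simp_all
    then show "b i * 2 ^ (L' - M) \<le> a i \<and> a i < (b i + 1) * 2 ^ (L' - M)"
      by (simp only: of_int_le_iff of_int_less_iff)
  qed
  \<comment> \<open>Boxes of different points may overlap, so the weight of a cell counts all
    \<open>z\<close> with \<open>a \<in> R z\<close>, each spreading mass
    \<open>1 / card (S b)\<close> evenly over its \<open>V\<close> cells.\<close>
  define \<nu> where "\<nu> a = (if a \<in> cells L' then
      real (card {z \<in> S (anc (L' - M) a). a \<in> R z}) / (real (card (S (anc (L' - M) a))) * V) else 0)" for a
  have cm: "cmass L' \<nu> l c = (\<Sum>z\<in>S b. real (card {a \<in> {a. a \<in> cells L' \<and> anc (L' - l) a = c}. a \<in> R z})) / (real (card (S b)) * V)"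
    if "M \<le> l" "l \<le> L'" "c \<in> cells l" "b = anc (l - M) c" for l c b
  proof -
    have b: "b \<in> cells M" using that anc_in_cells by blast
    have anc: "anc (L' - M) a = b" if "anc (L' - l) a = c" for a :: "'n \<Rightarrow> int"
      using \<open>M \<le> l\<close> \<open>l \<le> L'\<close> \<open>b = _\<close> that by (auto simp: anc_anc)
    have "cmass L' \<nu> l c = (\<Sum>a | a \<in> cells L' \<and> anc (L' - l) a = c. real (card {z \<in> S b. a \<in> R z}) / (real (card (S b)) * V))"
      unfolding cmass_def by (intro sum.cong refl) (auto simp: \<nu>_def anc)
    also have "\<dots> = (\<Sum>a | a \<in> cells L' \<and> anc (L' - l) a = c. real (card {z \<in> S b. a \<in> R z})) / (real (card (S b)) * V)"
      by (simp add: sum_divide_distrib)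
    also have "(\<Sum>a | a \<in> cells L' \<and> anc (L' - l) a = c. real (card {z \<in> S b. a \<in> R z}))
       = (\<Sum>z\<in>S b. real (card {a \<in> {a. a \<in> cells L' \<and> anc (L' - l) a = c}. a \<in> R z}))"
      by (rule sum_card_swap) (use S[OF b] in \<open>auto simp: good_def\<close>)
    finally show ?thesis .
  qed
  show ?thesis
  proof (rule that[OF M_less_L])
    show "\<nu> a \<ge> 0" for a using V by (simp add: \<nu>_def)
    show "cmass L' \<nu> M b = 1" if b: "b \<in> cells M" for b
    proof -
      have "{a \<in> {a. a \<in> cells L' \<and> anc (L' - M) a = b}. a \<in> R z} = R z" if "z \<in> S b" for z
        using Ranc[OF b that] b descendant_in_cells[of L' M] M_less_L by auto
      then have "cmass L' \<nu> M b = (\<Sum>z\<in>S b. V) / (real (card (S b)) * V)"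
        using cm[of M b b] M_less_L b R(2) by simp
      also have "\<dots> = 1" using V S[OF b] by (simp add: good_def)
      finally show ?thesis .
    qed
    show "\<exists>q::nat. q > m \<and> (\<exists>p::'n \<Rightarrow> int. \<forall>i. p i / q + sh q i < a i / 2 ^ L'
        \<and> (real_of_int (a i) + 1) / 2 ^ L' < p i / q + sh q i + q powr (- 1 - t i))" if "\<nu> a \<noteq> 0" for a
    proof -
      have a: "a \<in> cells L'" "card {z \<in> S (anc (L' - M) a). a \<in> R z} \<noteq> 0" using that by (auto simp: \<nu>_def split: if_splits)
      then have "{z \<in> S (anc (L' - M) a). a \<in> R z} \<noteq> {}" by (metis card.empty)
      then obtain z where z: "z \<in> S (anc (L' - M) a)" "a \<in> R z" by blast
      have b: "anc (L' - M) a \<in> cells M" using a(1) M_less_L by (simp add: anc_in_cells)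
      have q: "Q < fst z" "fst z \<le> 2 * Q" using S[OF b] z by (auto simp: good_def)
      have "real_of_int (snd z i) / real (fst z) + sh (fst z) i < a i / 2 ^ L' \<and> (real_of_int (a i) + 1) / 2 ^ L' < real_of_int (snd z i) / real (fst z) + sh (fst z) i + real (fst z) powr (- 1 - t i)" for i
      proof
        show "real_of_int (snd z i) / real (fst z) + sh (fst z) i < a i / 2 ^ L'"
          using Rin(1)[OF z(2), of i] by (simp add: ctr_def field_simps)
        have "(real_of_int (a i) + 1) / 2 ^ L' < ctr sh z i + \<rho> i"
          using Rin(2)[OF z(2), of i] by (simp add: field_simps)
        also have "\<rho> i \<le> real (fst z) powr (- 1 - t i)"
          unfolding \<rho>_def using q t(1)[of i] by (intro powr_mono2') auto
        finally show "(real_of_int (a i) + 1) / 2 ^ L' < real_of_int (snd z i) / real (fst z) + sh (fst z) i + real (fst z) powr (- 1 - t i)"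
          by (simp add: ctr_def)
      qed
      then show ?thesis using q Q(2) by (intro exI[of _ "fst z"] conjI exI[of _ "snd z"]) auto
    qed
    show "cmass L' \<nu> l c \<le> max (2 * 10 ^ CARD('n) * (2 ^ M / 2 ^ l) ^ CARD('n)) ((1 / 2 ^ l) powr s)"
      if l: "M < l" "l \<le> L'" "c \<in> cells l" for l c
    proof -
      define b where "b = anc (l - M) c"
      have b: "b \<in> cells M" using l by (simp add: b_def anc_in_cells)
      have gb: "good b (S b)" by (rule S[OF b])
      define r :: real where "r = 1 / 2 ^ l"
      have r: "r > 0" by (simp add: r_def)
      define C where "C = {z \<in> S b. \<forall>i. c i * r - \<rho> i \<le> ctr sh z i \<and> ctr sh z i \<le> c i * r + r}"
      define P where "P = (\<Prod>i\<in>UNIV. min 1 (2 * r / \<rho> i))"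
      have P0: "P \<ge> 0" unfolding P_def using r \<rho>0 by (auto intro!: prod_nonneg simp: less_imp_le)
      let ?D = "{a. a \<in> cells L' \<and> anc (L' - l) a = c}"
      \<comment> \<open>Only points of \<open>C\<close> have a box reaching into \<open>c\<close>.
        In direction \<open>i\<close> the overlap has at most \<open>wd i\<close> cells and at most
        \<open>2 ^ (L' - l)\<close>; the latter is at most \<open>wd i * (2 * r / \<rho> i)\<close>,
        the 2 coming from \<open>wd i\<close> being at least half of
        \<open>2 ^ L' * \<rho> i\<close>.\<close>
      have each: "real (card {a \<in> ?D. a \<in> R z}) \<le> (if z \<in> C then V * P else 0)" if "z \<in> S b" for z
      proof (cases "{a \<in> ?D. a \<in> R z} = {}")
        case True
        then show ?thesis using P0 V by (simp only:) simp
      next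
        case False
        then obtain a where a: "a \<in> R z" "anc (L' - l) a = c" by auto
        have "c i * r - \<rho> i \<le> ctr sh z i \<and> ctr sh z i \<le> c i * r + r" for i
        proof -
          have c: "c i * 2 ^ (L' - l) \<le> a i" "a i < (c i + 1) * 2 ^ (L' - l)" using a(2) by (auto simp: anc_eq_iff)
          have e: "real_of_int (x * 2 ^ (L' - l)) = 2 ^ L' * (x * r)" for x using pw[OF l(2)] by (simp add: r_def)
          have "real_of_int (c i * 2 ^ (L' - l)) \<le> real_of_int (a i)" using c(1) by (simp only: of_int_le_iff)
          also have "real_of_int (a i) \<le> 2 ^ L' * (ctr sh z i + \<rho> i)" using Rin(2)[OF a(1), of i] by simp
          finally have 1: "c i * r \<le> ctr sh z i + \<rho> i" unfolding e by simp
          have "2 ^ L' * ctr sh z i \<le> real_of_int (a i)" using Rin(1)[OF a(1), of i] by simp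
          also have "real_of_int (a i) \<le> real_of_int ((c i + 1) * 2 ^ (L' - l))" using c(2) by (simp only: of_int_le_iff)
          finally have "ctr sh z i \<le> (c i + 1) * r" unfolding e by simp
          then show ?thesis using 1 by (simp add: algebra_simps)
        qed
        then have "z \<in> C" using that by (simp add: C_def)
        let ?T = "\<lambda>i. {u z i..<u z i + wd i} \<inter> {c i * 2 ^ (L' - l)..<(c i + 1) * 2 ^ (L' - l)}"
        have "{a \<in> ?D. a \<in> R z} \<subseteq> {a. \<forall>i. a i \<in> ?T i}"
          by (auto simp: R_def anc_eq_iff)
        then have "card {a \<in> ?D. a \<in> R z} \<le> card {a. \<forall>i. a i \<in> ?T i}"
          by (intro card_mono card_dependent_functions) auto
        also have "\<dots> = (\<Prod>i\<in>UNIV. card (?T i))" by (intro card_dependent_functions) auto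
        also have "real \<dots> \<le> (\<Prod>i\<in>UNIV. wd i * min 1 (2 * r / \<rho> i))"
          unfolding of_nat_prod
        proof (rule prod_mono, rule conjI)
          fix i
          have "card (?T i) \<le> card {u z i..<u z i + wd i}" by (intro card_mono) auto
          then have "real (card (?T i)) \<le> real (card {u z i..<u z i + wd i})" by (simp only: of_nat_le_iff)
          also have "\<dots> = wd i" using wd(1)[of i] by simp
          finally have 1: "real (card (?T i)) \<le> wd i" .
          have "card (?T i) \<le> card {c i * 2 ^ (L' - l)..<(c i + 1) * 2 ^ (L' - l)}" by (intro card_mono) auto
          also have "\<dots> = 2 ^ (L' - l)" by (simp add: algebra_simps nat_power_eq)
          finally have "real (card (?T i)) \<le> real (2 ^ (L' - l))" by (simp only: of_nat_le_iff)
          also have "real (2 ^ (L' - l)) = 2 ^ (L' - l)" by simp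
          also have "\<dots> = 2 ^ L' * \<rho> i / 2 * (2 * r / \<rho> i)" using \<rho>0[of i] pw[OF l(2)] by (simp add: r_def)
          also have "\<dots> \<le> wd i * (2 * r / \<rho> i)" using wd(2)[of i] \<rho>0[of i] r by (intro mult_right_mono) auto
          finally show "real (card (?T i)) \<le> wd i * min 1 (2 * r / \<rho> i)" using 1 by (auto simp: min_def)
        qed simp
        also have "\<dots> = V * P" by (simp add: prod.distrib V_def P_def)
        finally show ?thesis using \<open>z \<in> C\<close> by simp
      qed
      have "cmass L' \<nu> l c = (\<Sum>z\<in>S b. real (card {a \<in> ?D. a \<in> R z})) / (real (card (S b)) * V)"
        by (rule cm) (use l in \<open>auto simp: b_def\<close>)
      also have "\<dots> \<le> (\<Sum>z\<in>S b. if z \<in> C then V * P else 0) / (real (card (S b)) * V)"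
        using V by (intro divide_right_mono sum_mono each) auto
      also have "(\<Sum>z\<in>S b. if z \<in> C then V * P else 0) = card C * (V * P)"
      proof -
        have "finite (S b)" "S b \<inter> C = C" using gb by (auto simp: good_def C_def)
        then show ?thesis by (simp add: sum.If_cases Int_def)
      qed
      also have "card C * (V * P) / (real (card (S b)) * V) = card C / card (S b) * P" using V by simp
      also have "\<dots> \<le> max (2 * 10 ^ ?n * (r / \<delta>) ^ ?n) (r powr s)"
        using gb[unfolded good_def, THEN conjunct2, THEN conjunct2, THEN conjunct2, rule_format, OF r, of "\<lambda>i. c i * r"]
        unfolding C_def P_def .
      finally show ?thesis by (simp add: r_def \<delta>_def)
    qed
  qed
qed

text \<open>Refining first gains \<open>\<kappa> = 1 / (2 * 10 ^ n)\<close>, the inverse of the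
  constant in the first entry of the maximum in \<open>local_measure\<close>, so the new weights
  again satisfy the bound with constant 1. The second entry needs only
  \<open>\<kappa> \<le> 1\<close>.\<close>

lemma frostman_step:
  fixes t :: "'n::finite \<Rightarrow> real" and sh :: "nat \<Rightarrow> 'n \<Rightarrow> real" and s :: real and w :: "('n \<Rightarrow> int) \<Rightarrow> real"
  assumes t: "\<And>i. t i > 0" "(\<Sum>i\<in>UNIV. t i) \<ge> 1"
    and s: "0 \<le> s" "s < CARD('n)"
    and k: "\<And>k. s * (1 + t k) < real CARD('n) + 1 + (\<Sum>i\<in>UNIV. max 0 (t k - t i))"
    and w: "frostman s L w"
  obtains L' w' where "L < L'" "frostman s L' w'"
    "\<And>a. w' a \<noteq> 0 \<Longrightarrow> w (anc (L' - L) a) \<noteq> 0"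
    "\<And>a. w' a \<noteq> 0 \<Longrightarrow> \<exists>q::nat. q > m \<and> (\<exists>p::'n \<Rightarrow> int. \<forall>i. p i / q + sh q i < a i / 2 ^ L'
        \<and> (real_of_int (a i) + 1) / 2 ^ L' < p i / q + sh q i + q powr (- 1 - t i))"
proof -
  let ?n = "CARD('n)"
  define \<kappa> :: real where "\<kappa> = 1 / (2 * 10 ^ ?n)"
  have \<kappa>: "\<kappa> > 0" "\<kappa> \<le> 1" by (auto simp: \<kappa>_def divide_le_eq intro: order.trans[OF one_le_power[of 10 ?n]])
  obtain M w1 where M: "M \<ge> L" "frostman s M w1" "\<And>b. b \<in> cells M \<Longrightarrow> w1 b \<le> \<kappa> * (1 / 2 ^ M) powr s"
    "\<And>a. w1 a \<noteq> 0 \<Longrightarrow> w (anc (M - L) a) \<noteq> 0"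
    using refine_frostman[OF w s(2) \<kappa>(1)] by metis
  show ?thesis
  proof (rule local_measure[OF t s k, where sh = sh and M = M and m = m])
    fix L' and \<nu> :: "('n \<Rightarrow> int) \<Rightarrow> real"
    assume L': "M < L'" and \<nu>: "\<And>a. \<nu> a \<ge> 0" "\<And>b. b \<in> cells M \<Longrightarrow> cmass L' \<nu> M b = 1"
      and box: "\<And>a. \<nu> a \<noteq> 0 \<Longrightarrow> \<exists>q::nat. q > m \<and> (\<exists>p::'n \<Rightarrow> int. \<forall>i. p i / q + sh q i < a i / 2 ^ L'
        \<and> (real_of_int (a i) + 1) / 2 ^ L' < p i / q + sh q i + q powr (- 1 - t i))"
      and le: "\<And>l c. M < l \<Longrightarrow> l \<le> L' \<Longrightarrow> c \<in> cells l \<Longrightarrow>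
         cmass L' \<nu> l c \<le> max (2 * 10 ^ ?n * (2 ^ M / 2 ^ l) ^ ?n) ((1 / 2 ^ l) powr s)"
    show thesis
    proof (rule that[of L' "\<lambda>a. w1 (anc (L' - M) a) * \<nu> a"])
      show "frostman s L' (\<lambda>a. w1 (anc (L' - M) a) * \<nu> a)"
      proof (rule redistribute[OF M(2)])
        fix l and c :: "'n \<Rightarrow> int" assume l: "M < l" "l \<le> L'" "c \<in> cells l"
        have b: "anc (l - M) c \<in> cells M" using l by (simp add: anc_in_cells)
        have c0: "cmass L' \<nu> l c \<ge> 0" using \<nu>(1) by (simp add: cmass_def sum_nonneg)
        have "w1 (anc (l - M) c) * cmass L' \<nu> l c \<le> (\<kappa> * (1 / 2 ^ M) powr s) * max (2 * 10 ^ ?n * (2 ^ M / 2 ^ l) ^ ?n) ((1 / 2 ^ l) powr s)"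
          using M(3)[OF b] le[OF l] c0 \<kappa> by (intro mult_mono) auto
        also have "\<dots> \<le> (1 / 2 ^ l) powr s"
        proof -
          have lm: "(2::real) ^ l = 2 ^ M * 2 ^ (l - M)" using l by (simp flip: power_add)
          then have "(2 ^ M / 2 ^ l :: real) = 1 / 2 ^ (l - M)" by simp
          then have "(2 ^ M / 2 ^ l :: real) ^ ?n \<le> (1 / 2 ^ (l - M)) powr s"
            using power_le_powr_of_le_1[of "1 / 2 ^ (l - M)" s ?n] s by simp
          then have "(1 / 2 ^ M) powr s * (2 ^ M / 2 ^ l :: real) ^ ?n \<le> (1 / 2 ^ M) powr s * (1 / 2 ^ (l - M)) powr s"
            by (intro mult_left_mono) auto
          also have "\<dots> = (1 / 2 ^ l) powr s" unfolding lm by (simp flip: powr_mult)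
          finally have "(\<kappa> * (1 / 2 ^ M) powr s) * (2 * 10 ^ ?n * (2 ^ M / 2 ^ l) ^ ?n) \<le> (1 / 2 ^ l) powr s"
            by (simp add: \<kappa>_def)
          moreover have "(\<kappa> * (1 / 2 ^ M) powr s) * (1 / 2 ^ l) powr s \<le> (1 * 1) * (1 / 2 ^ l) powr s"
            using \<kappa> s by (intro mult_right_mono mult_mono powr_le1) auto
          ultimately show ?thesis by (simp add: max_def)
        qed
        finally show "w1 (anc (l - M) c) * cmass L' \<nu> l c \<le> (1 / 2 ^ l) powr s" .
      qed (use L' \<nu> in auto)
      show "w (anc (L' - L) a) \<noteq> 0" if "w1 (anc (L' - M) a) * \<nu> a \<noteq> 0" for a
        using M(4)[of "anc (L' - M) a"] that M(1) L' by (simp add: anc_anc)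
      show "\<exists>q::nat. q > m \<and> (\<exists>p::'n \<Rightarrow> int. \<forall>i. p i / q + sh q i < a i / 2 ^ L'
        \<and> (real_of_int (a i) + 1) / 2 ^ L' < p i / q + sh q i + q powr (- 1 - t i))" if "w1 (anc (L' - M) a) * \<nu> a \<noteq> 0" for a
        using box that by auto
    qed (use M(1) L' in auto)
  qed
qed

text \<open>Closed cubes, unlike the half-open cells behind \<open>anc\<close>, make every stage
  compact.\<close>

definition closed_cells :: "nat \<Rightarrow> (('n::finite \<Rightarrow> int) \<Rightarrow> real) \<Rightarrow> (real ^ 'n) set" where
  "closed_cells L w = (\<Union>a\<in>{a \<in> cells L. w a \<noteq> 0}. {x. \<forall>i. a i / 2 ^ L \<le> x $ i \<and> x $ i \<le> (real_of_int (a i) + 1) / 2 ^ L})"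

lemma compact_closed_cells: "compact (closed_cells L w)"
  unfolding closed_cells_def
proof (rule compact_UN)
  fix a :: "'a \<Rightarrow> int"
  have "{x. \<forall>i. a i / 2 ^ L \<le> x $ i \<and> x $ i \<le> (real_of_int (a i) + 1) / 2 ^ L}
     = cbox (\<chi> i. a i / 2 ^ L) (\<chi> i. (real_of_int (a i) + 1) / 2 ^ L)"
    by (auto simp: mem_box_cart)
  then show "compact {x. \<forall>i. a i / 2 ^ L \<le> x $ i \<and> x $ i \<le> (real_of_int (a i) + 1) / 2 ^ L}"
    by (simp add: compact_cbox)
qed auto

lemma closed_cells_mono:
  fixes w w' :: "('n::finite \<Rightarrow> int) \<Rightarrow> real"
  assumes "L \<le> L'" "\<And>a. w' a \<noteq> 0 \<Longrightarrow> w (anc (L' - L) a) \<noteq> 0"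
  shows "closed_cells L' w' \<subseteq> closed_cells L w"
proof
  fix x assume "x \<in> closed_cells L' w'"
  then obtain a where a: "a \<in> cells L'" "w' a \<noteq> 0" and x: "\<And>i. a i / 2 ^ L' \<le> x $ i \<and> x $ i \<le> (real_of_int (a i) + 1) / 2 ^ L'"
    by (auto simp: closed_cells_def)
  define b where "b = anc (L' - L) a"
  have b: "b \<in> cells L" "w b \<noteq> 0" using assms a anc_in_cells by (auto simp: b_def)
  have "b i / 2 ^ L \<le> x $ i \<and> x $ i \<le> (real_of_int (b i) + 1) / 2 ^ L" for i
  proof -
    have "b i * 2 ^ (L' - L) \<le> a i" "a i + 1 \<le> (b i + 1) * 2 ^ (L' - L)"
      using anc_eq_iff[of "L' - L" a b] by (auto simp: b_def add1_zle_eq)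
    then have ab: "real_of_int (b i * 2 ^ (L' - L)) \<le> real_of_int (a i)" "real_of_int (a i + 1) \<le> real_of_int ((b i + 1) * 2 ^ (L' - L))"
      by (simp_all only: of_int_le_iff)
    have pw: "(2::real) ^ L' = 2 ^ L * 2 ^ (L' - L)" using assms(1) by (simp flip: power_add)
    have e: "real_of_int (y * 2 ^ (L' - L)) / 2 ^ L' = y / 2 ^ L" for y by (simp add: pw)
    have "b i / 2 ^ L \<le> a i / 2 ^ L'" unfolding e[symmetric] by (intro divide_right_mono ab) auto
    moreover have "(real_of_int (a i + 1)) / 2 ^ L' \<le> real_of_int (b i + 1) / 2 ^ L" unfolding e[symmetric] by (intro divide_right_mono ab) auto
    ultimately show ?thesis using x[of i] by auto
  qed
  then show "x \<in> closed_cells L w" using b unfolding closed_cells_def by blast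
qed

text \<open>Take the first level \<open>l\<close> with \<open>1 / 2 ^ l \<le> r\<close>; then
  \<open>r \<le> 2 / 2 ^ l\<close>. Along each axis the box, of side \<open>4 * r\<close>, meets at
  most \<open>4 * (2 ^ l * r) + 2 \<le> 10\<close> cells of that level, each with mass at most
  \<open>r powr s\<close>. The 12 is slack.\<close>

lemma frostman_mass_in_box:
  fixes w :: "('n::finite \<Rightarrow> int) \<Rightarrow> real" and x :: "real ^ 'n" and s r :: real
  assumes w: "frostman s L w" and s: "0 \<le> s" "s \<le> CARD('n)" and r: "0 < r" "r \<le> 1" "1 / 2 ^ L \<le> r"
  shows "(\<Sum>a | a \<in> cells L \<and> (\<forall>i. \<bar>a i / 2 ^ L - x $ i\<bar> < 2 * r). w a) \<le> 12 ^ CARD('n) * r powr s"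
proof -
  let ?n = "CARD('n)"
  define l where "l = (LEAST l. 1 / 2 ^ l \<le> r)"
  have l: "1 / 2 ^ l \<le> r" "l \<le> L" unfolding l_def using r(3) by (auto intro: LeastI Least_le)
  have lr: "r \<le> 2 / 2 ^ l"
  proof (cases l)
    case 0 then show ?thesis using r by simp
  next
    case (Suc m)
    then have "\<not> 1 / 2 ^ m \<le> r" using not_less_Least[of m "\<lambda>l. 1 / 2 ^ l \<le> r"] by (simp add: l_def)
    then show ?thesis using Suc by simp
  qed
  let ?A = "{a. a \<in> cells L \<and> (\<forall>i. \<bar>a i / 2 ^ L - x $ i\<bar> < 2 * r)}"
  define T where "T i = {y::int. 2 ^ l * (x $ i - 2 * r) - 1 \<le> y \<and> y \<le> 2 ^ l * (x $ i + 2 * r)}" for i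
  have Tle: "2 ^ l * (x $ i - 2 * r) - 1 \<le> 2 ^ l * (x $ i + 2 * r)" for i
  proof -
    have "2 ^ l * (x $ i - 2 * r) \<le> 2 ^ l * (x $ i + 2 * r)" using r by (intro mult_left_mono) auto
    then show ?thesis by linarith
  qed
  have finT: "finite (T i)" for i unfolding T_def by (rule card_ints_le[OF Tle])
  have cT: "real (card (T i)) \<le> 10" for i
  proof -
    have "real (card (T i)) \<le> 2 ^ l * (x $ i + 2 * r) - (2 ^ l * (x $ i - 2 * r) - 1) + 1"
      unfolding T_def by (rule card_ints_le[OF Tle])
    also have "\<dots> = 4 * (2 ^ l * r) + 2" by (simp add: algebra_simps)
    also have "2 ^ l * r \<le> 2" using lr by (simp add: field_simps)
    finally show ?thesis by simp
  qed
  have "(\<Sum>a\<in>?A. w a) \<le> (\<Sum>c\<in>{c. \<forall>i. c i \<in> T i}. cmass L w l c)"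
  proof -
    have sub: "anc (L - l) ` ?A \<subseteq> {c. \<forall>i. c i \<in> T i}"
    proof safe
      fix a :: "'n \<Rightarrow> int" and i assume a: "\<forall>i. \<bar>a i / 2 ^ L - x $ i\<bar> < 2 * r"
      define c where "c = anc (L - l) a i"
      have "c * 2 ^ (L - l) \<le> a i" "a i \<le> (c + 1) * 2 ^ (L - l)"
        using anc_eq_iff[of "L - l" a "anc (L - l) a"] by (auto simp: c_def less_imp_le)
      then have ab: "real_of_int (c * 2 ^ (L - l)) \<le> real_of_int (a i)" "real_of_int (a i) \<le> real_of_int ((c + 1) * 2 ^ (L - l))"
        by (simp_all only: of_int_le_iff)
      have pw: "(2::real) ^ L = 2 ^ l * 2 ^ (L - l)" using l(2) by (simp flip: power_add)
      have e: "2 ^ l * (real_of_int (y * 2 ^ (L - l)) / 2 ^ L) = y" for y by (simp add: pw)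
      have "2 ^ l * (real_of_int (c * 2 ^ (L - l)) / 2 ^ L) \<le> 2 ^ l * (a i / 2 ^ L)"
        "2 ^ l * (a i / 2 ^ L) \<le> 2 ^ l * (real_of_int ((c + 1) * 2 ^ (L - l)) / 2 ^ L)"
        by (intro mult_left_mono divide_right_mono ab; simp)+
      then have 1: "c \<le> 2 ^ l * (a i / 2 ^ L)" "2 ^ l * (a i / 2 ^ L) \<le> real_of_int (c + 1)" unfolding e by simp_all
      have "x $ i - 2 * r \<le> a i / 2 ^ L" "a i / 2 ^ L \<le> x $ i + 2 * r"
        using a[rule_format, of i] by linarith+
      then have "2 ^ l * (x $ i - 2 * r) \<le> 2 ^ l * (a i / 2 ^ L)" "2 ^ l * (a i / 2 ^ L) \<le> 2 ^ l * (x $ i + 2 * r)"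
        by (intro mult_left_mono; simp)+
      then show "anc (L - l) a i \<in> T i" using 1 unfolding T_def c_def[symmetric] by simp
    qed
    have "(\<Sum>a\<in>?A. w a) = (\<Sum>c\<in>{c. \<forall>i. c i \<in> T i}. \<Sum>a | a \<in> ?A \<and> anc (L - l) a = c. w a)"
      by (rule sum.group[symmetric]) (use sub finT in \<open>auto intro: card_dependent_functions\<close>)
    also have "\<dots> \<le> (\<Sum>c\<in>{c. \<forall>i. c i \<in> T i}. cmass L w l c)"
      unfolding cmass_def by (intro sum_mono sum_mono2) (use w in \<open>auto simp: frostman_def\<close>)
    finally show ?thesis .
  qed
  also have "\<dots> \<le> (\<Sum>c\<in>{c. \<forall>i. c i \<in> T i}. (1 / 2 ^ l) powr s)"
    using w l by (intro sum_mono) (auto simp: frostman_def)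
  also have "\<dots> = (\<Prod>i\<in>UNIV. real (card (T i))) * (1 / 2 ^ l) powr s"
    using finT by (simp add: card_dependent_functions)
  also have "\<dots> \<le> (\<Prod>i\<in>(UNIV :: 'n set). 10) * r powr s"
    using cT l s by (intro mult_mono prod_mono powr_mono2) (auto intro: prod_nonneg)
  also have "\<dots> \<le> 12 ^ ?n * r powr s" by (intro mult_right_mono) (auto intro!: power_mono)
  finally show ?thesis .
qed

section \<open>Positive Hausdorff measure of the Cantor set\<close>

lemma sum_Union_le:
  fixes f :: "'a \<Rightarrow> real"
  assumes "finite J" "\<And>i. finite (N i)" "\<And>a. f a \<ge> 0"
  shows "sum f (\<Union>i\<in>J. N i) \<le> (\<Sum>i\<in>J. sum f (N i))"
  using assms(1)
proof induction
  case (insert i J)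
  have "sum f (N i \<union> (\<Union>i\<in>J. N i)) \<le> sum f (N i) + sum f (\<Union>i\<in>J. N i)"
    using insert.hyps assms by (subst sum_Un) (auto intro!: sum_nonneg)
  then show ?case using insert by simp
qed simp

text \<open>This is the mass distribution principle carried out on a finite stage: total weight 1 is
  compared with the weights that finitely many covering boxes can capture at a level finer than all
  of them.\<close>

lemma cantor_hausdorff_measure_pos:
  fixes A :: "(real ^ 'n::finite) set" and s :: real and L :: "nat \<Rightarrow> nat" and w :: "nat \<Rightarrow> ('n \<Rightarrow> int) \<Rightarrow> real"
  assumes s: "0 \<le> s" "s \<le> CARD('n)"
    and w: "\<And>m. frostman s (L m) (w m)" and L: "\<And>m. L m < L (Suc m)"
    and nest: "\<And>m a. w (Suc m) a \<noteq> 0 \<Longrightarrow> w m (anc (L (Suc m) - L m) a) \<noteq> 0"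
    and A: "(\<Inter>m. closed_cells (L m) (w m)) \<subseteq> A"
  shows "hausdorff_measure s A \<noteq> 0"
proof
  let ?n = "CARD('n)"
  assume zero: "hausdorff_measure s A = 0"
  \<comment> \<open>Capturing weight 1 forces the \<open>r i powr s\<close> to sum to at least
    \<open>2 * c\<close>. The cover costs less than \<open>c\<close>, and the enlargements
    \<open>e i\<close> add at most another \<open>c\<close>.\<close>
  define c :: real where "c = 1 / (2 * 12 ^ ?n)"
  have c: "c > 0" by (simp add: c_def)
  have "hausdorff_premeasure 1 s A \<le> hausdorff_measure s A"
    unfolding hausdorff_measure_def by (rule SUP_upper) simp
  then have "hausdorff_premeasure 1 s A < ennreal c" using zero c by simp
  then obtain U where U: "A \<subseteq> (\<Union>i. U i)" "\<And>i. bounded (U i)" "\<And>i. diameter (U i) \<le> 1"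
      and sumU: "(\<Sum>i. diam_pow s (U i)) < ennreal c"
    unfolding hausdorff_premeasure_def by (auto simp: Inf_less_iff)
  define e where "e i = c / 2 ^ Suc i" for i
  have e: "e i > 0" for i using c by (simp add: e_def)
  \<comment> \<open>Radii must be positive to give open boxes. A set of diameter 0 costs nothing
    when \<open>s > 0\<close>, so its radius is paid for by \<open>e i\<close>; for
    \<open>s = 0\<close> every nonempty set costs 1 and radius 1 will do.\<close>
  have "\<exists>r>0. r \<le> 1 \<and> diameter (U i) \<le> r \<and> ennreal (r powr s) \<le> diam_pow s (U i) + ennreal (e i)"
    if ne: "U i \<noteq> {}" for i
  proof -
    have d0: "diameter (U i) \<ge> 0" by (rule diameter_ge_0[OF U(2)])
    consider "s = 0" | "s > 0" "diameter (U i) > 0" | "s > 0" "diameter (U i) = 0" using s d0 by linarith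
    then show ?thesis
    proof cases
      case 1
      then show ?thesis using ne U(3)[of i] by (intro exI[of _ 1]) (auto simp: diam_pow_def)
    next
      case 2
      then show ?thesis using ne U(3)[of i] by (intro exI[of _ "diameter (U i)"]) (auto simp: diam_pow_def)
    next
      case 3
      define r where "r = min 1 (e i powr (1 / s))"
      have "r > 0" using e[of i] by (simp add: r_def)
      moreover have "r powr s \<le> (e i powr (1 / s)) powr s"
        using \<open>r > 0\<close> s by (intro powr_mono2) (auto simp: r_def)
      then have "r powr s \<le> e i" using 3 e[of i] by (simp add: powr_powr)
      then have "ennreal (r powr s) \<le> ennreal (e i)" by (rule ennreal_leI)
      then have "ennreal (r powr s) \<le> diam_pow s (U i) + ennreal (e i)"
        by (rule order.trans) simp
      ultimately show ?thesis using 3 by (intro exI[of _ r]) (auto simp: r_def)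
    qed
  qed
  then obtain r where r: "\<And>i. U i \<noteq> {} \<Longrightarrow> 0 < r i \<and> r i \<le> 1 \<and> diameter (U i) \<le> r i
      \<and> ennreal (r i powr s) \<le> diam_pow s (U i) + ennreal (e i)" by metis
  define x where "x i = (SOME y. y \<in> U i)" for i
  have x: "x i \<in> U i" if "U i \<noteq> {}" for i using that by (simp add: x_def some_in_eq)
  define B where "B i = box (x i - (\<chi> j. 2 * r i)) (x i + (\<chi> j. 2 * r i))" for i
  have B: "y \<in> B i \<longleftrightarrow> (\<forall>j. \<bar>y $ j - x i $ j\<bar> < 2 * r i)" for y i
    by (auto simp: B_def mem_box_cart abs_less_iff algebra_simps)
  let ?I = "{i. U i \<noteq> {}}"
  have UB: "U i \<subseteq> B i" if i: "i \<in> ?I" for i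
  proof
    fix y assume y: "y \<in> U i"
    have "\<bar>y $ j - x i $ j\<bar> < 2 * r i" for j
    proof -
      have "\<bar>y $ j - x i $ j\<bar> = \<bar>(y - x i) $ j\<bar>" by simp
      also have "\<dots> \<le> norm (y - x i)" by (rule component_le_norm_cart)
      also have "\<dots> = dist y (x i)" by (simp add: dist_norm)
      also have "\<dots> \<le> diameter (U i)" using y x i by (intro diameter_bounded_bound[OF U(2)]) auto
      finally show ?thesis using r[of i] i by auto
    qed
    then show "y \<in> B i" by (simp add: B)
  qed
  define K where "K m = closed_cells (L m) (w m)" for m
  have Kdec: "K m' \<subseteq> K m" if "m \<le> m'" for m m'
  proof (rule lift_Suc_antimono_le[OF _ that])
    show "K (Suc m) \<subseteq> K m" for m unfolding K_def
      by (rule closed_cells_mono) (use L nest in \<open>auto simp: less_imp_le\<close>)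
  qed
  \<comment> \<open>Otherwise the stages minus the open union would be decreasing nonempty compact
    sets, and a common point would lie in \<open>A\<close> but in no box.\<close>
  have "\<exists>m. K m \<subseteq> (\<Union>i\<in>?I. B i)"
  proof (rule ccontr)
    assume neg: "\<not> ?thesis"
    define F where "F m = K m - (\<Union>i\<in>?I. B i)" for m
    have "open (\<Union>i\<in>?I. B i)" by (auto simp: B_def)
    then have "compact (F m)" for m
      unfolding F_def K_def by (intro compact_diff compact_closed_cells)
    moreover have "F m \<noteq> {}" for m using neg by (auto simp: F_def)
    moreover have "F m' \<subseteq> F m" if "m \<le> m'" for m m' using Kdec[OF that] by (auto simp: F_def)
    ultimately have "\<Inter>(range F) \<noteq> {}" by (rule compact_nest)
    then obtain y where y: "\<And>m. y \<in> F m" by blast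
    then have "y \<in> A" using A by (auto simp: F_def K_def)
    then obtain i where "y \<in> U i" using U by blast
    then show False using UB[of i] y[of 0] by (auto simp: F_def)
  qed
  then obtain m0 where m0: "K m0 \<subseteq> (\<Union>i\<in>?I. B i)" by blast
  obtain J where J: "J \<subseteq> ?I" "finite J" "K m0 \<subseteq> (\<Union>i\<in>J. B i)"
    by (rule compactE_image[of "K m0" ?I B]) (use m0 in \<open>auto simp: K_def compact_closed_cells B_def\<close>)
  have rJ: "0 < r i" "r i \<le> 1" "ennreal (r i powr s) \<le> diam_pow s (U i) + ennreal (e i)" if "i \<in> J" for i
    using r[of i] J(1) that by blast+
  have Lm: "L m \<ge> m" for m by (induction m) (use L le_less_trans in \<open>auto simp: Suc_le_eq intro: le_less_trans\<close>)
  obtain m where m: "m \<ge> m0" "\<And>i. i \<in> J \<Longrightarrow> 1 / 2 ^ L m \<le> r i"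
  proof -
    have "\<forall>i\<in>J. eventually (\<lambda>m::nat. (1 / 2) ^ m < r i) sequentially"
      using rJ(1) by (auto intro!: order_tendstoD[OF LIMSEQ_power_zero])
    then have "eventually (\<lambda>m::nat. \<forall>i\<in>J. (1 / 2) ^ m < r i) sequentially"
      using J(2) by (simp add: eventually_ball_finite_distrib)
    then have "eventually (\<lambda>m. m \<ge> m0 \<and> (\<forall>i\<in>J. (1 / 2) ^ m < r i)) sequentially"
      using eventually_ge_at_top by (rule eventually_conj[rotated])
    then obtain m where m: "m \<ge> m0" "\<And>i. i \<in> J \<Longrightarrow> (1 / 2) ^ m < r i"
      by (auto dest!: eventually_happens)
    have "1 / 2 ^ L m \<le> r i" if "i \<in> J" for i
    proof -
      have "1 / 2 ^ L m \<le> (1 / 2 ^ m :: real)" using Lm[of m] by (simp add: frac_le)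
      also have "\<dots> \<le> r i" using m(2)[OF that] by (simp add: power_one_over)
      finally show ?thesis .
    qed
    then show ?thesis using that m(1) by blast
  qed
  let ?N = "\<lambda>i. {a. a \<in> cells (L m) \<and> (\<forall>j. \<bar>a j / 2 ^ L m - x i $ j\<bar> < 2 * r i)}"
  have "1 = (\<Sum>a\<in>cells (L m). w m a)" using w by (simp add: frostman_def)
  also have "\<dots> = (\<Sum>a | a \<in> cells (L m) \<and> w m a \<noteq> 0. w m a)"
    by (rule sum.mono_neutral_right) auto
  also have "\<dots> \<le> (\<Sum>a\<in>(\<Union>i\<in>J. ?N i). w m a)"
  proof (rule sum_mono2)
    show "finite (\<Union>i\<in>J. ?N i)" using J(2) by auto
    show "{a. a \<in> cells (L m) \<and> w m a \<noteq> 0} \<subseteq> (\<Union>i\<in>J. ?N i)"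
    proof
      fix a assume a: "a \<in> {a. a \<in> cells (L m) \<and> w m a \<noteq> 0}"
      \<comment> \<open>The lower corner stands for its cell: whichever box contains the corner is
        charged with the weight of the cell.\<close>
      have "(\<chi> j. a j / 2 ^ L m) \<in> K m" using a unfolding K_def closed_cells_def
        by (intro UN_I[of a]) (auto simp: divide_right_mono)
      then obtain i where "i \<in> J" "(\<chi> j. a j / 2 ^ L m) \<in> B i" using Kdec[OF m(1)] J(3) by blast
      then show "a \<in> (\<Union>i\<in>J. ?N i)" using a by (auto simp: B)
    qed
  qed (use w in \<open>auto simp: frostman_def\<close>)
  also have "\<dots> \<le> (\<Sum>i\<in>J. \<Sum>a\<in>?N i. w m a)"
    using w J(2) by (intro sum_Union_le) (auto simp: frostman_def)
  also have "\<dots> \<le> (\<Sum>i\<in>J. 12 ^ ?n * r i powr s)"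
    by (intro sum_mono frostman_mass_in_box[OF w s]) (use rJ m(2) in auto)
  also have "\<dots> = 12 ^ ?n * (\<Sum>i\<in>J. r i powr s)" by (simp add: sum_distrib_left)
  finally have lower: "2 * c \<le> (\<Sum>i\<in>J. r i powr s)" by (simp add: c_def field_simps)
  have "ennreal (\<Sum>i\<in>J. r i powr s) = (\<Sum>i\<in>J. ennreal (r i powr s))" by simp
  also have "\<dots> \<le> (\<Sum>i\<in>J. diam_pow s (U i) + ennreal (e i))"
    using rJ by (intro sum_mono) auto
  also have "\<dots> = (\<Sum>i\<in>J. diam_pow s (U i)) + ennreal (\<Sum>i\<in>J. e i)"
    using e by (simp add: sum.distrib less_imp_le)
  also have "\<dots> \<le> (\<Sum>i. diam_pow s (U i)) + ennreal c"
  proof (intro add_mono ennreal_leI)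
    show "(\<Sum>i\<in>J. diam_pow s (U i)) \<le> (\<Sum>i. diam_pow s (U i))" using J(2) by (intro sum_le_suminf) auto
    have "(\<lambda>i. c * (1 / 2) ^ Suc i) sums (c * 1)" by (intro sums_mult power_half_series)
    then have "e sums c" by (simp add: e_def[abs_def] power_one_over)
    then show "(\<Sum>i\<in>J. e i) \<le> c" using e J(2) sum_le_suminf[of e J] by (auto simp: sums_iff less_imp_le)
  qed
  also have "\<dots> < ennreal c + ennreal c"
    using sumU by (simp add: ennreal_add_left_cancel_less add.commute)
  also have "\<dots> = ennreal (2 * c)" using c by (simp flip: ennreal_plus)
  finally show False using lower c by (simp add: ennreal_less_iff sum_nonneg)
qed

text \<open>Starting from mass 1 on the unit cube, dependent choice iterates
  \<open>frostman_step\<close>, with denominators above \<open>m\<close> at step \<open>m\<close>.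
  Closed cells of the new stage lie strictly inside the boxes, so a point of all stages satisfies
  the strict inequalities for arbitrarily large \<open>q\<close>.\<close>

lemma limsup_boxes_hausdorff_measure_pos:
  fixes t :: "'n::finite \<Rightarrow> real" and sh :: "nat \<Rightarrow> 'n \<Rightarrow> real" and s :: real
  assumes t: "\<And>i. t i > 0" "(\<Sum>i\<in>UNIV. t i) \<ge> 1"
    and s: "0 \<le> s" "s < CARD('n)"
    and k: "\<And>k. s * (1 + t k) < real CARD('n) + 1 + (\<Sum>i\<in>UNIV. max 0 (t k - t i))"
  shows "hausdorff_measure s {x :: real ^ 'n. (\<forall>i. 0 \<le> x $ i \<and> x $ i \<le> 1) \<and> (\<forall>m::nat. \<exists>q>m. \<exists>p :: 'n \<Rightarrow> int.
     \<forall>i. p i / real q + sh q i < x $ i \<and> x $ i < p i / real q + sh q i + real q powr (- 1 - t i))} \<noteq> 0"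
proof -
  define P where "P = (\<lambda>(_::nat) (L, w :: ('n \<Rightarrow> int) \<Rightarrow> real). frostman s L w)"
  define R where "R = (\<lambda>m (L, w :: ('n \<Rightarrow> int) \<Rightarrow> real) (L', w' :: ('n \<Rightarrow> int) \<Rightarrow> real). L < L' \<and> (\<forall>a. w' a \<noteq> 0 \<longrightarrow> w (anc (L' - L) a) \<noteq> 0) \<and>
     (\<forall>a. w' a \<noteq> 0 \<longrightarrow> (\<exists>q::nat. q > m \<and> (\<exists>p::'n \<Rightarrow> int. \<forall>i. p i / q + sh q i < a i / 2 ^ L'
        \<and> (real_of_int (a i) + 1) / 2 ^ L' < p i / q + sh q i + q powr (- 1 - t i)))))"
  have "\<exists>f. \<forall>m. P m (f m) \<and> R m (f m) (f (Suc m))"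
  proof (rule dependent_nat_choice)
    have c0: "cells 0 = {\<lambda>_::'n. 0}" by (auto simp: cells_def fun_eq_iff) (metis order_antisym zless_imp_add1_zle add.commute add_le_cancel_left add_0)
    have "frostman s 0 (\<lambda>a::'n \<Rightarrow> int. 1)"
      unfolding frostman_def cmass_def c0 using card_mono[of "{\<lambda>_::'n. 0::int}"] by (auto simp: Collect_conv_if)
    then show "\<exists>x. P 0 x" by (auto simp: P_def)
    fix x m assume "P m x"
    then obtain L w where x: "x = (L, w)" "frostman s L w" by (auto simp: P_def)
    obtain L' w' where "L < L'" "frostman s L' w'"
      "\<And>a. w' a \<noteq> 0 \<Longrightarrow> w (anc (L' - L) a) \<noteq> 0"
      "\<And>a. w' a \<noteq> 0 \<Longrightarrow> \<exists>q::nat. q > m \<and> (\<exists>p::'n \<Rightarrow> int. \<forall>i. p i / q + sh q i < a i / 2 ^ L'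
        \<and> (real_of_int (a i) + 1) / 2 ^ L' < p i / q + sh q i + q powr (- 1 - t i))"
      by (rule frostman_step[OF t s k x(2), where sh = sh and m = m]) blast
    then have "P (Suc m) (L', w') \<and> R m x (L', w')" unfolding P_def R_def x(1) prod.case by blast
    then show "\<exists>y. P (Suc m) y \<and> R m x y" by blast
  qed
  then obtain f where f: "\<And>m. P m (f m)" "\<And>m. R m (f m) (f (Suc m))" by blast
  define L where "L m = fst (f m)" for m
  define w where "w m = snd (f m)" for m
  have w: "frostman s (L m) (w m)" for m using f(1)[of m] by (simp add: P_def L_def w_def case_prod_beta)
  have step: "L m < L (Suc m)" "\<And>a. w (Suc m) a \<noteq> 0 \<Longrightarrow> w m (anc (L (Suc m) - L m) a) \<noteq> 0"
    "\<And>a. w (Suc m) a \<noteq> 0 \<Longrightarrow> (\<exists>q::nat. q > m \<and> (\<exists>p::'n \<Rightarrow> int. \<forall>i. p i / q + sh q i < a i / 2 ^ L (Suc m)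
        \<and> (real_of_int (a i) + 1) / 2 ^ L (Suc m) < p i / q + sh q i + q powr (- 1 - t i)))" for m
    using f(2)[of m] by (simp_all add: R_def L_def w_def case_prod_beta)
  show ?thesis
  proof (rule cantor_hausdorff_measure_pos[of s L w], fact s(1), simp add: s less_imp_le, fact w, fact step(1), erule step(2), rule subsetI, rule CollectI, intro conjI allI)
    fix x assume x: "x \<in> (\<Inter>m. closed_cells (L m) (w m))"
    {
      fix i
      have "x \<in> closed_cells (L 0) (w 0)" using x by blast
      then obtain a where a: "a \<in> cells (L 0)" "a i / 2 ^ L 0 \<le> x $ i" "x $ i \<le> (real_of_int (a i) + 1) / 2 ^ L 0"
        by (auto simp: closed_cells_def)
      then have "0 \<le> a i" "a i + 1 \<le> 2 ^ L 0" by (auto simp: cells_def add1_zle_eq)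
      then have "0 \<le> real_of_int (a i)" "real_of_int (a i + 1) \<le> real_of_int (2 ^ L 0)" by (simp_all only: of_int_le_iff of_int_0_le_iff)
      then have "0 \<le> a i / 2 ^ L 0" "(real_of_int (a i) + 1) / 2 ^ L 0 \<le> 1" by (auto simp: divide_le_eq)
      then show "0 \<le> x $ i" "x $ i \<le> 1" using a by linarith+
    }
    fix m
    have "x \<in> closed_cells (L (Suc m)) (w (Suc m))" using x by blast
    then obtain a where a: "w (Suc m) a \<noteq> 0" "\<And>i. a i / 2 ^ L (Suc m) \<le> x $ i \<and> x $ i \<le> (real_of_int (a i) + 1) / 2 ^ L (Suc m)"
      by (auto simp: closed_cells_def)
    obtain q :: nat and p :: "'n \<Rightarrow> int" where "q > m" and qp: "\<And>i. p i / q + sh q i < a i / 2 ^ L (Suc m)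
        \<and> (real_of_int (a i) + 1) / 2 ^ L (Suc m) < p i / q + sh q i + q powr (- 1 - t i)"
      using step(3)[OF a(1)] by blast
    have "p i / real q + sh q i < x $ i \<and> x $ i < p i / real q + sh q i + real q powr (- 1 - t i)" for i
      using qp[of i] a(2)[of i] by linarith
    then show "\<exists>q>m. \<exists>p :: 'n \<Rightarrow> int. \<forall>i. p i / real q + sh q i < x $ i \<and> x $ i < p i / real q + sh q i + real q powr (- 1 - t i)"
      using \<open>q > m\<close> by blast
  qed
qed

section \<open>Covering the limsup set\<close>

text \<open>The Hausdorff-Cantelli argument: the families with index at least \<open>N\<close> cover
  \<open>A\<close>, and their cost is a tail of a convergent series. The finite families are padded
  with empty sets, which cost 0, to form a double sequence indexed by
  \<open>nat \<times> nat\<close>.\<close>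

lemma hausdorff_measure_limsup_zero:
  fixes U :: "nat \<Rightarrow> 'i \<Rightarrow> 'a::metric_space set"
  assumes fin: "\<And>q. finite (F q)"
    and cov: "\<And>N. A \<subseteq> (\<Union>q\<in>{N..}. \<Union>f\<in>F q. U q f)"
    and bdd: "\<And>q f. q > 0 \<Longrightarrow> f \<in> F q \<Longrightarrow> bounded (U q f) \<and> diameter (U q f) \<le> d q"
    and d: "d \<longlonglongrightarrow> 0"
    and B: "\<And>q. q > 0 \<Longrightarrow> (\<Sum>f\<in>F q. diam_pow s (U q f)) \<le> ennreal (B q)" "summable B" "\<And>q. B q \<ge> 0"
  shows "hausdorff_measure s A = 0"
proof -
  have "hausdorff_premeasure \<delta> s A \<le> ennreal \<eta>" if \<delta>: "\<delta> > 0" and \<eta>: "\<eta> > 0" for \<delta> \<eta>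
  proof -
    obtain N1 where N1: "\<And>n. n \<ge> N1 \<Longrightarrow> norm (\<Sum>i. B (i + n)) < \<eta>"
      using suminf_exist_split[OF \<eta> B(2)] by blast
    obtain N2 where N2: "\<And>n. n \<ge> N2 \<Longrightarrow> d n < \<delta>"
      using order_tendstoD(2)[OF d \<delta>] by (auto simp: eventually_sequentially)
    define N where "N = N1 + N2 + 1"
    obtain h where h: "\<And>q. bij_betw (h q) {0..<card (F q)} (F q)"
      using ex_bij_betw_nat_finite[OF fin] by metis
    define V where "V = (\<lambda>(q, k). if k < card (F (q + N)) then U (q + N) (h (q + N) k) else {})"
    have hF: "h q k \<in> F q" if "k < card (F q)" for q k using bij_betwE[OF h[of q]] that by auto
    have "hausdorff_premeasure \<delta> s A \<le> (\<Sum>i. diam_pow s (V (prod_decode i)))"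
      unfolding hausdorff_premeasure_def
    proof (rule INF_lower, rule CollectI, intro conjI allI)
      show "A \<subseteq> (\<Union>i. V (prod_decode i))"
      proof
        fix x assume "x \<in> A"
        then obtain q f where q: "q \<ge> N" "f \<in> F q" "x \<in> U q f" using cov[of N] by auto
        have "f \<in> h q ` {0..<card (F q)}" using h[of q] q(2) by (simp add: bij_betw_def)
        then obtain k where k: "k < card (F q)" "h q k = f" by auto
        have "x \<in> V (q - N, k)" using q k by (simp add: V_def)
        then show "x \<in> (\<Union>i. V (prod_decode i))" by (intro UN_I[of "prod_encode (q - N, k)"]) auto
      qed
      fix i
      obtain q k where qk: "prod_decode i = (q, k)" by force
      have "d (q + N) < \<delta>" using N2 by (simp add: N_def)
      moreover have "q + N > 0" by (simp add: N_def)
      ultimately have "k < card (F (q + N)) \<Longrightarrow> bounded (U (q + N) (h (q + N) k)) \<and> diameter (U (q + N) (h (q + N) k)) \<le> \<delta>"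
        using bdd[of "q + N" "h (q + N) k"] hF[of k "q + N"] by force
      then show "bounded (V (prod_decode i))" "diameter (V (prod_decode i)) \<le> \<delta>"
        using \<delta> by (auto simp: qk V_def)
    qed
    also have "\<dots> = (\<Sum>q. \<Sum>k. diam_pow s (V (q, k)))"
      by (rule suminf_ennreal_2dimen) simp
    also have "\<dots> \<le> (\<Sum>q. ennreal (B (q + N)))"
    proof (rule suminf_le)
      fix q
      have "(\<Sum>k. diam_pow s (V (q, k))) = (\<Sum>k\<in>{0..<card (F (q + N))}. diam_pow s (V (q, k)))"
        by (rule suminf_finite) (auto simp: V_def diam_pow_def)
      also have "\<dots> = (\<Sum>k\<in>{0..<card (F (q + N))}. diam_pow s (U (q + N) (h (q + N) k)))"
        by (intro sum.cong) (auto simp: V_def)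
      also have "\<dots> = (\<Sum>f\<in>F (q + N). diam_pow s (U (q + N) f))"
        by (rule sum.reindex_bij_betw[OF h])
      also have "\<dots> \<le> ennreal (B (q + N))" by (rule B) (simp add: N_def)
      finally show "(\<Sum>k. diam_pow s (V (q, k))) \<le> ennreal (B (q + N))" .
    qed auto
    also have "\<dots> = ennreal (\<Sum>q. B (q + N))"
      using B summable_ignore_initial_segment[OF B(2), of N] by (intro suminf_ennreal2) auto
    also have "\<dots> \<le> ennreal \<eta>" using N1[of N] by (intro ennreal_leI) (auto simp: N_def)
    finally show ?thesis .
  qed
  then have "hausdorff_premeasure \<delta> s A = 0" if "\<delta> > 0" for \<delta>
    using that by (metis ennreal_0 ennreal_le_epsilon le_zero_eq add.left_neutral zero_less_one)
  then show ?thesis unfolding hausdorff_measure_def by (simp add: SUP_constant)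
qed

text \<open>The boolean \<open>\<sigma>\<close> selects one of the two slabs into which the shell around \<open>p / q\<close> splits in direction \<open>j\<close>.\<close>
lemma limsup_boxes_hausdorff_measure_zero:
  fixes A :: "(real ^ 'n::finite) set" and tt :: "'n \<Rightarrow> 'n \<Rightarrow> real" and sh :: "nat \<Rightarrow> 'n \<Rightarrow> bool \<Rightarrow> 'n \<Rightarrow> real"
  assumes s: "s > 0" and tt: "\<And>j i. tt j i > 0"
    and k: "\<And>j. \<exists>k. real CARD('n) + 1 + (\<Sum>i\<in>UNIV. max 0 (tt j k - tt j i)) < s * (1 + tt j k)"
    and cov: "\<And>x N. x \<in> A \<Longrightarrow> \<exists>q>N. \<exists>j \<sigma>. \<exists>p :: 'n \<Rightarrow> int. (\<forall>i. - 1 \<le> p i \<and> p i \<le> int q + 1) \<and>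
       (\<forall>i. p i / real q + sh q j \<sigma> i \<le> x $ i \<and> x $ i \<le> p i / real q + sh q j \<sigma> i + 2 * real q powr (- 1 - tt j i))"
  shows "hausdorff_measure s A = 0"
proof -
  let ?n = "CARD('n)"
  obtain \<kappa> where \<kappa>: "\<And>j. real ?n + 1 + (\<Sum>i\<in>UNIV. max 0 (tt j (\<kappa> j) - tt j i)) < s * (1 + tt j (\<kappa> j))"
    using k by metis
  define T where "T j = tt j (\<kappa> j)" for j
  define r where "r q j = real q powr (- 1 - T j)" for q :: nat and j
  have T: "T j > 0" for j using tt by (simp add: T_def)
  define P where "P q = {p :: 'n \<Rightarrow> int. \<forall>i. p i \<in> {- 1..int q + 1}}" for q :: nat
  \<comment> \<open>\<open>m\<close> numbers the cubes of side \<open>r q j\<close> into which a box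
    with sides \<open>2 * real q powr (- 1 - tt j i)\<close> is cut.\<close>
  define M where "M q j = {m :: 'n \<Rightarrow> int. \<forall>i. m i \<in> {0..\<lfloor>2 * real q powr (- 1 - tt j i) / r q j\<rfloor>}}" for q :: nat and j
  define F where "F q = (SIGMA j:(UNIV :: 'n set). (UNIV :: bool set) \<times> P q \<times> M q j)" for q
  define U where "U q = (\<lambda>(j, \<sigma>, p :: 'n \<Rightarrow> int, m :: 'n \<Rightarrow> int). {x :: real ^ 'n. \<forall>i. p i / real q + sh q j \<sigma> i + m i * r q j \<le> x $ i
      \<and> x $ i \<le> p i / real q + sh q j \<sigma> i + (real_of_int (m i) + 1) * r q j})" for q
  \<comment> \<open>Numerators contribute the exponent \<open>n\<close>, cubes per box the sum, and
    the diameters \<open>- s * (1 + T j)\<close>. The choice of \<open>\<kappa>\<close> means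
    \<open>e j < - 1\<close>, hence summability. In \<open>B\<close>, 2 counts the slabs and 12 is
    \<open>4 * 3\<close>, from \<open>q + 3 \<le> 4 * q\<close> numerators and at most
    \<open>3 * q powr max 0 (T j - tt j i)\<close> cubes per direction.\<close>
  define e where "e j = real ?n + (\<Sum>i\<in>UNIV. max 0 (T j - tt j i)) - s * (1 + T j)" for j
  define B where "B q = (\<Sum>j\<in>(UNIV :: 'n set). 2 * 12 ^ ?n * real ?n powr s * real q powr e j)" for q :: nat
  have finP: "finite (P q)" and finM: "finite (M q j)" for q j
    unfolding P_def M_def by (rule card_dependent_functions; simp)+
  have rpos: "r q j > 0" if "q > 0" for q j using that by (simp add: r_def)
  have diam: "norm (x - y) \<le> ?n * r q j" if "x \<in> U q (j, \<sigma>, p, m)" "y \<in> U q (j, \<sigma>, p, m)" for x y q j \<sigma> p m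
  proof -
    have "\<bar>(x - y) $ i\<bar> \<le> r q j" for i
    proof -
      have "p i / real q + sh q j \<sigma> i + m i * r q j \<le> x $ i \<and> x $ i \<le> p i / real q + sh q j \<sigma> i + (real_of_int (m i) + 1) * r q j"
        "p i / real q + sh q j \<sigma> i + m i * r q j \<le> y $ i \<and> y $ i \<le> p i / real q + sh q j \<sigma> i + (real_of_int (m i) + 1) * r q j"
        using that by (auto simp: U_def)
      then show ?thesis unfolding distrib_right vector_minus_component abs_le_iff by linarith
    qed
    then have "(\<Sum>i\<in>UNIV. \<bar>(x - y) $ i\<bar>) \<le> (\<Sum>i\<in>(UNIV :: 'n set). r q j)" by (intro sum_mono)
    moreover have "norm (x - y) \<le> (\<Sum>i\<in>UNIV. \<bar>(x - y) $ i\<bar>)" by (rule norm_le_l1_cart)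
    ultimately show ?thesis by simp
  qed
  have bdd: "bounded (U q (j, \<sigma>, p, m))" and dia: "diameter (U q (j, \<sigma>, p, m)) \<le> ?n * r q j" for q j \<sigma> p m
  proof -
    show "diameter (U q (j, \<sigma>, p, m)) \<le> ?n * r q j"
      by (rule diameter_le) (use diam in \<open>auto simp: r_def\<close>)
    show "bounded (U q (j, \<sigma>, p, m))"
    proof (cases "U q (j, \<sigma>, p, m) = {}")
      case False
      then obtain y where "y \<in> U q (j, \<sigma>, p, m)" by blast
      then have "U q (j, \<sigma>, p, m) \<subseteq> cball y (?n * r q j)" using diam by (auto simp: dist_norm)
      then show ?thesis using bounded_cball bounded_subset by blast
    qed simp
  qed
  show ?thesis
  proof (rule hausdorff_measure_limsup_zero)
    show "finite (F q)" for q unfolding F_def using finP finM by auto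
    show "A \<subseteq> (\<Union>q\<in>{N..}. \<Union>f\<in>F q. U q f)" for N
    proof
      fix x assume "x \<in> A"
      obtain q j \<sigma> and p :: "'n \<Rightarrow> int" where q: "q > N" "\<And>i. - 1 \<le> p i \<and> p i \<le> int q + 1"
        and x: "\<And>i. p i / real q + sh q j \<sigma> i \<le> x $ i \<and> x $ i \<le> p i / real q + sh q j \<sigma> i + 2 * real q powr (- 1 - tt j i)"
        using cov[OF \<open>x \<in> A\<close>, of N] by blast
      have q0: "q > 0" using q by simp
      define m where "m i = \<lfloor>(x $ i - (p i / real q + sh q j \<sigma> i)) / r q j\<rfloor>" for i
      have "m i \<in> {0..\<lfloor>2 * real q powr (- 1 - tt j i) / r q j\<rfloor>}" for i
      proof -
        have "0 \<le> (x $ i - (p i / real q + sh q j \<sigma> i)) / r q j" 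
          "(x $ i - (p i / real q + sh q j \<sigma> i)) / r q j \<le> 2 * real q powr (- 1 - tt j i) / r q j"
          using x[of i] rpos[OF q0, of j] by (auto intro!: divide_nonneg_pos divide_right_mono)
        then show ?thesis by (auto simp: m_def floor_mono)
      qed
      then have "(j, \<sigma>, p, m) \<in> F q" using q by (auto simp: F_def P_def M_def)
      moreover have "x \<in> U q (j, \<sigma>, p, m)"
      proof -
        have "p i / real q + sh q j \<sigma> i + m i * r q j \<le> x $ i \<and> x $ i \<le> p i / real q + sh q j \<sigma> i + (real_of_int (m i) + 1) * r q j" for i
        proof -
          define y where "y = (x $ i - (p i / real q + sh q j \<sigma> i)) / r q j"
          have "x $ i = p i / real q + sh q j \<sigma> i + y * r q j" using rpos[OF q0, of j] by (simp add: y_def)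
          moreover have "m i * r q j \<le> y * r q j" "y * r q j \<le> (real_of_int (m i) + 1) * r q j"
            using rpos[OF q0, of j] by (auto simp: m_def y_def[symmetric] intro!: mult_right_mono)
          ultimately show ?thesis by linarith
        qed
        then show ?thesis by (simp add: U_def)
      qed
      ultimately show "x \<in> (\<Union>q\<in>{N..}. \<Union>f\<in>F q. U q f)" using q(1) by (intro UN_I[of q]) (auto intro: UN_I)
    qed
    show "bounded (U q f) \<and> diameter (U q f) \<le> ?n / real q" if "q > 0" "f \<in> F q" for q f
    proof -
      obtain j \<sigma> p m where f: "f = (j, \<sigma>, p, m)" by (cases f) auto
      have "r q j \<le> real q powr (- 1)" unfolding r_def using that T[of j] by (intro powr_mono) auto
      then have "?n * r q j \<le> ?n * (1 / real q)" using that by (intro mult_left_mono) (auto simp: powr_minus_divide)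
      then show ?thesis using bdd dia[of q j \<sigma> p m] unfolding f by auto
    qed
    show "(\<lambda>q. ?n / real q) \<longlonglongrightarrow> 0" by (rule lim_const_over_n)
    show "B q \<ge> 0" for q unfolding B_def by (intro sum_nonneg) auto
    have "e j < - 1" for j using \<kappa>[of j] by (simp add: e_def T_def)
    then show "summable B" unfolding B_def by (intro summable_sum summable_mult) (simp add: summable_real_powr_iff)
    show "(\<Sum>f\<in>F q. diam_pow s (U q f)) \<le> ennreal (B q)" if q: "q > 0" for q
    proof -
      have dp: "diam_pow s (U q (j, f)) \<le> ennreal ((?n * r q j) powr s)" for j f
      proof -
        obtain \<sigma> p m where f: "f = (\<sigma>, p, m)" by (cases f) auto
        have "diameter (U q (j, f)) powr s \<le> (?n * r q j) powr s"
          unfolding f using s by (intro powr_mono2 dia diameter_ge_0 bdd) auto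
        then show ?thesis using s by (auto simp: diam_pow_def intro: ennreal_leI)
      qed
      have "(\<Sum>f\<in>F q. diam_pow s (U q f)) = (\<Sum>j\<in>UNIV. \<Sum>f\<in>(UNIV :: bool set) \<times> P q \<times> M q j. diam_pow s (U q (j, f)))"
        unfolding F_def by (subst sum.Sigma) (use finP finM in \<open>auto simp: case_prod_beta\<close>)
      also have "\<dots> \<le> (\<Sum>j\<in>UNIV. \<Sum>f\<in>(UNIV :: bool set) \<times> P q \<times> M q j. ennreal ((?n * r q j) powr s))"
        by (intro sum_mono dp)
      also have "\<dots> = (\<Sum>j\<in>UNIV. ennreal (real (card ((UNIV :: bool set) \<times> P q \<times> M q j)) * (?n * r q j) powr s))"
        by (simp add: ennreal_of_nat_eq_real_of_nat ennreal_mult del: card_cartesian_product)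
      also have "\<dots> = ennreal (\<Sum>j\<in>UNIV. real (card ((UNIV :: bool set) \<times> P q \<times> M q j)) * (?n * r q j) powr s)"
        by (rule sum_ennreal) auto
      also have "\<dots> \<le> ennreal (B q)"
        unfolding B_def
      proof (intro ennreal_leI sum_mono)
        fix j
        have "real (card (P q)) \<le> (\<Prod>i\<in>(UNIV :: 'n set). 4 * real q)"
          unfolding P_def card_dependent_functions(2)[of "\<lambda>_. {- 1..int q + 1}", OF finite_atLeastAtMost_int] of_nat_prod
          using q by (intro prod_mono) auto
        then have cP: "real (card (P q)) \<le> 4 ^ ?n * real q powr ?n" using q by (simp add: power_mult_distrib powr_realpow)
        have "real (card (M q j)) \<le> (\<Prod>i\<in>UNIV. 3 * real q powr (max 0 (T j - tt j i)))"
          unfolding M_def card_dependent_functions(2)[of "\<lambda>i. {0..\<lfloor>2 * real q powr (- 1 - tt j i) / r q j\<rfloor>}", OF finite_atLeastAtMost_int] of_nat_prod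
        proof (rule prod_mono, rule conjI)
          fix i
          let ?y = "2 * real q powr (- 1 - tt j i) / r q j"
          have y0: "?y \<ge> 0" using rpos[OF q, of j] by simp
          then have 1: "real (card {0..\<lfloor>?y\<rfloor>}) \<le> ?y + 1" by simp
          have "?y = 2 * real q powr (T j - tt j i)" unfolding r_def
            by (simp only: times_divide_eq_right[symmetric] powr_diff[symmetric]) simp
          also have "\<dots> \<le> 2 * real q powr (max 0 (T j - tt j i))" using q by (intro mult_left_mono powr_mono) auto
          finally have 2: "?y \<le> 2 * real q powr (max 0 (T j - tt j i))" .
          have "1 \<le> real q powr (max 0 (T j - tt j i))" using q by (intro ge_one_powr_ge_zero) auto
          then show "real (card {0..\<lfloor>?y\<rfloor>}) \<le> 3 * real q powr (max 0 (T j - tt j i))" using 1 2 by linarith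
        qed simp
        also have "\<dots> = 3 ^ ?n * real q powr (\<Sum>i\<in>UNIV. max 0 (T j - tt j i))"
          using q by (simp add: prod.distrib prod_powr_const)
        finally have cM: "real (card (M q j)) \<le> 3 ^ ?n * real q powr (\<Sum>i\<in>UNIV. max 0 (T j - tt j i))" .
        have "(?n * r q j) powr s = real ?n powr s * real q powr (- s * (1 + T j))"
          using q by (simp add: powr_mult r_def powr_powr algebra_simps)
        then have "real (card ((UNIV :: bool set) \<times> P q \<times> M q j)) * (?n * r q j) powr s
           = 2 * (real (card (P q)) * real (card (M q j))) * (real ?n powr s * real q powr (- s * (1 + T j)))"
          by (simp add: card_cartesian_product)
        also have "\<dots> \<le> 2 * ((4 ^ ?n * real q powr ?n) * (3 ^ ?n * real q powr (\<Sum>i\<in>UNIV. max 0 (T j - tt j i)))) * (real ?n powr s * real q powr (- s * (1 + T j)))"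
          by (intro mult_mono mult_right_mono mult_left_mono cP cM) auto
        also have "2 * ((4 ^ ?n * real q powr ?n) * (3 ^ ?n * real q powr (\<Sum>i\<in>UNIV. max 0 (T j - tt j i)))) * (real ?n powr s * real q powr (- s * (1 + T j)))
          = 2 * (4 ^ ?n * 3 ^ ?n) * real ?n powr s * (real q powr ?n * real q powr (\<Sum>i\<in>UNIV. max 0 (T j - tt j i)) * real q powr (- s * (1 + T j)))"
          by (simp only: mult_ac)
        also have "real q powr ?n * real q powr (\<Sum>i\<in>UNIV. max 0 (T j - tt j i)) * real q powr (- s * (1 + T j)) = real q powr e j"
          by (simp add: e_def flip: powr_add)
        also have "(4::real) ^ ?n * 3 ^ ?n = 12 ^ ?n" by (simp flip: power_mult_distrib)
        finally show "real (card ((UNIV :: bool set) \<times> P q \<times> M q j)) * (?n * r q j) powr s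
            \<le> 2 * 12 ^ ?n * real ?n powr s * real q powr e j" .
      qed
      finally show ?thesis .
    qed
  qed
qed

section \<open>The dimension formula\<close>

lemma hausdorff_measure_mono:
  assumes "A \<subseteq> B"
  shows "hausdorff_measure s A \<le> hausdorff_measure s B"
  unfolding hausdorff_measure_def hausdorff_premeasure_def
  by (intro SUP_mono' INF_superset_mono) (use assms in auto)

lemma hausdorff_dim_eqI:
  assumes "m \<ge> 0"
    and "\<And>s. s > m \<Longrightarrow> hausdorff_measure s A = 0"
    and "\<And>s. 0 \<le> s \<Longrightarrow> s < m \<Longrightarrow> hausdorff_measure s A \<noteq> 0"
  shows "hausdorff_dim A = ereal m"
  unfolding hausdorff_dim_def
proof (rule antisym)
  let ?S = "{ereal s | s. 0 \<le> s \<and> hausdorff_measure s A = 0}"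
  show "Inf ?S \<le> ereal m"
  proof (rule ereal_le_epsilon2)
    show "Inf ?S \<le> ereal m + ereal e" if "0 < e" for e
      using assms(1) assms(2)[of "m + e"] that by (intro Inf_lower) auto
  qed
  show "ereal m \<le> Inf ?S"
  proof (intro Inf_greatest, clarify)
    fix s assume "0 \<le> s" "hausdorff_measure s A = 0"
    then have "\<not> s < m" using assms(3) by blast
    then show "ereal m \<le> ereal s" by simp
  qed
qed

text \<open>The separate maximum in the formula is the missing summand \<open>i = j\<close>, because
  \<open>tau_k\<close> at \<open>k = j\<close> is \<open>\<tau>\<psi> j + \<tau>\<phi> j\<close>.
  What results is symmetric in the side exponents.\<close>

lemma sum_max_tau_k:
  fixes \<tau>\<psi> \<tau>\<phi> :: "'n::finite \<Rightarrow> real"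
  shows "(\<Sum>i | i \<noteq> j \<and> \<tau>\<psi> i < T. T - \<tau>\<psi> i) + max 0 (T - \<tau>\<psi> j - \<tau>\<phi> j)
     = (\<Sum>i\<in>UNIV. max 0 (T - tau_k \<tau>\<psi> \<tau>\<phi> i j))"
proof -
  have "(\<Sum>i\<in>UNIV. max 0 (T - tau_k \<tau>\<psi> \<tau>\<phi> i j))
      = max 0 (T - tau_k \<tau>\<psi> \<tau>\<phi> j j) + (\<Sum>i\<in>UNIV - {j}. max 0 (T - tau_k \<tau>\<psi> \<tau>\<phi> i j))"
    by (rule sum.remove) auto
  also have "(\<Sum>i\<in>UNIV - {j}. max 0 (T - tau_k \<tau>\<psi> \<tau>\<phi> i j)) = (\<Sum>i\<in>UNIV - {j}. max 0 (T - \<tau>\<psi> i))"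
    by (intro sum.cong) (auto simp: tau_k_def)
  also have "\<dots> = (\<Sum>i | i \<noteq> j \<and> \<tau>\<psi> i < T. max 0 (T - \<tau>\<psi> i))"
    by (rule sum.mono_neutral_right) (auto simp: max_def)
  also have "\<dots> = (\<Sum>i | i \<noteq> j \<and> \<tau>\<psi> i < T. T - \<tau>\<psi> i)"
    by (intro sum.cong) auto
  finally show ?thesis by (simp add: tau_k_def diff_diff_eq)
qed

section \<open>Passing between \<open>W_set\<close> and translated boxes\<close>

lemma powr_minus_div: "real q powr (- a) / real q = real q powr (- 1 - a)" if "q > 0"
  using that by (simp add: powr_diff powr_minus field_simps)

text \<open>Outer minus inner radius of the shell is the product of both functions divided by
  \<open>q\<close>; this is why the exponents add up in direction \<open>j\<close>.\<close>

lemma powr_shell_width: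
  "real q powr (- 1 - a) - (1 - real q powr (- b)) * real q powr (- a) / real q = real q powr (- 1 - (a + b))" if "q > 0"
proof -
  have "real q powr (- 1 - a) = real q powr (- a) / real q" using powr_minus_div[OF that] by simp
  moreover have "real q powr (- 1 - (a + b)) = real q powr (- b) * real q powr (- a) / real q"
    using powr_minus_div[OF that, of "a + b"] by (simp add: powr_add[symmetric] algebra_simps)
  ultimately show ?thesis by (simp add: left_diff_distrib diff_divide_distrib)
qed

text \<open>For \<open>x\<close> in the unit cube, errors below \<open>1 / q\<close> confine each
  numerator to the range from \<open>- 1\<close> to \<open>q + 1\<close>. So each \<open>q\<close>
  occurs with finitely many \<open>p\<close> only, and infinitely many pairs force \<open>q\<close>
  to be unbounded.\<close>

lemma W_set_approximations:
  fixes \<tau>\<psi> \<tau>\<phi> :: "'n::finite \<Rightarrow> real" and x :: "real ^ 'n"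
  assumes \<psi>: "\<And>i. \<tau>\<psi> i > 0"
    and x: "x \<in> W_set (\<lambda>i q. real q powr (- \<tau>\<psi> i)) (\<lambda>i q. real q powr (- \<tau>\<phi> i))"
  obtains q j and p :: "'n \<Rightarrow> int" where "q > N" "\<And>i. - 1 \<le> p i \<and> p i \<le> int q + 1"
    "\<And>i. \<bar>x $ i - p i / real q\<bar> < real q powr (- 1 - \<tau>\<psi> i)"
    "\<bar>x $ j - p j / real q\<bar> > (1 - real q powr (- \<tau>\<phi> j)) * real q powr (- \<tau>\<psi> j) / real q"
proof -
  define S where "S = {(p :: int ^ 'n, q :: nat). q > 0 \<and>
       (\<forall>i. \<bar>x $ i - real_of_int (p $ i) / real q\<bar> < real q powr (- \<tau>\<psi> i) / real q) \<and>
       (\<exists>j. \<bar>x $ j - real_of_int (p $ j) / real q\<bar> > (1 - real q powr (- \<tau>\<phi> j)) * real q powr (- \<tau>\<psi> j) / real q)}"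
  have S: "infinite S" and x01: "\<And>i. 0 \<le> x $ i \<and> x $ i \<le> 1" using x by (auto simp: W_set_def S_def)
  have bnd: "- 1 \<le> p $ i \<and> p $ i \<le> int q + 1" if "(p, q) \<in> S" for p q i
  proof -
    have q: "q > 0" and "\<bar>x $ i - real_of_int (p $ i) / real q\<bar> < real q powr (- \<tau>\<psi> i) / real q"
      using that by (auto simp: S_def)
    note this(2)
    also have "real q powr (- \<tau>\<psi> i) \<le> real q powr 0" using q \<psi>[of i] by (intro powr_mono) auto
    then have "real q powr (- \<tau>\<psi> i) / real q \<le> 1 / real q" using q by (intro divide_right_mono) auto
    finally have "real q * \<bar>x $ i - real_of_int (p $ i) / real q\<bar> < real q * (1 / real q)"
      using q by (intro mult_strict_left_mono) auto
    then have "\<bar>real q * x $ i - real_of_int (p $ i)\<bar> < 1"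
      using q by (simp add: abs_mult[of "real q", simplified, symmetric] right_diff_distrib)
    moreover have "0 \<le> real q * x $ i" "real q * x $ i \<le> real q * 1" using x01[of i] by (simp, intro mult_left_mono) auto
    ultimately have "- 1 < real_of_int (p $ i)" "real_of_int (p $ i) < real_of_int (int q + 1)" by (simp_all add: abs_less_iff)
    then show ?thesis by linarith
  qed
  have "\<exists>z\<in>S. snd z > N"
  proof (rule ccontr)
    assume "\<not> ?thesis"
    then have le: "\<And>p q. (p, q) \<in> S \<Longrightarrow> q \<le> N" by fastforce
    let ?C = "{f :: 'n \<Rightarrow> int. \<forall>i. f i \<in> {- 1..int N + 1}}"
    have "S \<subseteq> (\<lambda>f. \<chi> i. f i) ` ?C \<times> {..N}"
    proof
      fix z assume "z \<in> S"
      then obtain p q where z: "z = (p, q)" "(p, q) \<in> S" by (cases z) auto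
      have "- 1 \<le> p $ i \<and> p $ i \<le> int N + 1" for i using bnd[OF z(2), of i] le[OF z(2)] by linarith
      then have "(\<lambda>i. p $ i) \<in> ?C" by simp
      moreover have "p = (\<chi> i. p $ i)" by simp
      ultimately have "p \<in> (\<lambda>f. \<chi> i. f i) ` ?C" by (intro image_eqI[where x = "\<lambda>i. p $ i"])
      then show "z \<in> (\<lambda>f. \<chi> i. f i) ` ?C \<times> {..N}" using le[OF z(2)] z(1) by auto
    qed
    moreover have "finite ?C" by (rule card_dependent_functions) simp
    ultimately have "finite S" by (meson finite_SigmaI finite_atMost finite_imageI finite_subset)
    then show False using S by simp
  qed
  then obtain p q where pq: "(p, q) \<in> S" "q > N" by force
  then obtain j where "\<bar>x $ j - real_of_int (p $ j) / real q\<bar> > (1 - real q powr (- \<tau>\<phi> j)) * real q powr (- \<tau>\<psi> j) / real q"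
    by (auto simp: S_def)
  moreover have "\<bar>x $ i - p $ i / real q\<bar> < real q powr (- 1 - \<tau>\<psi> i)" for i
  proof -
    have "q > 0" "\<bar>x $ i - real_of_int (p $ i) / real q\<bar> < real q powr (- \<tau>\<psi> i) / real q" using pq(1) by (auto simp: S_def)
    then show ?thesis using powr_minus_div[of q "\<tau>\<psi> i"] by simp
  qed
  ultimately show ?thesis using that[of q "\<lambda>i. p $ i" j] pq(2) bnd[OF pq(1)] by blast
qed

text \<open>The shift \<open>sh\<close> is the inner radius of the shell in direction
  \<open>j\<close>, so the box is the slab to the right of \<open>p j / q\<close>; in the other
  directions it is the right half of the allowed interval.\<close>

lemma limsup_boxes_subset_W_set:
  fixes \<tau>\<psi> \<tau>\<phi> :: "'n::finite \<Rightarrow> real" and j :: 'n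
  assumes \<phi>: "\<tau>\<phi> j > 0"
  defines "sh \<equiv> \<lambda>q i. if i = j then (1 - real q powr (- \<tau>\<phi> j)) * real q powr (- \<tau>\<psi> j) / real q else 0"
  shows "{x :: real ^ 'n. (\<forall>i. 0 \<le> x $ i \<and> x $ i \<le> 1) \<and> (\<forall>m::nat. \<exists>q>m. \<exists>p :: 'n \<Rightarrow> int.
     \<forall>i. p i / real q + sh q i < x $ i
       \<and> x $ i < p i / real q + sh q i + real q powr (- 1 - tau_k \<tau>\<psi> \<tau>\<phi> i j))}
    \<subseteq> W_set (\<lambda>i q. real q powr (- \<tau>\<psi> i)) (\<lambda>i q. real q powr (- \<tau>\<phi> i))" (is "?V \<subseteq> ?W")
proof
  fix x assume x: "x \<in> ?V"
  define S where "S = {(p :: int ^ 'n, q :: nat). q > 0 \<and>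
       (\<forall>i. \<bar>x $ i - real_of_int (p $ i) / real q\<bar> < real q powr (- \<tau>\<psi> i) / real q) \<and>
       (\<exists>j. \<bar>x $ j - real_of_int (p $ j) / real q\<bar> > (1 - real q powr (- \<tau>\<phi> j)) * real q powr (- \<tau>\<psi> j) / real q)}"
  have ex: "\<exists>z\<in>S. snd z > m" for m
  proof -
    obtain q and p :: "'n \<Rightarrow> int" where q: "q > m" and p: "\<And>i. p i / real q + sh q i < x $ i
       \<and> x $ i < p i / real q + sh q i + real q powr (- 1 - tau_k \<tau>\<psi> \<tau>\<phi> i j)"
      using x by blast
    have q0: "q > 0" using q by simp
    have "real q powr (- \<tau>\<phi> j) \<le> real q powr 0" using q0 \<phi> by (intro powr_mono) auto
    then have nn: "(1 - real q powr (- \<tau>\<phi> j)) * real q powr (- \<tau>\<psi> j) / real q \<ge> 0" using q0 by simp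
    have "\<bar>x $ i - p i / real q\<bar> < real q powr (- \<tau>\<psi> i) / real q" for i
    proof (cases "i = j")
      case True
      then show ?thesis using p[of j] nn powr_shell_width[OF q0, of "\<tau>\<psi> j" "\<tau>\<phi> j"] powr_minus_div[OF q0, of "\<tau>\<psi> j"]
        by (auto simp: sh_def tau_k_def abs_less_iff)
    next
      case False
      then show ?thesis using p[of i] powr_minus_div[OF q0, of "\<tau>\<psi> i"] powr_ge_zero[of "real q" "- 1 - \<tau>\<psi> i"]
        by (auto simp: sh_def tau_k_def abs_less_iff)
    qed
    moreover have "\<bar>x $ j - p j / real q\<bar> > (1 - real q powr (- \<tau>\<phi> j)) * real q powr (- \<tau>\<psi> j) / real q"
      using p[of j] nn by (simp add: sh_def)
    ultimately have "((\<chi> i. p i), q) \<in> S" using q0 by (auto simp: S_def)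
    then show ?thesis using q by force
  qed
  have "infinite S"
  proof
    assume "finite S"
    then have "finite (snd ` S)" by simp
    then obtain m where "\<And>q. q \<in> snd ` S \<Longrightarrow> q \<le> m" by (meson finite_nat_set_iff_bounded_le)
    then show False using ex[of m] by fastforce
  qed
  then show "x \<in> ?W" using x by (simp add: W_set_def S_def)
qed

theorem theorem1p3:
  fixes \<tau>\<psi> \<tau>\<phi> :: "'n::finite \<Rightarrow> real"
  assumes "\<And>i. \<tau>\<psi> i > 0"
    and "\<And>i. \<tau>\<phi> i > 0"
    and "(\<Sum>i\<in>UNIV. \<tau>\<psi> i) \<ge> 1"
  shows "hausdorff_dim (W_set (\<lambda>i q. real q powr (- \<tau>\<psi> i)) (\<lambda>i q. real q powr (- \<tau>\<phi> i))) =
    ereal (MAX j. MIN k.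
      (real CARD('n) + 1
        + (\<Sum>i | i \<noteq> j \<and> \<tau>\<psi> i < tau_k \<tau>\<psi> \<tau>\<phi> k j. tau_k \<tau>\<psi> \<tau>\<phi> k j - \<tau>\<psi> i)
        + max 0 (tau_k \<tau>\<psi> \<tau>\<phi> k j - \<tau>\<psi> j - \<tau>\<phi> j))
      / (1 + tau_k \<tau>\<psi> \<tau>\<phi> k j))"
proof -
  let ?n = "CARD('n)"
  let ?W = "W_set (\<lambda>i q. real q powr (- \<tau>\<psi> i)) (\<lambda>i q. real q powr (- \<tau>\<phi> i)) :: (real ^ 'n) set"
  define tt where "tt j i = tau_k \<tau>\<psi> \<tau>\<phi> i j" for j i
  define D where "D j k = (real ?n + 1 + (\<Sum>i\<in>UNIV. max 0 (tt j k - tt j i))) / (1 + tt j k)" for j k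
  define d where "d = (MAX j. MIN k. D j k)"
  have tt: "tt j i > 0" for j i using assms(1)[of i] assms(1)[of j] assms(2)[of j] by (auto simp: tt_def tau_k_def)
  have ttsum: "(\<Sum>i\<in>UNIV. tt j i) \<ge> 1" for j
  proof -
    have "(\<Sum>i\<in>UNIV. \<tau>\<psi> i) \<le> (\<Sum>i\<in>UNIV. tt j i)"
      using assms(2)[of j] by (intro sum_mono) (auto simp: tt_def tau_k_def)
    then show ?thesis using assms(3) by linarith
  qed
  have Deq: "(MAX j. MIN k.
      (real ?n + 1
        + (\<Sum>i | i \<noteq> j \<and> \<tau>\<psi> i < tau_k \<tau>\<psi> \<tau>\<phi> k j. tau_k \<tau>\<psi> \<tau>\<phi> k j - \<tau>\<psi> i)
        + max 0 (tau_k \<tau>\<psi> \<tau>\<phi> k j - \<tau>\<psi> j - \<tau>\<phi> j))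
      / (1 + tau_k \<tau>\<psi> \<tau>\<phi> k j)) = d"
    unfolding d_def D_def tt_def sum_max_tau_k[symmetric] by (simp only: add.assoc)
  have Dpos: "D j k > 0" for j k
    unfolding D_def using tt[of j k] by (intro divide_pos_pos add_pos_nonneg sum_nonneg) auto
  have minD: "\<exists>k. (MIN k. D j k) = D j k" for j
  proof -
    have "(MIN k. D j k) \<in> range (D j)" by (rule Min_in) auto
    then show ?thesis by blast
  qed
  have "hausdorff_dim ?W = ereal d"
  proof (rule hausdorff_dim_eqI)
    have "(MIN k. D undefined k) \<ge> 0" using minD[of undefined] Dpos by (metis less_imp_le)
    also have "(MIN k. D undefined k) \<le> d" unfolding d_def by (rule Max_ge) auto
    finally show "d \<ge> 0" .
    fix s assume s: "s > d"
    show "hausdorff_measure s ?W = 0"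
    proof (rule limsup_boxes_hausdorff_measure_zero[where tt = tt])
      show "s > 0" using s \<open>d \<ge> 0\<close> by linarith
      show "\<exists>k. real ?n + 1 + (\<Sum>i\<in>UNIV. max 0 (tt j k - tt j i)) < s * (1 + tt j k)" for j
      proof -
        obtain k where "(MIN k. D j k) = D j k" using minD by blast
        moreover have "(MIN k. D j k) \<le> d" unfolding d_def by (rule Max_ge) auto
        ultimately have "D j k < s" using s by simp
        then show ?thesis using tt[of j k] by (intro exI[of _ k]) (simp add: D_def divide_less_eq)
      qed
      fix x N assume x: "x \<in> ?W"
      obtain q j and p :: "'n \<Rightarrow> int" where q: "q > N" and p: "\<And>i. - 1 \<le> p i \<and> p i \<le> int q + 1"
        and lt: "\<And>i. \<bar>x $ i - p i / real q\<bar> < real q powr (- 1 - \<tau>\<psi> i)"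
        and gt: "\<bar>x $ j - p j / real q\<bar> > (1 - real q powr (- \<tau>\<phi> j)) * real q powr (- \<tau>\<psi> j) / real q"
        using W_set_approximations[OF assms(1) x] by metis
      \<comment> \<open>For \<open>\<sigma>\<close> true the slab starts at the inner radius to the
        right; otherwise at the outer radius to the left. In directions other than \<open>j\<close>
        the whole interval around \<open>p i / q\<close> is taken, which accounts for the factor 2
        in the side length.\<close>
      define sh where "sh q j \<sigma> i = (if i = j \<and> \<sigma> then (1 - real q powr (- \<tau>\<phi> j)) * real q powr (- \<tau>\<psi> j) / real q
         else - (real q powr (- 1 - \<tau>\<psi> i)))" for q :: nat and j \<sigma> i
      define \<sigma> where "\<sigma> \<longleftrightarrow> x $ j \<ge> p j / real q"
      have q0: "q > 0" using q by simp
      have "p i / real q + sh q j \<sigma> i \<le> x $ i \<and> x $ i \<le> p i / real q + sh q j \<sigma> i + 2 * real q powr (- 1 - tt j i)" for i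
      proof (cases "i = j")
        case True
        have "real q powr (- 1 - (\<tau>\<psi> j + \<tau>\<phi> j)) \<ge> 0" by simp
        then show ?thesis using True lt[of j] gt powr_shell_width[OF q0, of "\<tau>\<psi> j" "\<tau>\<phi> j"]
          unfolding sh_def \<sigma>_def tt_def tau_k_def by (auto simp: abs_less_iff abs_if split: if_splits)
      next
        case False
        then show ?thesis using lt[of i] by (auto simp: sh_def tt_def tau_k_def abs_less_iff)
      qed
      then show "\<exists>q>N. \<exists>j \<sigma>. \<exists>p :: 'n \<Rightarrow> int. (\<forall>i. - 1 \<le> p i \<and> p i \<le> int q + 1) \<and>
         (\<forall>i. p i / real q + sh q j \<sigma> i \<le> x $ i \<and> x $ i \<le> p i / real q + sh q j \<sigma> i + 2 * real q powr (- 1 - tt j i))"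
        using q p by blast
    qed (rule tt)
  next
    fix s assume s: "0 \<le> s" "s < d"
    \<comment> \<open>A direction \<open>j\<close> attaining the maximum suffices, since its boxes
      alone already lie in the set.\<close>
    have "d \<in> range (\<lambda>j. MIN k. D j k)" unfolding d_def by (rule Max_in) auto
    then obtain j where j: "d = (MIN k. D j k)" by blast
    have sD: "s < D j k" for k
    proof -
      have "(MIN k. D j k) \<le> D j k" by (rule Min_le) auto
      then show ?thesis using s j by simp
    qed
    have k: "s * (1 + tt j k) < real ?n + 1 + (\<Sum>i\<in>UNIV. max 0 (tt j k - tt j i))" for k
      using sD[of k] tt[of j k] by (simp add: D_def less_divide_eq)
    \<comment> \<open>At the largest \<open>tt j k\<close> every term of the sum is nonnegative, so
      the right-hand side of \<open>k\<close> is \<open>n + 1 + n * tt j k\<close> minus the sum of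
      all \<open>tt j i\<close>. That sum is at least 1, which leaves at most
      \<open>n * (1 + tt j k)\<close>.\<close>
    have sn: "s < ?n"
    proof -
      have "Max (range (tt j)) \<in> range (tt j)" by (rule Max_in) auto
      then obtain k where kk: "Max (range (tt j)) = tt j k" by blast
      have le: "tt j i \<le> tt j k" for i unfolding kk[symmetric] by (rule Max_ge) auto
      have "(\<Sum>i\<in>UNIV. max 0 (tt j k - tt j i)) = (\<Sum>i\<in>UNIV. tt j k - tt j i)"
        using le by (intro sum.cong) auto
      also have "\<dots> = ?n * tt j k - (\<Sum>i\<in>UNIV. tt j i)" by (simp add: sum_subtractf)
      finally have "s * (1 + tt j k) < real ?n * (1 + tt j k)" using k[of k] ttsum[of j] by (simp add: algebra_simps)
      then show ?thesis using tt[of j k] by (simp add: mult_less_cancel_right)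
    qed
    let ?sh = "\<lambda>q i. if i = j then (1 - real q powr (- \<tau>\<phi> j)) * real q powr (- \<tau>\<psi> j) / real q else 0"
    let ?V = "{x :: real ^ 'n. (\<forall>i. 0 \<le> x $ i \<and> x $ i \<le> 1) \<and> (\<forall>m::nat. \<exists>q>m. \<exists>p :: 'n \<Rightarrow> int.
      \<forall>i. p i / real q + ?sh q i < x $ i \<and> x $ i < p i / real q + ?sh q i + real q powr (- 1 - tt j i))}"
    have "hausdorff_measure s ?V \<noteq> 0"
      by (rule limsup_boxes_hausdorff_measure_pos) (fact tt ttsum s(1) sn k)+
    moreover have "?V \<subseteq> ?W"
      unfolding tt_def by (rule limsup_boxes_subset_W_set) (rule assms(2))
    then have "hausdorff_measure s ?V \<le> hausdorff_measure s ?W" by (rule hausdorff_measure_mono)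
    ultimately show "hausdorff_measure s ?W \<noteq> 0" by auto
  qed
  then show ?thesis using Deq by simp
qed

end
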